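(* Consider the multi-pressure Navier-Stokes system (with $\epsilon>0$ fixed) $$\begin{aligned}&\partial_t\rho+\partial_x(\rho u)=0,\\&\partial_t(\rho u)+\partial_x\Big(\rho u^2+\sum_{i=1}^Np_i\Big)=\epsilon\,\partial_x\Big(\sum_{i=1}^N\mu_i\,\partial_xu\Big),\\&\partial_t(\rho e_i)+\partial_x(\rho ue_i)+p_i\,\partial_xu=\epsilon\,\mu_i(\partial_xu)^2,\qquad 1\le i\le N,\end{aligned}$$ where the pressure and viscosity laws satisfy the positivity, convexity and asymptotic conditions listed in the context. Let $\mathbf{u}_L\in\Omega_{\mathbf{u}}$ and $\sigma\in\mathbb{R}$ be given such that $$\frac{u_L-\sigma}{c(\mathbf{u}_L)}>1,\qquad c^2(\mathbf{u}_L)=\sum_{i=1}^N-\tau_L^2\,\frac{\partial p_i}{\partial\tau}(\tau_L,(s_i)_L).$$ Then there exists a unique (up to translation) traveling wave solution with speed $\sigma$ issuing from the left-hand state $\mathbf{u}_L$ and reaching some right-hand state $\mathbf{u}_R\in\Omega_{\mathbf{u}}$ with $$0<\frac{u_R-\sigma}{c(\mathbf{u}_R)}<1.$$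
   Context: $\rho>0$ is the density, $\tau=1/\rho$ the specific volume, $u\in\mathbb{R}$ the velocity. For each $i=1,\dots,N$ the internal energy is a smooth, strictly convex function $(\tau,s_i)\mapsto e_i(\tau,s_i)>0$ of $\tau>0$ and the specific entropy $s_i\in\mathbb{R}$, with pressure $p_i=-\partial e_i/\partial\tau>0$ and temperature $T_i=\partial e_i/\partial s_i>0$; all $p_i,\mu_i$ are viewed as functions of $(\tau,s_i)$. Write $\mathbf{s}=(s_1,\dots,s_N)$. Assumptions on the thermodynamics: for each $i$, $$\lim_{\tau\to0^+}e_i=+\infty,\quad\lim_{s_i\to+\infty}e_i=+\infty,\quad\lim_{\tau\to+\infty}e_i=0,\quad\frac{\partial p_i}{\partial s_i}(\tau,s_i)>0,\quad\lim_{s_i\to+\infty}\frac{\partial p_i}{\partial\tau}(\tau,s_i)=-\infty,$$ and, for all $\tau>0$ and $\mathbf{s}$, $\sum_i\frac{\partial^2p_i}{\partial\tau^2}(\tau,s_i)>0$, and $$\lim_{\tau\to0^+}\sum_ip_i=+\infty,\quad\lim_{\tau\to+\infty}\sum_ip_i=0,\quad\lim_{\tau\to0^+}\sum_i\frac{\partial p_i}{\partial\tau}=-\infty,\quad\lim_{\tau\to+\infty}\sum_i\frac{\partial p_i}{\partial\tau}=0.$$ Assumptions on the viscosities: the $\mu_i(\tau,s_i)$ are smooth, $\mu_i\ge0$, and $\mu(\tau,\mathbf{s}):=\sum_i\mu_i(\tau,s_i)>0$. States are described by $\mathbf{u}=(\rho,\rho u,(\rho s_i)_{1\le i\le N})\in\Omega_{\mathbf{u}}$,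 the set of such vectors with $\rho>0$. The sound speed is $c(\mathbf{u})>0$ with $c^2(\mathbf{u})=-\tau^2\sum_i\frac{\partial p_i}{\partial\tau}(\tau,s_i)$. A traveling wave solution with speed $\sigma$ issuing from $\mathbf{u}_L$ and reaching $\mathbf{u}_R$ is a smooth, nonconstant solution of the system with values in $\Omega_{\mathbf{u}}$, depending only on $\xi=x-\sigma t$, which tends to $\mathbf{u}_L$ as $\xi\to-\infty$ and to $\mathbf{u}_R$ as $\xi\to+\infty$. *)

theory Defs
  imports "HOL-Analysis.Analysis"
begin

text \<open>Continuous differentiability of order \<open>k\<close> on a set \<open>S\<close>, all total derivatives being taken
  with respect to the full space; it is only meant to be used for open \<open>S\<close>.\<close>

primrec C_k_on :: "nat \<Rightarrow> 'a::real_normed_vector set \<Rightarrow> ('a \<Rightarrow> 'b::real_normed_vector) \<Rightarrow> bool" where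
  "C_k_on 0 S f \<longleftrightarrow> continuous_on S f"
| "C_k_on (Suc k) S f \<longleftrightarrow>
     (\<forall>x\<in>S. f differentiable (at x)) \<and> (\<forall>v. C_k_on k S (\<lambda>x. frechet_derivative f (at x) v))"

definition smooth_on :: "'a::real_normed_vector set \<Rightarrow> ('a \<Rightarrow> 'b::real_normed_vector) \<Rightarrow> bool" where
  "smooth_on S f \<longleftrightarrow> (\<forall>k. C_k_on k S f)"

definition strictly_convex_on :: "'a::real_vector set \<Rightarrow> ('a \<Rightarrow> real) \<Rightarrow> bool" where
  "strictly_convex_on S f \<longleftrightarrow> convex S \<and>
     (\<forall>x\<in>S. \<forall>y\<in>S. \<forall>t. x \<noteq> y \<longrightarrow> 0 < t \<longrightarrow> t < 1 \<longrightarrow>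
        f ((1 - t) *\<^sub>R x + t *\<^sub>R y) < (1 - t) * f x + t * f y)"

definition partial1 :: "(real \<Rightarrow> real \<Rightarrow> real) \<Rightarrow> real \<Rightarrow> real \<Rightarrow> real" where
  "partial1 f a b = deriv (\<lambda>r. f r b) a"

definition partial2 :: "(real \<Rightarrow> real \<Rightarrow> real) \<Rightarrow> real \<Rightarrow> real \<Rightarrow> real" where
  "partial2 f a b = deriv (\<lambda>r. f a r) b"

text \<open>An internal energy \<open>e\<close> is a function of the specific volume \<open>\<tau>\<close> and the specific entropy \<open>s\<close>,
  in this order.\<close>

definition pressure :: "(real \<Rightarrow> real \<Rightarrow> real) \<Rightarrow> real \<Rightarrow> real \<Rightarrow> real" where
  "pressure e \<tau> s = - partial1 e \<tau> s"

definition temperature :: "(real \<Rightarrow> real \<Rightarrow> real) \<Rightarrow> real \<Rightarrow> real \<Rightarrow> real" where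
  "temperature e \<tau> s = partial2 e \<tau> s"

text \<open>The \<open>N\<close> pressure laws are indexed by a finite type \<open>'n\<close>, so \<open>N = CARD('n) \<ge> 1\<close> is arbitrary.
  All limits are taken in one variable, the others being fixed.\<close>

locale multi_pressure_laws =
  fixes e :: "'n::finite \<Rightarrow> real \<Rightarrow> real \<Rightarrow> real"
    and \<mu> :: "'n \<Rightarrow> real \<Rightarrow> real \<Rightarrow> real"
  assumes energy_smooth: "\<And>i. smooth_on ({0<..} \<times> UNIV) (\<lambda>(\<tau>, s). e i \<tau> s)"
    and energy_strictly_convex: "\<And>i. strictly_convex_on ({0<..} \<times> UNIV) (\<lambda>(\<tau>, s). e i \<tau> s)"
    and energy_pos: "\<And>i \<tau> s. \<tau> > 0 \<Longrightarrow> e i \<tau> s > 0"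
    and pressure_pos: "\<And>i \<tau> s. \<tau> > 0 \<Longrightarrow> pressure (e i) \<tau> s > 0"
    and temperature_pos: "\<And>i \<tau> s. \<tau> > 0 \<Longrightarrow> temperature (e i) \<tau> s > 0"
    and energy_lim_volume_0: "\<And>i s. filterlim (\<lambda>\<tau>. e i \<tau> s) at_top (at_right 0)"
    and energy_lim_entropy: "\<And>i \<tau>. \<tau> > 0 \<Longrightarrow> filterlim (\<lambda>s. e i \<tau> s) at_top at_top"
    and energy_lim_volume_infinity: "\<And>i s. ((\<lambda>\<tau>. e i \<tau> s) \<longlongrightarrow> 0) at_top"
    and pressure_entropy_pos: "\<And>i \<tau> s. \<tau> > 0 \<Longrightarrow> partial2 (pressure (e i)) \<tau> s > 0"
    and pressure_volume_lim_entropy: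
      "\<And>i \<tau>. \<tau> > 0 \<Longrightarrow> filterlim (\<lambda>s. partial1 (pressure (e i)) \<tau> s) at_bot at_top"
    and total_pressure_convex:
      "\<And>\<tau> (s :: 'n \<Rightarrow> real). \<tau> > 0 \<Longrightarrow>
         (\<Sum>i\<in>UNIV. partial1 (partial1 (pressure (e i))) \<tau> (s i)) > 0"
    and total_pressure_lim_volume_0:
      "\<And>s :: 'n \<Rightarrow> real. filterlim (\<lambda>\<tau>. \<Sum>i\<in>UNIV. pressure (e i) \<tau> (s i)) at_top (at_right 0)"
    and total_pressure_lim_volume_infinity:
      "\<And>s :: 'n \<Rightarrow> real. ((\<lambda>\<tau>. \<Sum>i\<in>UNIV. pressure (e i) \<tau> (s i)) \<longlongrightarrow> 0) at_top"
    and total_pressure_volume_lim_volume_0: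
      "\<And>s :: 'n \<Rightarrow> real.
         filterlim (\<lambda>\<tau>. \<Sum>i\<in>UNIV. partial1 (pressure (e i)) \<tau> (s i)) at_bot (at_right 0)"
    and total_pressure_volume_lim_volume_infinity:
      "\<And>s :: 'n \<Rightarrow> real. ((\<lambda>\<tau>. \<Sum>i\<in>UNIV. partial1 (pressure (e i)) \<tau> (s i)) \<longlongrightarrow> 0) at_top"
    and viscosity_smooth: "\<And>i. smooth_on ({0<..} \<times> UNIV) (\<lambda>(\<tau>, s). \<mu> i \<tau> s)"
    and viscosity_nonneg: "\<And>i \<tau> s. \<tau> > 0 \<Longrightarrow> \<mu> i \<tau> s \<ge> 0"
    and total_viscosity_pos:
      "\<And>\<tau> (s :: 'n \<Rightarrow> real). \<tau> > 0 \<Longrightarrow> (\<Sum>i\<in>UNIV. \<mu> i \<tau> (s i)) > 0"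

text \<open>States are given in the conservative variables \<open>(\<rho>, \<rho> u, (\<rho> s\<^sub>i)\<^sub>i)\<close>.\<close>

type_synonym 'n state = "real \<times> real \<times> (real ^ 'n)"

definition state_space :: "'n::finite state set" where
  "state_space = {U. fst U > 0}"

definition density :: "'n::finite state \<Rightarrow> real" where
  "density U = fst U"

definition volume :: "'n::finite state \<Rightarrow> real" where
  "volume U = 1 / density U"

definition velocity :: "'n::finite state \<Rightarrow> real" where
  "velocity U = fst (snd U) / density U"

definition entropy :: "'n::finite state \<Rightarrow> 'n \<Rightarrow> real" where
  "entropy U i = snd (snd U) $ i / density U"

definition sound_speed :: "('n::finite \<Rightarrow> real \<Rightarrow> real \<Rightarrow> real) \<Rightarrow> 'n state \<Rightarrow> real" where
  "sound_speed e U =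
     sqrt (\<Sum>i\<in>UNIV. - (volume U)\<^sup>2 * partial1 (pressure (e i)) (volume U) (entropy U i))"

text \<open>Classical smooth solutions \<open>W t x\<close>, for all real \<open>t\<close> and \<open>x\<close>, of the multi-pressure
  Navier-Stokes system with values in the state space; \<open>partial1\<close> is the time derivative and
  \<open>partial2\<close> the space derivative.\<close>

definition navier_stokes_solution ::
  "('n::finite \<Rightarrow> real \<Rightarrow> real \<Rightarrow> real) \<Rightarrow> ('n \<Rightarrow> real \<Rightarrow> real \<Rightarrow> real) \<Rightarrow> real \<Rightarrow>
    (real \<Rightarrow> real \<Rightarrow> 'n state) \<Rightarrow> bool" where
  "navier_stokes_solution e \<mu> \<epsilon> W \<longleftrightarrow>
     smooth_on UNIV (\<lambda>(t, x). W t x) \<and>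
     (\<forall>t x. W t x \<in> state_space) \<and>
     (let \<rho> = (\<lambda>t x. density (W t x));
          u = (\<lambda>t x. velocity (W t x));
          E = (\<lambda>i t x. e i (volume (W t x)) (entropy (W t x) i));
          p = (\<lambda>i t x. pressure (e i) (volume (W t x)) (entropy (W t x) i));
          m = (\<lambda>i t x. \<mu> i (volume (W t x)) (entropy (W t x) i))
      in \<forall>t x.
           partial1 \<rho> t x + partial2 (\<lambda>t x. \<rho> t x * u t x) t x = 0 \<and>
           partial1 (\<lambda>t x. \<rho> t x * u t x) t x
             + partial2 (\<lambda>t x. \<rho> t x * (u t x)\<^sup>2 + (\<Sum>i\<in>UNIV. p i t x)) t x
             = \<epsilon> * partial2 (\<lambda>t x. (\<Sum>i\<in>UNIV. m i t x) * partial2 u t x) t x \<and>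
           (\<forall>i. partial1 (\<lambda>t x. \<rho> t x * E i t x) t x
                  + partial2 (\<lambda>t x. \<rho> t x * u t x * E i t x) t x
                  + p i t x * partial2 u t x
                = \<epsilon> * m i t x * (partial2 u t x)\<^sup>2))"

text \<open>\<open>V\<close> is the wave profile, i.e. the wave as a function of \<open>\<xi> = x - \<sigma> t\<close>.\<close>

definition traveling_wave ::
  "('n::finite \<Rightarrow> real \<Rightarrow> real \<Rightarrow> real) \<Rightarrow> ('n \<Rightarrow> real \<Rightarrow> real \<Rightarrow> real) \<Rightarrow> real \<Rightarrow> real \<Rightarrow>
    'n state \<Rightarrow> 'n state \<Rightarrow> (real \<Rightarrow> 'n state) \<Rightarrow> bool" where
  "traveling_wave e \<mu> \<epsilon> \<sigma> U\<^sub>L U\<^sub>R V \<longleftrightarrow>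
     navier_stokes_solution e \<mu> \<epsilon> (\<lambda>t x. V (x - \<sigma> * t)) \<and>
     \<not> V constant_on UNIV \<and>
     (V \<longlongrightarrow> U\<^sub>L) at_bot \<and>
     (V \<longlongrightarrow> U\<^sub>R) at_top"

end

theory Submission
  imports Defs
begin

text \<open>Let $m = \rho_L (u_L - \sigma) > 0$. Conservation of mass and momentum give
  $u = \sigma + m \tau$ and $\epsilon m \mu \tau' = G$ with
  $G(\tau, \mathbf{s}) = \sum_i p_i - p_L + m^2 (\tau - \tau_L)$, and the energy equations become
  $\mathbf{s}' = \tau' F(\tau, \mathbf{s})$ with $F_i = \mu_i G / (\mu T_i)$. Both end states are zeros
  of $G$, hence degenerate equilibria of this system; but as long as $G \ne 0$ the orbit is
  the graph of a solution of $d\mathbf{s}/d\tau = F(\tau, \mathbf{s})$, which is regular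
  at $(\tau_L, \mathbf{s}_L)$ and replaces an unstable manifold argument.

  Existence: follow this curve from $\tau_L$ towards smaller $\tau$. The Lax condition makes $G$ negative at
  first, so the entropies increase; the total energy along the curve is an explicit function of $\tau$, so
  they stay bounded; and $G(\tau, \mathbf{s}) \ge G(\tau, \mathbf{s}_L) \to +\infty$ as $\tau \to 0$ forces a
  first zero $\tau_R$ of $G$. Convexity of the pressure excludes $G_\tau = 0$ there, which
  is the inequality required at the right-hand state. The wave is then given by the scalar equation for $\tau$.

  Uniqueness: $G$ has constant sign along a wave, and $G > 0$ is impossible by convexity, since
  $\tau$ and $\mathbf{s}$ would both increase. If $G < 0$, a Gronwall estimate from
  $-\infty$ puts the wave on the curve above.\<close>

section \<open>Functions of class $C^k$\<close>

text \<open>Every zero of \<open>G\<close> is an equilibrium of the profile system, and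
  \<open>G\<close> increases strictly in each entropy, so the equilibria form a hypersurface and the
  linearization at the left state has rank at most one. Writing
  \<open>\<Phi> X = h X *\<^sub>R (1, F X)\<close> puts this degeneracy into the scalar speed
  \<open>h\<close>, while the direction \<open>(1, F X)\<close> never vanishes. At the left state
  \<open>F\<close> is zero, so the derivative of \<open>G\<close> along the curve there is its
  partial derivative in the volume alone; this is where the Lax condition enters. A second obstacle
  is domain and growth: \<open>global_picard\<close> wants a globally Lipschitz field, but
  \<open>F\<close> and \<open>h\<close> are smooth for positive volume only. The fields are
  therefore clamped to a box or an interval, and bounds on the solution show afterwards that the
  clamping is never felt. For uniqueness, a wave comes without any assumption on the limits of its
  derivatives. The integration constant of the momentum equation is found from the fact that a
  convergent function whose derivative converges has derivative limit 0.\<close>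

lemma C_k_on_cong:
  assumes "open S" "\<And>x. x \<in> S \<Longrightarrow> f x = g x"
  shows "C_k_on k S f \<longleftrightarrow> C_k_on k S g"
  using assms(2)
proof (induction k arbitrary: f g)
  case 0
  then show ?case by (simp cong: continuous_on_cong)
next
  case (Suc k)
  have D: "(f has_derivative D) (at x) \<longleftrightarrow> (g has_derivative D) (at x)" if "x \<in> S" for x D
    using has_derivative_transform_within_open[OF _ assms(1) that, of f D UNIV g]
      has_derivative_transform_within_open[OF _ assms(1) that, of g D UNIV f] Suc.prems by auto
  have *: "frechet_derivative f (at x) = frechet_derivative g (at x)"
    "f differentiable (at x) \<longleftrightarrow> g differentiable (at x)" if "x \<in> S" for x
    using D[OF that] by (simp_all add: frechet_derivative_def differentiable_def)
  have "C_k_on k S (\<lambda>x. frechet_derivative f (at x) v) \<longleftrightarrow>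
        C_k_on k S (\<lambda>x. frechet_derivative g (at x) v)" for v
    by (rule Suc.IH) (simp add: *)
  with * show ?case by simp
qed

text \<open>\<open>frechet_derivative\<close> is a choice term, so induction steps work with an
  explicit derivative \<open>f'\<close>. On an open set the two agree at each point, and
  \<open>C_k_on_cong\<close> carries this over to all higher orders.\<close>

lemma C_k_on_SucI:
  assumes "open S" "\<And>x. x \<in> S \<Longrightarrow> (f has_derivative f' x) (at x)"
    and "\<And>v. C_k_on k S (\<lambda>x. f' x v)"
  shows "C_k_on (Suc k) S f"
proof -
  have "frechet_derivative f (at x) = f' x" if "x \<in> S" for x
    using frechet_derivative_at[OF assms(2)[OF that]] by simp
  then have "C_k_on k S (\<lambda>x. frechet_derivative f (at x) v)" for v
    using C_k_on_cong[OF assms(1), of "\<lambda>x. frechet_derivative f (at x) v" "\<lambda>x. f' x v" k]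
      assms(3) by simp
  then show ?thesis
    using assms(2) by (auto simp: differentiable_def)
qed

lemma C_k_on_has_derivative:
  assumes "C_k_on (Suc k) S f" "x \<in> S"
  shows "(f has_derivative frechet_derivative f (at x)) (at x)"
  using assms by (simp add: frechet_derivative_works[symmetric])

lemma C_k_on_SucD: "C_k_on (Suc k) S f \<Longrightarrow> C_k_on k S f"
proof (induction k arbitrary: f)
  case 0
  then show ?case
    by (auto simp: continuous_on_eq_continuous_at
        intro!: continuous_at_imp_continuous_on differentiable_imp_continuous_within)
next
  case (Suc k)
  then show ?case
    by (metis C_k_on.simps(2))
qed

lemma C_k_on_const: "C_k_on k S (\<lambda>x. c)"
proof (induction k arbitrary: c)
  case (Suc k)
  have "frechet_derivative (\<lambda>x. c) (at y) = (\<lambda>v. 0)" for y :: 'a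
    using frechet_derivative_at[OF has_derivative_const] by metis
  with Suc show ?case by simp
qed simp

lemma C_k_on_bounded_linear:
  assumes "bounded_linear f" shows "C_k_on k S f"
proof (cases k)
  case 0
  with assms show ?thesis by (simp add: linear_continuous_on)
next
  case (Suc j)
  have "frechet_derivative f (at y) = f" for y
    using frechet_derivative_at[OF bounded_linear.has_derivative[OF assms has_derivative_ident]]
    by metis
  with Suc assms show ?thesis
    by (auto simp: C_k_on_const bounded_linear_imp_differentiable)
qed

lemma C_k_on_bounded_linear_comp:
  assumes "open S" "bounded_linear h" "C_k_on k S f"
  shows "C_k_on k S (\<lambda>x. h (f x))"
  using assms(3)
proof (induction k arbitrary: f)
  case 0
  then show ?case
    using bounded_linear.continuous_on[OF assms(2)] by simp
next
  case (Suc k)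
  show ?case
  proof (rule C_k_on_SucI[OF assms(1)])
    show "((\<lambda>x. h (f x)) has_derivative (\<lambda>v. h (frechet_derivative f (at x) v))) (at x)"
      if "x \<in> S" for x
      using bounded_linear.has_derivative[OF assms(2) C_k_on_has_derivative[OF Suc.prems that]] .
    show "C_k_on k S (\<lambda>x. h (frechet_derivative f (at x) v))" for v
      using Suc.prems by (intro Suc.IH) simp
  qed
qed

lemma C_k_on_add:
  assumes "open S" "C_k_on k S f" "C_k_on k S g"
  shows "C_k_on k S (\<lambda>x. f x + g x)"
  using assms(2,3)
proof (induction k arbitrary: f g)
  case 0
  then show ?case by (simp add: continuous_on_add)
next
  case (Suc k)
  show ?case
    by (rule C_k_on_SucI[OF assms(1) has_derivative_add[OF C_k_on_has_derivative[OF Suc.prems(1)]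
            C_k_on_has_derivative[OF Suc.prems(2)]]])
      (use Suc in auto)
qed

lemma C_k_on_sum:
  assumes "open S" "\<And>i. i \<in> I \<Longrightarrow> C_k_on k S (f i)"
  shows "C_k_on k S (\<lambda>x. \<Sum>i\<in>I. f i x)"
  using assms(2)
  by (induction I rule: infinite_finite_induct) (auto simp: C_k_on_const C_k_on_add[OF assms(1)])

lemma C_k_on_bounded_bilinear:
  assumes "open S" "bounded_bilinear h" "C_k_on k S f" "C_k_on k S g"
  shows "C_k_on k S (\<lambda>x. h (f x) (g x))"
  using assms(3,4)
proof (induction k arbitrary: f g)
  case 0
  then show ?case by (simp add: bounded_bilinear.continuous_on[OF assms(2)])
next
  case (Suc k)
  show ?case
  proof (rule C_k_on_SucI[OF assms(1) bounded_bilinear.FDERIV[OF assms(2)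
          C_k_on_has_derivative[OF Suc.prems(1)] C_k_on_has_derivative[OF Suc.prems(2)]]])
    show "C_k_on k S (\<lambda>x. h (f x) (frechet_derivative g (at x) v)
        + h (frechet_derivative f (at x) v) (g x))" for v
      using Suc.prems Suc.prems[THEN C_k_on_SucD] by (intro C_k_on_add assms(1) Suc.IH) auto
  qed
qed

lemmas C_k_on_scaleR = C_k_on_bounded_bilinear[OF _ bounded_bilinear_scaleR]

lemmas C_k_on_mult = C_k_on_bounded_bilinear[OF _ bounded_bilinear_mult]

text \<open>The chain rule evaluates the derivative of \<open>f\<close> in the direction
  \<open>frechet_derivative g (at x) v\<close>, which moves with \<open>x\<close>, whereas
  \<open>C_k_on\<close> controls fixed directions only. Expanding the moving direction in
  \<open>Basis\<close> gives a finite sum of scalar functions times derivatives in fixed directions;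
  hence the Euclidean middle space.\<close>

lemma C_k_on_compose:
  fixes g :: "'a::real_normed_vector \<Rightarrow> 'b::euclidean_space"
    and f :: "'b \<Rightarrow> 'c::real_normed_vector"
  assumes "open S" "open T" "g ` S \<subseteq> T" "C_k_on k T f" "C_k_on k S g"
  shows "C_k_on k S (\<lambda>x. f (g x))"
  using assms(4,5)
proof (induction k arbitrary: f)
  case 0
  then show ?case
    using continuous_on_compose2[OF _ _ assms(3)] by simp
next
  case (Suc k)
  have df: "(f has_derivative frechet_derivative f (at y)) (at y)" if "y \<in> T" for y
    using C_k_on_has_derivative[OF Suc.prems(1) that] .
  have dg: "(g has_derivative frechet_derivative g (at x)) (at x)" if "x \<in> S" for x
    using C_k_on_has_derivative[OF Suc.prems(2) that] .
  show ?case
  proof (rule C_k_on_SucI[OF assms(1)])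
    fix x assume x: "x \<in> S"
    let ?D = "frechet_derivative f (at (g x))"
    have gx: "g x \<in> T" using x assms(3) by auto
    have lin: "linear ?D" using df[OF gx] by (rule has_derivative_linear)
    have "((\<lambda>x. f (g x)) has_derivative (\<lambda>v. ?D (frechet_derivative g (at x) v))) (at x)"
      using has_derivative_compose[OF dg[OF x] df[OF gx]] .
    moreover have "(\<lambda>v. ?D (L v)) = (\<lambda>v. \<Sum>b\<in>Basis. (L v \<bullet> b) *\<^sub>R ?D b)" for L :: "'a \<Rightarrow> 'b"
    proof
      fix v
      have "?D (L v) = ?D (\<Sum>b\<in>Basis. (L v \<bullet> b) *\<^sub>R b)" by (simp add: euclidean_representation)
      also have "\<dots> = (\<Sum>b\<in>Basis. (L v \<bullet> b) *\<^sub>R ?D b)"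
        by (simp add: linear_sum[OF lin] linear_scale[OF lin])
      finally show "?D (L v) = (\<Sum>b\<in>Basis. (L v \<bullet> b) *\<^sub>R ?D b)" .
    qed
    ultimately show "((\<lambda>x. f (g x)) has_derivative (\<lambda>v. \<Sum>b\<in>Basis.
        (frechet_derivative g (at x) v \<bullet> b) *\<^sub>R frechet_derivative f (at (g x)) b)) (at x)"
      by (simp only:)
  next
    fix v
    have "C_k_on k S (\<lambda>x. frechet_derivative f (at (g x)) b)" for b
      by (rule Suc.IH) (use Suc.prems(1) C_k_on_SucD[OF Suc.prems(2)] in auto)
    moreover have "C_k_on k S (\<lambda>x. frechet_derivative g (at x) v \<bullet> b)" for b
      using Suc.prems(2)
      by (intro C_k_on_bounded_linear_comp[OF assms(1) bounded_linear_inner_left]) auto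
    ultimately show "C_k_on k S (\<lambda>x. \<Sum>b\<in>Basis.
        (frechet_derivative g (at x) v \<bullet> b) *\<^sub>R frechet_derivative f (at (g x)) b)"
      by (intro C_k_on_sum C_k_on_scaleR assms(1))
  qed
qed

text \<open>The derivative of \<open>inverse\<close> is a constant times a product of two copies of
  \<open>inverse\<close>, so the induction closes on itself.\<close>

lemma C_k_on_inverse_real: "C_k_on k (- {0}) (inverse :: real \<Rightarrow> real)"
proof (induction k)
  case 0
  then show ?case by (auto intro!: continuous_intros)
next
  case (Suc k)
  have o: "open (- {0 :: real})" by auto
  show ?case
  proof (rule C_k_on_SucI[OF o])
    show "(inverse has_derivative (\<lambda>v. - (inverse x * v * inverse x))) (at x)"
      if "x \<in> - {0}" for x :: real
      using that by (auto intro!: has_derivative_inverse')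
    have "C_k_on k (- {0}) (\<lambda>x. - v * (inverse x * inverse x))" for v :: real
      by (intro C_k_on_mult[OF o] C_k_on_const Suc.IH)
    then show "C_k_on k (- {0}) (\<lambda>x. - (inverse x * v * inverse x))" for v :: real
      by (simp add: mult_ac)
  qed
qed

lemma C_k_on_divide:
  fixes f g :: "'a::real_normed_vector \<Rightarrow> real"
  assumes "open S" "C_k_on k S f" "C_k_on k S g" "\<And>x. x \<in> S \<Longrightarrow> g x \<noteq> 0"
  shows "C_k_on k S (\<lambda>x. f x / g x)"
proof -
  have "C_k_on k S (\<lambda>x. inverse (g x))"
    using assms by (intro C_k_on_compose[OF _ _ _ C_k_on_inverse_real]) auto
  then show ?thesis
    using C_k_on_mult[OF assms(1,2)] by (simp add: divide_inverse)
qed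

lemma C_k_on_Pair:
  assumes "open S" "C_k_on k S f" "C_k_on k S g"
  shows "C_k_on k S (\<lambda>x. (f x, g x))"
proof -
  have "C_k_on k S (\<lambda>x. (f x, 0) + (0, g x))"
    by (intro C_k_on_add assms(1) C_k_on_bounded_linear_comp[OF _ _ assms(2)]
        C_k_on_bounded_linear_comp[OF _ _ assms(3)] bounded_linear_Pair
        bounded_linear_ident bounded_linear_zero)
  then show ?thesis by simp
qed

lemma C_k_on_vec:
  fixes f :: "'n::finite \<Rightarrow> 'a::real_normed_vector \<Rightarrow> real"
  assumes "open S" "\<And>i. C_k_on k S (f i)"
  shows "C_k_on k S (\<lambda>x. \<chi> i. f i x)"
proof -
  have "C_k_on k S (\<lambda>x. \<Sum>i\<in>UNIV. f i x *\<^sub>R axis i (1 :: real))"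
    by (intro C_k_on_sum assms C_k_on_scaleR C_k_on_const)
  moreover have "(\<Sum>i\<in>UNIV. f i x *\<^sub>R axis i (1 :: real)) = (\<chi> i. f i x)" for x
    using basis_expansion[of "\<chi> i. f i x"] by (simp add: scalar_mult_eq_scaleR)
  ultimately show ?thesis by (simp only:)
qed

section \<open>Closure properties of smooth functions\<close>

lemma smooth_on_imp_continuous_on: "smooth_on S f \<Longrightarrow> continuous_on S f"
  unfolding smooth_on_def by (metis C_k_on.simps(1))

lemma smooth_on_differentiable: "smooth_on S f \<Longrightarrow> x \<in> S \<Longrightarrow> f differentiable (at x)"
  unfolding smooth_on_def by (metis C_k_on.simps(2))

lemma smooth_on_frechet_derivative:
  "smooth_on S f \<Longrightarrow> smooth_on S (\<lambda>x. frechet_derivative f (at x) v)"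
  unfolding smooth_on_def by (metis C_k_on.simps(2))

lemma smooth_on_cong:
  "open S \<Longrightarrow> (\<And>x. x \<in> S \<Longrightarrow> f x = g x) \<Longrightarrow> smooth_on S f \<longleftrightarrow> smooth_on S g"
  unfolding smooth_on_def using C_k_on_cong by metis

lemma smooth_on_const: "smooth_on S (\<lambda>x. c)"
  by (simp add: smooth_on_def C_k_on_const)

lemma smooth_on_bounded_linear: "bounded_linear f \<Longrightarrow> smooth_on S f"
  by (simp add: smooth_on_def C_k_on_bounded_linear)

lemma smooth_on_add:
  "open S \<Longrightarrow> smooth_on S f \<Longrightarrow> smooth_on S g \<Longrightarrow> smooth_on S (\<lambda>x. f x + g x)"
  by (simp add: smooth_on_def C_k_on_add)

lemma smooth_on_sum:
  "open S \<Longrightarrow> (\<And>i. i \<in> I \<Longrightarrow> smooth_on S (f i)) \<Longrightarrow> smooth_on S (\<lambda>x. \<Sum>i\<in>I. f i x)"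
  by (simp add: smooth_on_def C_k_on_sum)

lemma smooth_on_mult:
  fixes f g :: "'a::real_normed_vector \<Rightarrow> real"
  shows "open S \<Longrightarrow> smooth_on S f \<Longrightarrow> smooth_on S g \<Longrightarrow> smooth_on S (\<lambda>x. f x * g x)"
  by (simp add: smooth_on_def C_k_on_mult)

lemma smooth_on_scaleR:
  "open S \<Longrightarrow> smooth_on S f \<Longrightarrow> smooth_on S g \<Longrightarrow> smooth_on S (\<lambda>x. f x *\<^sub>R g x)"
  by (simp add: smooth_on_def C_k_on_scaleR)

lemma smooth_on_minus: "open S \<Longrightarrow> smooth_on S f \<Longrightarrow> smooth_on S (\<lambda>x. - f x)"
  by (simp add: smooth_on_def C_k_on_bounded_linear_comp bounded_linear_minus[OF bounded_linear_ident])

lemma smooth_on_diff: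
  "open S \<Longrightarrow> smooth_on S f \<Longrightarrow> smooth_on S g \<Longrightarrow> smooth_on S (\<lambda>x. f x - g x)"
  using smooth_on_add[of S f "\<lambda>x. - g x"] by (simp add: smooth_on_minus)

lemma smooth_on_divide:
  fixes f g :: "'a::real_normed_vector \<Rightarrow> real"
  shows "open S \<Longrightarrow> smooth_on S f \<Longrightarrow> smooth_on S g \<Longrightarrow> (\<And>x. x \<in> S \<Longrightarrow> g x \<noteq> 0) \<Longrightarrow>
    smooth_on S (\<lambda>x. f x / g x)"
  by (simp add: smooth_on_def C_k_on_divide)

lemma smooth_on_Pair:
  "open S \<Longrightarrow> smooth_on S f \<Longrightarrow> smooth_on S g \<Longrightarrow> smooth_on S (\<lambda>x. (f x, g x))"
  by (simp add: smooth_on_def C_k_on_Pair)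

lemma smooth_on_vec:
  fixes f :: "'n::finite \<Rightarrow> 'a::real_normed_vector \<Rightarrow> real"
  shows "open S \<Longrightarrow> (\<And>i. smooth_on S (f i)) \<Longrightarrow> smooth_on S (\<lambda>x. \<chi> i. f i x)"
  by (simp add: smooth_on_def C_k_on_vec)

lemma smooth_on_compose:
  fixes g :: "'a::real_normed_vector \<Rightarrow> 'b::euclidean_space"
  shows "smooth_on T f \<Longrightarrow> smooth_on S g \<Longrightarrow> open S \<Longrightarrow> open T \<Longrightarrow> g ` S \<subseteq> T \<Longrightarrow>
    smooth_on S (\<lambda>x. f (g x))"
  unfolding smooth_on_def using C_k_on_compose by metis

lemma smooth_on_real_derivative:
  fixes f :: "real \<Rightarrow> real"
  assumes "smooth_on UNIV f"
  shows "(f has_real_derivative deriv f x) (at x)" "smooth_on UNIV (deriv f)"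
proof -
  have *: "(f has_real_derivative deriv f x) (at x)" for x
    using smooth_on_differentiable[OF assms, of x]
    by (metis DERIV_deriv_iff_real_differentiable UNIV_I)
  then show "(f has_real_derivative deriv f x) (at x)" .
  have "frechet_derivative f (at x) 1 = deriv f x" for x
    using frechet_derivative_at[OF *[unfolded has_field_derivative_def]] by (metis mult.right_neutral)
  then show "smooth_on UNIV (deriv f)"
    using smooth_on_frechet_derivative[OF assms, of 1] by simp
qed

text \<open>Bootstrapping: if \<open>X\<close> has k continuous derivatives, so has its derivative
  \<open>\<Phi> (X t)\<close>, and \<open>X\<close> gains one order.\<close>

lemma smooth_on_autonomous_solution:
  fixes X :: "real \<Rightarrow> 'a::euclidean_space"
  assumes "open S" "smooth_on S \<Phi>" "range X \<subseteq> S"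
    and "\<And>t. (X has_vector_derivative \<Phi> (X t)) (at t)"
  shows "smooth_on UNIV X"
proof -
  have "C_k_on k UNIV X" for k
  proof (induction k)
    case 0
    then show ?case
      using has_vector_derivative_continuous[OF assms(4)] by (simp add: continuous_at_imp_continuous_on)
  next
    case (Suc k)
    show ?case
    proof (rule C_k_on_SucI)
      show "(X has_derivative (\<lambda>v. v *\<^sub>R \<Phi> (X t))) (at t)" for t
        using assms(4) by (simp add: has_vector_derivative_def)
      have "C_k_on k UNIV (\<lambda>t. \<Phi> (X t))"
        using assms(2) by (intro C_k_on_compose[OF open_UNIV assms(1,3) _ Suc]) (simp add: smooth_on_def)
      from C_k_on_scaleR[OF open_UNIV C_k_on_const this]
      show "C_k_on k UNIV (\<lambda>t. v *\<^sub>R \<Phi> (X t))" for v .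
    qed simp
  qed
  then show ?thesis by (simp add: smooth_on_def)
qed

text \<open>Continuity is available for the derivative in each fixed direction. Compactness bounds
  it in the basis directions, the sum of these bounds controls the operator norm, and the mean value
  inequality on the convex set \<open>K\<close> finishes.\<close>

lemma smooth_on_lipschitz:
  fixes f :: "'a::euclidean_space \<Rightarrow> 'b::real_normed_vector"
  assumes "smooth_on S f" "K \<subseteq> S" "compact K" "convex K"
  obtains L where "L > 0" "\<And>x y. x \<in> K \<Longrightarrow> y \<in> K \<Longrightarrow> norm (f x - f y) \<le> L * norm (x - y)"
proof -
  have "\<exists>B. \<forall>x\<in>K. norm (frechet_derivative f (at x) b) \<le> B" for b
  proof -
    have "continuous_on K (\<lambda>x. frechet_derivative f (at x) b)"
      using smooth_on_imp_continuous_on[OF smooth_on_frechet_derivative[OF assms(1)]] assms(2)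
      by (rule continuous_on_subset)
    then have "bounded ((\<lambda>x. frechet_derivative f (at x) b) ` K)"
      using assms(3) compact_continuous_image compact_imp_bounded by blast
    then show ?thesis by (auto simp: bounded_iff)
  qed
  then obtain B where B: "\<And>b x. x \<in> K \<Longrightarrow> norm (frechet_derivative f (at x) b) \<le> B b"
    by metis
  \<comment> \<open>The summand 1 makes \<open>L\<close> strictly positive, as the existence results
    for differential equations require.\<close>
  define L where "L = (\<Sum>b\<in>Basis. \<bar>B b\<bar>) + 1"
  have "L > 0" unfolding L_def by (simp add: add_nonneg_pos sum_nonneg)
  have d: "(f has_derivative frechet_derivative f (at x)) (at x)" if "x \<in> K" for x
    using smooth_on_differentiable[OF assms(1), of x] that assms(2)
    by (auto simp: frechet_derivative_works[symmetric])
  have "onorm (frechet_derivative f (at x)) \<le> L" if x: "x \<in> K" for x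
  proof (rule onorm_le)
    fix v
    let ?D = "frechet_derivative f (at x)"
    have lin: "linear ?D" using d[OF x] by (rule has_derivative_linear)
    have "?D v = ?D (\<Sum>b\<in>Basis. (v \<bullet> b) *\<^sub>R b)" by (simp add: euclidean_representation)
    also have "\<dots> = (\<Sum>b\<in>Basis. (v \<bullet> b) *\<^sub>R ?D b)"
      by (simp add: linear_sum[OF lin] linear_scale[OF lin])
    also have "norm \<dots> \<le> (\<Sum>b\<in>Basis. norm v * \<bar>B b\<bar>)"
    proof (rule sum_norm_le)
      fix b :: 'a assume b: "b \<in> Basis"
      have "norm (?D b) \<le> \<bar>B b\<bar>" using B[OF x, of b] by linarith
      then show "norm ((v \<bullet> b) *\<^sub>R ?D b) \<le> norm v * \<bar>B b\<bar>"
        using Basis_le_norm[OF b, of v] by (auto intro!: mult_mono)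
    qed
    also have "\<dots> \<le> L * norm v"
      by (simp add: L_def sum_distrib_left[symmetric] algebra_simps)
    finally show "norm (?D v) \<le> L * norm v" .
  qed
  then have "norm (f x - f y) \<le> L * norm (x - y)" if "x \<in> K" "y \<in> K" for x y
    using differentiable_bound[OF assms(4) has_derivative_at_withinI[OF d] _ that] by blast
  with \<open>L > 0\<close> show ?thesis using that by blast
qed

subsection \<open>Partial derivatives of functions of two real variables\<close>

lemma open_half_plane: "open ({0<..} \<times> (UNIV :: 'a::topological_space set) :: (real \<times> 'a) set)"
  by (intro open_Times) auto

context
  fixes f :: "real \<Rightarrow> real \<Rightarrow> real"
  assumes smooth: "smooth_on ({0<..} \<times> UNIV) (\<lambda>(a, b). f a b)"
begin

text \<open>Links the two languages in use: the laws are stated with one-variable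
  \<open>deriv\<close>, smoothness with total derivatives. The total derivative is restricted to the
  coordinate lines.\<close>

lemma partial_frechet_derivative:
  assumes "a > 0"
  shows "partial1 f a b = frechet_derivative (\<lambda>(a, b). f a b) (at (a, b)) (1, 0)"
    and "partial2 f a b = frechet_derivative (\<lambda>(a, b). f a b) (at (a, b)) (0, 1)"
    and "((\<lambda>(a, b). f a b) has_derivative (\<lambda>(x, y). partial1 f a b * x + partial2 f a b * y))
           (at (a, b))"
proof -
  let ?D = "frechet_derivative (\<lambda>(a, b). f a b) (at (a, b))"
  have D: "((\<lambda>(a, b). f a b) has_derivative ?D) (at (a, b))"
    using smooth_on_differentiable[OF smooth, of "(a, b)"] assms
    by (simp add: frechet_derivative_works[symmetric])
  have lin: "linear ?D" using D by (rule has_derivative_linear)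
  have "((\<lambda>r. (r, b)) has_derivative (\<lambda>x. (x, 0))) (at a)"
    by (auto intro!: derivative_eq_intros)
  from has_derivative_compose[OF this D]
  have "((\<lambda>r. f r b) has_derivative (\<lambda>x. ?D (x, 0))) (at a)" by simp
  moreover have "(\<lambda>x. ?D (x, 0)) = (*) (?D (1, 0))"
  proof
    show "?D (x, 0) = ?D (1, 0) * x" for x
      using linear_scale[OF lin, of x "(1, 0)"] by simp
  qed
  ultimately show 1: "partial1 f a b = ?D (1, 0)"
    unfolding partial1_def by (intro DERIV_imp_deriv) (simp only: has_field_derivative_def)
  have "((\<lambda>r. (a, r)) has_derivative (\<lambda>y. (0, y))) (at b)"
    by (auto intro!: derivative_eq_intros)
  from has_derivative_compose[OF this D]
  have "((\<lambda>r. f a r) has_derivative (\<lambda>y. ?D (0, y))) (at b)" by simp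
  moreover have "(\<lambda>y. ?D (0, y)) = (*) (?D (0, 1))"
  proof
    show "?D (0, y) = ?D (0, 1) * y" for y
      using linear_scale[OF lin, of y "(0, 1)"] by simp
  qed
  ultimately show 2: "partial2 f a b = ?D (0, 1)"
    unfolding partial2_def by (intro DERIV_imp_deriv) (simp only: has_field_derivative_def)
  have "?D (x, y) = partial1 f a b * x + partial2 f a b * y" for x y
    unfolding 1 2 using linear_add[OF lin, of "(x, 0)" "(0, y)"] linear_scale[OF lin, of x "(1, 0)"]
      linear_scale[OF lin, of y "(0, 1)"] by simp
  then have "?D = (\<lambda>(x, y). partial1 f a b * x + partial2 f a b * y)"
    by (simp add: fun_eq_iff)
  with D show "((\<lambda>(a, b). f a b) has_derivative
      (\<lambda>(x, y). partial1 f a b * x + partial2 f a b * y)) (at (a, b))" by metis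
qed

lemma smooth_on_partial:
  shows "smooth_on ({0<..} \<times> UNIV) (\<lambda>(a, b). partial1 f a b)"
    and "smooth_on ({0<..} \<times> UNIV) (\<lambda>(a, b). partial2 f a b)"
proof -
  have "smooth_on ({0<..} \<times> UNIV) (\<lambda>x. frechet_derivative (\<lambda>(a, b). f a b) (at x) v)" for v
    by (rule smooth_on_frechet_derivative[OF smooth])
  note * = this[of "(1, 0)"] this[of "(0, 1)"]
  show "smooth_on ({0<..} \<times> UNIV) (\<lambda>(a, b). partial1 f a b)"
    by (rule smooth_on_cong[OF open_half_plane, THEN iffD1, OF _ *(1)])
      (auto simp: partial_frechet_derivative)
  show "smooth_on ({0<..} \<times> UNIV) (\<lambda>(a, b). partial2 f a b)"
    by (rule smooth_on_cong[OF open_half_plane, THEN iffD1, OF _ *(2)])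
      (auto simp: partial_frechet_derivative)
qed

lemma has_real_derivative_partial:
  assumes "(x has_real_derivative x') (at t)" "(y has_real_derivative y') (at t)" "x t > 0"
  shows "((\<lambda>t. f (x t) (y t)) has_real_derivative
           partial1 f (x t) (y t) * x' + partial2 f (x t) (y t) * y') (at t)"
proof -
  have "((\<lambda>t. (x t, y t)) has_derivative (\<lambda>h. (x' * h, y' * h))) (at t)"
    using assms(1,2) by (auto intro!: has_derivative_Pair simp: has_field_derivative_def)
  from has_derivative_compose[OF this partial_frechet_derivative(3)[OF assms(3)]]
  have "((\<lambda>t. f (x t) (y t)) has_derivative
      (\<lambda>h. partial1 f (x t) (y t) * (x' * h) + partial2 f (x t) (y t) * (y' * h))) (at t)"
    by simp
  then show ?thesis
    unfolding has_field_derivative_def by (rule has_derivative_eq_rhs) (auto simp: algebra_simps)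
qed

end

section \<open>Ordinary differential equations\<close>

lemma continuous_antiderivative:
  fixes f :: "real \<Rightarrow> 'a::euclidean_space"
  assumes "continuous_on UNIV f"
  obtains F where "F 0 = 0" "\<And>t. (F has_vector_derivative f t) (at t)"
proof -
  have "isCont f x" for x
    using assms by (simp add: continuous_on_eq_continuous_at)
  then obtain F where F: "\<And>t. (F has_vector_derivative f t) (at t)"
    using einterval_antiderivative[of "-\<infinity>" "\<infinity>" f] by auto
  have "((\<lambda>t. F t - F 0) has_vector_derivative f t - 0) (at t)" for t
    by (intro has_vector_derivative_diff F has_vector_derivative_const)
  with that[of "\<lambda>t. F t - F 0"] show ?thesis by simp
qed

text \<open>Integration from 0 preserves the exponential weight and gains a factor 1 /
  \<open>L\<close>; this gain makes the Picard operator contract. Negative times are reduced to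
  positive ones by reflection.\<close>

lemma norm_antiderivative_le_exp:
  fixes F :: "real \<Rightarrow> 'a::real_normed_vector"
  assumes "L > 0" "c \<ge> 0" "F 0 = 0"
    and F: "\<And>t. (F has_vector_derivative f t) (at t)"
    and f: "\<And>t. norm (f t) \<le> c * exp (L * \<bar>t\<bar>)"
  shows "norm (F t) \<le> c / L * exp (L * \<bar>t\<bar>)"
proof -
  have half: "norm (G t) \<le> c / L * exp (L * t)"
    if "t > 0" "G 0 = 0" and G: "\<And>t. (G has_vector_derivative g t) (at t)"
      and g: "\<And>t. t > 0 \<Longrightarrow> norm (g t) \<le> c * exp (L * t)"
    for G g :: "real \<Rightarrow> 'a" and t
  proof -
    have "norm (G t - G 0) \<le> c / L * exp (L * t) - c / L * exp (L * 0)"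
    proof (rule differentiable_bound_general[OF \<open>t > 0\<close>])
      show "continuous_on {0..t} G"
        using has_vector_derivative_continuous[OF G] by (simp add: continuous_at_imp_continuous_on)
      show "((\<lambda>t. c / L * exp (L * t)) has_vector_derivative c * exp (L * x)) (at x)" for x
        unfolding has_real_derivative_iff_has_vector_derivative[symmetric]
        using \<open>L > 0\<close> by (auto intro!: derivative_eq_intros)
      show "continuous_on {0..t} (\<lambda>t. c / L * exp (L * t))"
        by (intro continuous_on_mult continuous_on_const continuous_on_exp continuous_on_id)
    qed (use G g in auto)
    also have "\<dots> \<le> c / L * exp (L * t)"
      using assms(1,2) by simp
    finally show ?thesis using \<open>G 0 = 0\<close> by simp
  qed
  consider "t = 0" | "t > 0" | "t < 0" by linarith
  then show ?thesis
  proof cases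
    case 1
    then show ?thesis using assms(1-3) by simp
  next
    case 2
    have "norm (f t) \<le> c * exp (L * t)" if "t > 0" for t
      using f[of t] that by simp
    from half[OF 2 assms(3) F this] 2 show ?thesis by simp
  next
    case 3
    have "((\<lambda>t. F (- t)) has_vector_derivative - f (- t)) (at t)" for t
    proof -
      have "(uminus has_vector_derivative (- 1 :: real)) (at t)"
        by (auto intro!: derivative_eq_intros)
      from vector_diff_chain_at[OF this F] show ?thesis by (simp add: o_def)
    qed
    moreover have "norm (- f (- t)) \<le> c * exp (L * t)" if "t > 0" for t
      using f[of "- t"] that by simp
    ultimately show ?thesis
      using half[of "- t" "\<lambda>t. F (- t)" "\<lambda>t. - f (- t)"] 3 assms(3) by simp
  qed
qed

text \<open>The Picard operator is a contraction for the norm $\sup_t e^{-2L|t|} |X(t) - x_0|$.\<close>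

theorem global_picard:
  fixes \<Phi> :: "'a::euclidean_space \<Rightarrow> 'a"
  assumes "L > 0" and L: "\<And>x y. norm (\<Phi> x - \<Phi> y) \<le> L * norm (x - y)"
  obtains X where "X 0 = x0" "\<And>t. (X has_vector_derivative \<Phi> (X t)) (at t)"
proof -
  \<comment> \<open>The rate is twice the Lipschitz constant: integration gains 1 / (2 *
    \<open>L\<close>) against the factor \<open>L\<close>, so the contraction constant is 1/2 on the
    whole real line.\<close>
  define E where "E t = exp (2 * L * \<bar>t\<bar>)" for t
  \<comment> \<open>The unknown \<open>Y\<close> is the deviation from \<open>x0\<close> divided by
    the weight. It is a bounded continuous function, so Banach's theorem applies in the complete
    space of such functions.\<close>
  define Z where "Z Y t = x0 + E t *\<^sub>R apply_bcontfun Y t" for Y :: "real \<Rightarrow>\<^sub>C 'a" and t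
  have Epos: "E t > 0" for t by (simp add: E_def)
  have contE: "continuous_on UNIV E"
    unfolding E_def by (intro continuous_intros)
  have "continuous_on UNIV \<Phi>"
    by (rule lipschitz_on_continuous_on[of L])
      (use assms in \<open>auto simp: lipschitz_on_def dist_norm\<close>)
  moreover have "continuous_on UNIV (Z Y)" for Y
    unfolding Z_def by (intro continuous_intros contE) auto
  ultimately have "continuous_on UNIV (\<lambda>t. \<Phi> (Z Y t))" for Y
    by (rule continuous_on_compose2) auto
  then have "\<exists>F. F 0 = 0 \<and> (\<forall>t. (F has_vector_derivative \<Phi> (Z Y t)) (at t))" for Y
    using continuous_antiderivative by metis
  then obtain J where J0: "\<And>Y. J Y 0 = 0"
    and J: "\<And>Y t. (J Y has_vector_derivative \<Phi> (Z Y t)) (at t)"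
    by metis
  have bound: "norm (J Y t) \<le> (norm (\<Phi> x0) + L * norm Y) / (2 * L) * E t" for Y t
    unfolding E_def
  proof (rule norm_antiderivative_le_exp[OF _ _ J0 J])
    fix t
    have "norm (\<Phi> (Z Y t)) \<le> norm (\<Phi> x0) + norm (\<Phi> (Z Y t) - \<Phi> x0)"
      by norm
    also have "norm (\<Phi> (Z Y t) - \<Phi> x0) \<le> L * norm (Z Y t - x0)" by (rule L)
    also have "norm (Z Y t - x0) = E t * norm (apply_bcontfun Y t)"
      using Epos[of t] by (simp add: Z_def)
    also have "L * (E t * norm (apply_bcontfun Y t)) \<le> L * (E t * norm Y)"
      using \<open>L > 0\<close> Epos[of t] norm_bounded[of Y t] by (intro mult_left_mono) auto
    also have "norm (\<Phi> x0) + L * (E t * norm Y) \<le> norm (\<Phi> x0) * E t + L * (E t * norm Y)"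
      using \<open>L > 0\<close> by (simp add: E_def mult_le_cancel_left1)
    finally show "norm (\<Phi> (Z Y t)) \<le> (norm (\<Phi> x0) + L * norm Y) * exp (2 * L * \<bar>t\<bar>)"
      by (simp add: E_def algebra_simps)
  qed (use \<open>L > 0\<close> in auto)
  define T where "T Y = Bcontfun (\<lambda>t. inverse (E t) *\<^sub>R J Y t)" for Y
  have T: "apply_bcontfun (T Y) t = inverse (E t) *\<^sub>R J Y t" for Y t
  proof -
    have "continuous_on UNIV (J Y)"
      using has_vector_derivative_continuous[OF J] by (simp add: continuous_at_imp_continuous_on)
    then have "continuous_on UNIV (\<lambda>t. inverse (E t) *\<^sub>R J Y t)"
      using Epos by (intro continuous_intros contE) (metis less_irrefl)
    moreover have "norm (inverse (E t) *\<^sub>R J Y t) \<le> (norm (\<Phi> x0) + L * norm Y) / (2 * L)" for t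
      using bound[of Y t] Epos[of t] by (simp add: field_simps)
    then have "bounded (range (\<lambda>t. inverse (E t) *\<^sub>R J Y t))"
      by (auto simp: bounded_iff)
    ultimately have "(\<lambda>t. inverse (E t) *\<^sub>R J Y t) \<in> bcontfun"
      by (simp add: bcontfun_def)
    then show ?thesis
      by (simp add: T_def Bcontfun_inverse)
  qed
  have "dist (T Y) (T Y') \<le> 1 / 2 * dist Y Y'" for Y Y'
  proof (rule dist_bound)
    fix t
    have "norm (J Y t - J Y' t) \<le> L * dist Y Y' / (2 * L) * exp (2 * L * \<bar>t\<bar>)"
    proof (rule norm_antiderivative_le_exp[where f = "\<lambda>t. \<Phi> (Z Y t) - \<Phi> (Z Y' t)"])
      show "((\<lambda>t. J Y t - J Y' t) has_vector_derivative \<Phi> (Z Y t) - \<Phi> (Z Y' t)) (at t)" for t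
        by (intro has_vector_derivative_diff J)
      fix t
      have "norm (\<Phi> (Z Y t) - \<Phi> (Z Y' t)) \<le> L * norm (Z Y t - Z Y' t)" by (rule L)
      also have "Z Y t - Z Y' t = E t *\<^sub>R (apply_bcontfun Y t - apply_bcontfun Y' t)"
        by (simp add: Z_def algebra_simps)
      also have "norm \<dots> = E t * dist (apply_bcontfun Y t) (apply_bcontfun Y' t)"
        using Epos[of t] by (simp add: dist_norm)
      also have "L * \<dots> \<le> L * (E t * dist Y Y')"
        using \<open>L > 0\<close> Epos[of t] by (intro mult_left_mono dist_bounded) auto
      finally show "norm (\<Phi> (Z Y t) - \<Phi> (Z Y' t)) \<le> L * dist Y Y' * exp (2 * L * \<bar>t\<bar>)"
        by (simp add: E_def mult_ac)
    qed (use \<open>L > 0\<close> J0 in auto)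
    then have "norm (J Y t - J Y' t) \<le> 1 / 2 * dist Y Y' * E t"
      using \<open>L > 0\<close> by (simp add: E_def)
    moreover have "dist (apply_bcontfun (T Y) t) (apply_bcontfun (T Y') t)
        = norm (J Y t - J Y' t) / E t"
      using Epos[of t]
      by (simp add: T dist_norm scaleR_diff_right[symmetric] divide_inverse mult.commute)
    ultimately show "dist (apply_bcontfun (T Y) t) (apply_bcontfun (T Y') t) \<le> 1 / 2 * dist Y Y'"
      using Epos[of t] by (simp add: pos_divide_le_eq)
  qed
  then obtain Y where "T Y = Y"
    using banach_fix_type[of "1 / 2" T] by auto
  then have Y: "apply_bcontfun Y t = inverse (E t) *\<^sub>R J Y t" for t
    using T by metis
  have Z: "Z Y t = x0 + J Y t" for t
    using Epos[of t] by (simp add: Z_def Y)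
  show ?thesis
  proof (rule that[of "\<lambda>t. x0 + J Y t"])
    show "x0 + J Y 0 = x0" by (simp add: J0)
    show "((\<lambda>t. x0 + J Y t) has_vector_derivative \<Phi> (x0 + J Y t)) (at t)" for t
      using has_vector_derivative_add[OF has_vector_derivative_const J[of Y t], of x0] by (simp add: Z)
  qed
qed

section \<open>Gronwall's inequality and uniqueness of solutions\<close>

text \<open>The norm is squared because the norm itself need not be differentiable at zeros of
  \<open>D\<close>. By Cauchy-Schwarz the derivative of the square is at most 2 * \<open>k\<close>
  times the square in absolute value; the two integrating factors turn the two sides of this bound
  into monotonicity, so zeros of \<open>D\<close> propagate in both time directions. The variable
  rate \<open>k\<close> later allows volume to replace time as the clock.\<close>

lemma gronwall_norm_square:
  fixes D :: "real \<Rightarrow> 'a::real_inner"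
  assumes "a \<le> b"
    and D: "\<And>t. t \<in> {a..b} \<Longrightarrow> (D has_vector_derivative D' t) (at t)"
    and K: "\<And>t. t \<in> {a..b} \<Longrightarrow> (K has_real_derivative k t) (at t)"
    and bound: "\<And>t. t \<in> {a..b} \<Longrightarrow> norm (D' t) \<le> k t * norm (D t)"
  shows "(norm (D b))\<^sup>2 * exp (- 2 * K b) \<le> (norm (D a))\<^sup>2 * exp (- 2 * K a)" (is ?decr)
    and "(norm (D a))\<^sup>2 * exp (2 * K a) \<le> (norm (D b))\<^sup>2 * exp (2 * K b)" (is ?incr)
proof -
  have der: "((\<lambda>t. (norm (D t))\<^sup>2 * exp (c * K t)) has_real_derivative
      (2 * (D t \<bullet> D' t) + c * k t * (norm (D t))\<^sup>2) * exp (c * K t)) (at t)"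
    if "t \<in> {a..b}" for c t
  proof -
    have "((\<lambda>t. D t \<bullet> D t) has_derivative (\<lambda>h. D t \<bullet> (h *\<^sub>R D' t) + (h *\<^sub>R D' t) \<bullet> D t)) (at t)"
      using D[OF that] by (intro has_derivative_inner) (auto simp: has_vector_derivative_def)
    moreover have "(\<lambda>h. D t \<bullet> (h *\<^sub>R D' t) + (h *\<^sub>R D' t) \<bullet> D t) = (*) (2 * (D t \<bullet> D' t))"
      by (simp add: fun_eq_iff inner_commute)
    ultimately have "((\<lambda>t. D t \<bullet> D t) has_real_derivative 2 * (D t \<bullet> D' t)) (at t)"
      by (simp add: has_field_derivative_def)
    then show ?thesis
      unfolding power2_norm_eq_inner
      using K[OF that] by (auto intro!: derivative_eq_intros simp: algebra_simps)
  qed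
  have cs: "\<bar>D t \<bullet> D' t\<bar> \<le> k t * (norm (D t))\<^sup>2" if "t \<in> {a..b}" for t
  proof -
    have "\<bar>D t \<bullet> D' t\<bar> \<le> norm (D t) * norm (D' t)" by (rule Cauchy_Schwarz_ineq2)
    also have "\<dots> \<le> norm (D t) * (k t * norm (D t))"
      by (rule mult_left_mono[OF bound[OF that]]) simp
    finally show ?thesis by (simp add: power2_eq_square mult_ac)
  qed
  show ?decr
  proof (rule DERIV_nonpos_imp_nonincreasing[OF \<open>a \<le> b\<close>])
    fix t assume "a \<le> t" "t \<le> b"
    with cs[of t] der[of t "- 2"] show "\<exists>y. ((\<lambda>t. (norm (D t))\<^sup>2 * exp (- 2 * K t)) has_real_derivative y) (at t) \<and> y \<le> 0"
      by (intro exI[of _ "(2 * (D t \<bullet> D' t) + - 2 * k t * (norm (D t))\<^sup>2) * exp (- 2 * K t)"] conjI)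
        (auto simp: mult_le_0_iff)
  qed
  show ?incr
  proof (rule DERIV_nonneg_imp_nondecreasing[OF \<open>a \<le> b\<close>])
    fix t assume "a \<le> t" "t \<le> b"
    with cs[of t] der[of t "2"] show "\<exists>y. ((\<lambda>t. (norm (D t))\<^sup>2 * exp (2 * K t)) has_real_derivative y) (at t) \<and> 0 \<le> y"
      by (intro exI[of _ "(2 * (D t \<bullet> D' t) + 2 * k t * (norm (D t))\<^sup>2) * exp (2 * K t)"] conjI)
        (auto simp: zero_le_mult_iff)
  qed
qed

text \<open>The Lipschitz bound is asked only along the two solutions on compact time intervals, so
  that the lemma serves clamped fields as well as smooth fields on a half space.\<close>

lemma vector_field_solution_unique_lipschitz:
  fixes X Y :: "real \<Rightarrow> 'a::real_inner"
  assumes X: "\<And>t. (X has_vector_derivative \<Phi> (X t)) (at t)"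
    and Y: "\<And>t. (Y has_vector_derivative \<Phi> (Y t)) (at t)"
    and "X t0 = Y t0"
    and L: "\<And>a b. a \<le> b \<Longrightarrow> \<exists>L. \<forall>s\<in>{a..b}. norm (\<Phi> (X s) - \<Phi> (Y s)) \<le> L * norm (X s - Y s)"
  shows "X t = Y t"
proof -
  let ?a = "min t0 t" and ?b = "max t0 t"
  obtain L where L: "norm (\<Phi> (X s) - \<Phi> (Y s)) \<le> L * norm (X s - Y s)" if "s \<in> {?a..?b}" for s
    using L[of ?a ?b] by (metis max.cobounded2 min.cobounded2 order_trans)
  let ?D = "\<lambda>s. X s - Y s"
  have D: "(?D has_vector_derivative \<Phi> (X s) - \<Phi> (Y s)) (at s)" for s
    by (intro has_vector_derivative_diff X Y)
  have K: "((\<lambda>s. L * s) has_real_derivative L) (at s)" for s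
    by (auto intro!: derivative_eq_intros)
  show ?thesis
  proof (cases "t0 \<le> t")
    case True
    have "(norm (?D t))\<^sup>2 * exp (- 2 * (L * t)) \<le> (norm (?D t0))\<^sup>2 * exp (- 2 * (L * t0))"
      using True L by (intro gronwall_norm_square(1)[OF _ D K]) auto
    then show ?thesis using assms(3) by (simp add: mult_le_0_iff)
  next
    case False
    have "(norm (?D t))\<^sup>2 * exp (2 * (L * t)) \<le> (norm (?D t0))\<^sup>2 * exp (2 * (L * t0))"
      using False L by (intro gronwall_norm_square(2)[OF _ D K]) auto
    then show ?thesis using assms(3) by (simp add: mult_le_0_iff)
  qed
qed

text \<open>Over a compact time interval the two arcs have a compact convex hull inside
  \<open>S\<close>, and a smooth field is Lipschitz there.\<close>

lemma smooth_vector_field_solution_unique: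
  fixes X Y :: "real \<Rightarrow> 'a::euclidean_space"
  assumes "smooth_on S \<Phi>" "convex S" "range X \<subseteq> S" "range Y \<subseteq> S"
    and X: "\<And>t. (X has_vector_derivative \<Phi> (X t)) (at t)"
    and Y: "\<And>t. (Y has_vector_derivative \<Phi> (Y t)) (at t)"
    and "X t0 = Y t0"
  shows "X t = Y t"
proof (rule vector_field_solution_unique_lipschitz[OF X Y assms(7)])
  fix a b :: real
  have "compact (X ` {a..b})" "compact (Y ` {a..b})"
    using has_vector_derivative_continuous[OF X] has_vector_derivative_continuous[OF Y]
    by (auto intro!: compact_continuous_image continuous_at_imp_continuous_on)
  then have K: "compact (convex hull (X ` {a..b} \<union> Y ` {a..b}))"
    by (intro compact_convex_hull compact_Un)
  have "convex hull (X ` {a..b} \<union> Y ` {a..b}) \<subseteq> S"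
    using assms(2-4) by (intro hull_minimal) auto
  from smooth_on_lipschitz[OF assms(1) this K convex_convex_hull]
  obtain L where "\<And>x y. x \<in> convex hull (X ` {a..b} \<union> Y ` {a..b}) \<Longrightarrow>
      y \<in> convex hull (X ` {a..b} \<union> Y ` {a..b}) \<Longrightarrow> norm (\<Phi> x - \<Phi> y) \<le> L * norm (x - y)"
    by metis
  then show "\<exists>L. \<forall>s\<in>{a..b}. norm (\<Phi> (X s) - \<Phi> (Y s)) \<le> L * norm (X s - Y s)"
    by (intro exI[of _ L]) (auto intro!: hull_inc)
qed

subsection \<open>Monotone solutions of scalar equations\<close>

text \<open>By the mean value theorem the increment over an interval of length 1 is a value of
  \<open>f'\<close> further to the right. The increments tend to 0 and these values tend to
  \<open>c\<close>.\<close>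

lemma tendsto_derivative_at_top:
  fixes f :: "real \<Rightarrow> real"
  assumes f: "\<And>t. (f has_real_derivative f' t) (at t)"
    and "(f \<longlongrightarrow> l) at_top" "(f' \<longlongrightarrow> c) at_top"
  shows "c = 0"
proof -
  have "\<exists>z. t < z \<and> f (t + 1) - f t = f' z" for t
    using MVT2[of t "t + 1" f f'] f by auto
  then obtain z where z: "\<And>t. t < z t" "\<And>t. f (t + 1) - f t = f' (z t)"
    by metis
  have "filterlim z at_top at_top"
    by (rule filterlim_at_top_mono[OF filterlim_ident]) (use z(1) in \<open>auto simp: less_imp_le\<close>)
  then have "((\<lambda>t. f (t + 1) - f t) \<longlongrightarrow> c) at_top"
    unfolding z(2) by (rule filterlim_compose[OF assms(3)])
  moreover have "filterlim (\<lambda>t::real. t + 1) at_top at_top"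
    by (rule filterlim_at_top_mono[OF filterlim_ident]) auto
  then have "((\<lambda>t. f (t + 1) - f t) \<longlongrightarrow> l - l) at_top"
    by (intro tendsto_diff assms(2) filterlim_compose[OF assms(2)])
  ultimately have "c = l - l" by (rule tendsto_unique[rotated]) simp
  then show ?thesis by simp
qed

lemma tendsto_derivative_at_bot:
  fixes f :: "real \<Rightarrow> real"
  assumes f: "\<And>t. (f has_real_derivative f' t) (at t)"
    and "(f \<longlongrightarrow> l) at_bot" "(f' \<longlongrightarrow> c) at_bot"
  shows "c = 0"
proof -
  have "((\<lambda>t. f (- t)) has_real_derivative - f' (- t)) (at t)" for t
    using DERIV_mirror f by blast
  moreover have "((\<lambda>t. f (- t)) \<longlongrightarrow> l) at_top" "((\<lambda>t. - f' (- t)) \<longlongrightarrow> - c) at_top"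
    using assms(2,3) by (auto simp: filterlim_at_bot_mirror intro!: tendsto_minus)
  ultimately have "- c = 0" by (rule tendsto_derivative_at_top)
  then show ?thesis by simp
qed

lemma antimono_bounded_below_tendsto:
  fixes f :: "real \<Rightarrow> real"
  assumes "antimono f" "\<And>t. a \<le> f t"
  obtains l where "(f \<longlongrightarrow> l) at_top" "\<And>t. l \<le> f t" "a \<le> l"
proof -
  let ?l = "INF t. f t"
  have bdd: "bdd_below (range f)" using assms(2) by (auto intro!: bdd_belowI)
  then have le: "?l \<le> f t" for t by (auto intro!: cINF_lower)
  have "(f \<longlongrightarrow> ?l) at_top"
  proof (rule decreasing_tendsto)
    fix y assume "?l < y"
    then obtain t where "f t < y" using bdd by (auto simp: cINF_less_iff)
    then show "\<forall>\<^sub>F t in at_top. f t < y"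
      using assms(1) unfolding eventually_at_top_linorder
      by (metis antimonoD le_less_trans)
  qed (use le in auto)
  moreover have "a \<le> ?l" using assms(2) by (auto intro: cINF_greatest)
  ultimately show ?thesis using le that by blast
qed

lemma antimono_bounded_above_tendsto:
  fixes f :: "real \<Rightarrow> real"
  assumes "antimono f" "\<And>t. f t \<le> b"
  obtains l where "(f \<longlongrightarrow> l) at_bot" "\<And>t. f t \<le> l" "l \<le> b"
proof -
  have "antimono (\<lambda>t. - f (- t))"
    using assms(1) by (auto simp: antimono_def)
  then obtain l where l: "((\<lambda>t. - f (- t)) \<longlongrightarrow> l) at_top" "\<And>t. l \<le> - f (- t)" "- b \<le> l"
    by (rule antimono_bounded_below_tendsto[where a = "- b"]) (use assms(2) in auto)
  have "(f \<longlongrightarrow> - l) at_bot"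
    using tendsto_minus[OF l(1)] by (simp add: filterlim_at_bot_mirror)
  moreover have "f t \<le> - l" for t using l(2)[of "- t"] by simp
  ultimately show ?thesis using l(3) that[of "- l"] by simp
qed

text \<open>Since \<open>g\<close> is controlled on \<open>{a..b}\<close> only, it is frozen outside
  to obtain a globally Lipschitz field. By uniqueness the equilibria \<open>a\<close> and
  \<open>b\<close> are barriers; between them the orbit decreases, its two limits are equilibria,
  and the endpoints are the only ones available.\<close>

lemma scalar_heteroclinic_orbit:
  fixes g :: "real \<Rightarrow> real"
  assumes "a < b" "g a = 0" "g b = 0" and neg: "\<And>x. a < x \<Longrightarrow> x < b \<Longrightarrow> g x < 0"
    and "L > 0" and L: "\<And>x y. x \<in> {a..b} \<Longrightarrow> y \<in> {a..b} \<Longrightarrow> \<bar>g x - g y\<bar> \<le> L * \<bar>x - y\<bar>"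
  obtains \<theta> where "\<And>t. (\<theta> has_real_derivative g (\<theta> t)) (at t)" "\<And>t. a < \<theta> t" "\<And>t. \<theta> t < b"
    "(\<theta> \<longlongrightarrow> b) at_bot" "(\<theta> \<longlongrightarrow> a) at_top"
proof -
  define cl where "cl x = max a (min b x)" for x
  define h where "h x = g (cl x)" for x
  have cl: "cl x \<in> {a..b}" "\<bar>cl x - cl y\<bar> \<le> \<bar>x - y\<bar>" for x y
    using assms(1) by (auto simp: cl_def)
  have hL: "\<bar>h x - h y\<bar> \<le> L * \<bar>x - y\<bar>" for x y
    using order_trans[OF L[OF cl(1) cl(1)] mult_left_mono[OF cl(2)]] assms(5)
    by (simp add: h_def)
  have hg: "h x = g x" if "x \<in> {a..b}" for x
    using that by (simp add: h_def cl_def)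
  obtain \<theta> where \<theta>0: "\<theta> 0 = (a + b) / 2" and \<theta>': "\<And>t. (\<theta> has_vector_derivative h (\<theta> t)) (at t)"
    using global_picard[of L h "(a + b) / 2"] hL assms(5) by (metis real_norm_def)
  \<comment> \<open>The constant function at an equilibrium is itself a solution, so an orbit
    starting at the midpoint cannot reach it.\<close>
  have ne: "\<theta> t \<noteq> c" if "h c = 0" "c \<noteq> (a + b) / 2" for t c
  proof
    assume "\<theta> t = c"
    have "((\<lambda>t. c) has_vector_derivative h c) (at s)" for s
      using that(1) by simp
    from vector_field_solution_unique_lipschitz[of \<theta> h "\<lambda>t. c", OF \<theta>' this \<open>\<theta> t = c\<close>]
    have "\<theta> 0 = c" using hL by (metis real_norm_def)
    with that \<theta>0 show False by simp
  qed
  have cont: "isCont \<theta> t" for t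
    using has_vector_derivative_continuous[OF \<theta>'] by simp
  have bt: "a < \<theta> t \<and> \<theta> t < b" for t
  proof (rule ccontr)
    assume "\<not> (a < \<theta> t \<and> \<theta> t < b)"
    moreover have "connected (range \<theta>)"
      using cont by (intro connected_continuous_image continuous_at_imp_continuous_on) auto
    ultimately have "a \<in> range \<theta> \<or> b \<in> range \<theta>"
      using connectedD_interval[of "range \<theta>" "\<theta> t" "\<theta> 0" a, OF _ rangeI rangeI]
        connectedD_interval[of "range \<theta>" "\<theta> 0" "\<theta> t" b, OF _ rangeI rangeI] \<theta>0 assms(1)
      by argo
    then show False
      using ne[of a] ne[of b] assms(1-3) hg by auto
  qed
  have der: "(\<theta> has_real_derivative g (\<theta> t)) (at t)" for t
    using \<theta>'[of t] hg[of "\<theta> t"] bt[of t] has_real_derivative_iff_has_vector_derivative by auto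
  have anti: "antimono \<theta>"
  proof (rule antimonoI)
    fix s t :: real assume "s \<le> t"
    then show "\<theta> t \<le> \<theta> s"
      by (rule DERIV_nonpos_imp_nonincreasing) (use der neg bt less_imp_le in blast)
  qed
  \<comment> \<open>The limits of the orbit may be endpoints, where \<open>g\<close> is controlled
    from one side only; the clamped \<open>h\<close> is continuous from both sides.\<close>
  have conth: "isCont h x" for x
  proof -
    have "continuous_on UNIV h"
      by (rule lipschitz_on_continuous_on[of L]) (use assms(5) hL in \<open>auto simp: lipschitz_on_def dist_norm\<close>)
    then show ?thesis by (simp add: continuous_on_eq_continuous_at)
  qed
  have hder: "(\<theta> has_real_derivative h (\<theta> t)) (at t)" for t
    using \<theta>'[of t] has_real_derivative_iff_has_vector_derivative by auto
  obtain l where l: "(\<theta> \<longlongrightarrow> l) at_top" "\<And>t. l \<le> \<theta> t" "a \<le> l"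
    using antimono_bounded_below_tendsto[OF anti] bt less_imp_le by metis
  have "h l = 0"
    using tendsto_derivative_at_top[OF hder l(1) isCont_tendsto_compose[OF conth l(1)]] .
  then have "l = a"
    using neg[of l] hg[of l] l(2)[of 0] l(3) bt[of 0] by (cases "l = a") auto
  obtain r where r: "(\<theta> \<longlongrightarrow> r) at_bot" "\<And>t. \<theta> t \<le> r" "r \<le> b"
    using antimono_bounded_above_tendsto[OF anti] bt less_imp_le by metis
  have "h r = 0"
    using tendsto_derivative_at_bot[OF hder r(1) isCont_tendsto_compose[OF conth r(1)]] .
  then have "r = b"
    using neg[of r] hg[of r] r(2)[of 0] r(3) bt[of 0] by (cases "r = b") auto
  show ?thesis
    using that[of \<theta>] der bt l(1) r(1) \<open>l = a\<close> \<open>r = b\<close> by blast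
qed

section \<open>The pressure laws\<close>

lemma smooth_on_component:
  fixes q :: "real \<Rightarrow> real \<Rightarrow> real"
  assumes "smooth_on ({0<..} \<times> UNIV) (\<lambda>(a, b). q a b)"
  shows "smooth_on ({0<..} \<times> (UNIV :: (real ^ 'n) set)) (\<lambda>X. q (fst X) (snd X $ i))"
proof -
  have "bounded_linear (\<lambda>X :: real \<times> (real ^ 'n). (fst X, snd X $ i))"
    by (intro bounded_linear_Pair bounded_linear_fst
        bounded_linear_compose[OF bounded_linear_vec_nth bounded_linear_snd])
  then have "smooth_on ({0<..} \<times> UNIV) (\<lambda>X :: real \<times> (real ^ 'n). (fst X, snd X $ i))"
    by (rule smooth_on_bounded_linear)
  from smooth_on_compose[OF assms this open_half_plane open_half_plane]
  show ?thesis by (auto simp: image_subset_iff)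
qed

lemma has_real_derivative_vec_nth:
  fixes s :: "real \<Rightarrow> real ^ 'n"
  assumes "(s has_vector_derivative s') (at t)"
  shows "((\<lambda>t. s t $ i) has_real_derivative s' $ i) (at t)"
  using bounded_linear.has_vector_derivative[OF bounded_linear_vec_nth assms]
  by (simp add: has_real_derivative_iff_has_vector_derivative)

lemma has_real_derivative_sum_partial:
  fixes s :: "real \<Rightarrow> real ^ 'n::finite" and q :: "'n \<Rightarrow> real \<Rightarrow> real \<Rightarrow> real"
  assumes "\<And>i. smooth_on ({0<..} \<times> UNIV) (\<lambda>(a, b). q i a b)"
    and "(x has_real_derivative x') (at t)" "(s has_vector_derivative s') (at t)" "x t > 0"
  shows "((\<lambda>t. \<Sum>i\<in>UNIV. q i (x t) (s t $ i)) has_real_derivative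
    (\<Sum>i\<in>UNIV. partial1 (q i) (x t) (s t $ i)) * x'
      + (\<Sum>i\<in>UNIV. partial2 (q i) (x t) (s t $ i) * s' $ i)) (at t)"
proof -
  have "((\<lambda>t. \<Sum>i\<in>UNIV. q i (x t) (s t $ i)) has_real_derivative
    (\<Sum>i\<in>UNIV. partial1 (q i) (x t) (s t $ i) * x' + partial2 (q i) (x t) (s t $ i) * s' $ i)) (at t)"
    by (intro DERIV_sum has_real_derivative_partial[OF assms(1,2) has_real_derivative_vec_nth[OF assms(3)] assms(4)])
  then show ?thesis
    by (simp add: sum.distrib sum_distrib_right)
qed

context multi_pressure_laws
begin

definition total_pressure :: "real \<times> (real ^ 'n) \<Rightarrow> real" where
  "total_pressure X = (\<Sum>i\<in>UNIV. pressure (e i) (fst X) (snd X $ i))"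

definition total_pressure_slope :: "real \<times> (real ^ 'n) \<Rightarrow> real" where
  "total_pressure_slope X = (\<Sum>i\<in>UNIV. partial1 (pressure (e i)) (fst X) (snd X $ i))"

definition total_viscosity :: "real \<times> (real ^ 'n) \<Rightarrow> real" where
  "total_viscosity X = (\<Sum>i\<in>UNIV. \<mu> i (fst X) (snd X $ i))"

lemma smooth_temperature: "smooth_on ({0<..} \<times> UNIV) (\<lambda>(\<tau>, s). temperature (e i) \<tau> s)"
  unfolding temperature_def by (rule smooth_on_partial(2)[OF energy_smooth])

lemma smooth_pressure: "smooth_on ({0<..} \<times> UNIV) (\<lambda>(\<tau>, s). pressure (e i) \<tau> s)"
  using smooth_on_minus[OF open_half_plane smooth_on_partial(1)[OF energy_smooth]]
  by (simp add: pressure_def case_prod_unfold)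

lemmas smooth_pressure_slope = smooth_on_partial(1)[OF smooth_pressure]

lemma total_viscosity_pos': "fst X > 0 \<Longrightarrow> total_viscosity X > 0"
  unfolding total_viscosity_def by (rule total_viscosity_pos)

lemma partial_has_real_derivative:
  fixes q :: "real \<Rightarrow> real \<Rightarrow> real"
  assumes "smooth_on ({0<..} \<times> UNIV) (\<lambda>(\<tau>, s). q \<tau> s)" "\<tau> > 0"
  shows "((\<lambda>\<tau>. q \<tau> s) has_real_derivative partial1 q \<tau> s) (at \<tau>)"
    and "((\<lambda>s. q \<tau> s) has_real_derivative partial2 q \<tau> s) (at s)"
  using has_real_derivative_partial[OF assms(1) DERIV_ident DERIV_const assms(2)]
    has_real_derivative_partial[OF assms(1) DERIV_const DERIV_ident assms(2)] by simp_all

lemma energy_strict_mono: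
  assumes "\<tau> > 0" "s < s'" shows "e i \<tau> s < e i \<tau> s'"
  by (rule DERIV_pos_imp_increasing[OF assms(2)])
    (use partial_has_real_derivative(2)[OF energy_smooth assms(1)] temperature_pos[OF assms(1)]
      in \<open>fastforce simp: temperature_def\<close>)

lemma energy_antimono:
  assumes "0 < \<tau>" "\<tau> \<le> \<tau>'" shows "e i \<tau>' s \<le> e i \<tau> s"
proof (rule DERIV_nonpos_imp_nonincreasing[OF assms(2)])
  fix t assume "\<tau> \<le> t" "t \<le> \<tau>'"
  then have "t > 0" using assms by simp
  then have "partial1 (e i) t s \<le> 0"
    using pressure_pos[of t i s] by (simp add: pressure_def)
  then show "\<exists>y. ((\<lambda>\<tau>. e i \<tau> s) has_real_derivative y) (at t) \<and> y \<le> 0"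
    using partial_has_real_derivative(1)[OF energy_smooth \<open>t > 0\<close>] by blast
qed

lemma total_pressure_mono:
  assumes "\<tau> > 0" "\<And>i. s $ i \<le> s' $ i"
  shows "total_pressure (\<tau>, s) \<le> total_pressure (\<tau>, s')"
  unfolding total_pressure_def fst_conv snd_conv
proof (rule sum_mono)
  fix i
  show "pressure (e i) \<tau> (s $ i) \<le> pressure (e i) \<tau> (s' $ i)"
    by (rule DERIV_nonneg_imp_nondecreasing[OF assms(2)])
      (use partial_has_real_derivative(2)[OF smooth_pressure assms(1)]
        pressure_entropy_pos[OF assms(1)] less_imp_le in blast)
qed

lemma total_pressure_slope_strict_mono:
  assumes "0 < \<tau>" "\<tau> < \<tau>'"
  shows "total_pressure_slope (\<tau>, s) < total_pressure_slope (\<tau>', s)"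
proof (rule DERIV_pos_imp_increasing[OF assms(2)])
  fix t assume "\<tau> \<le> t" "t \<le> \<tau>'"
  then have "t > 0" using assms by simp
  have "((\<lambda>\<tau>. total_pressure_slope (\<tau>, s)) has_real_derivative
      (\<Sum>i\<in>UNIV. partial1 (partial1 (pressure (e i))) t (s $ i))) (at t)"
    unfolding total_pressure_slope_def fst_conv snd_conv
    by (intro DERIV_sum partial_has_real_derivative(1)[OF smooth_pressure_slope \<open>t > 0\<close>])
  then show "\<exists>y. ((\<lambda>\<tau>. total_pressure_slope (\<tau>, s)) has_real_derivative y) (at t) \<and> 0 < y"
    using total_pressure_convex[OF \<open>t > 0\<close>] by blast
qed

text \<open>By convexity the slope increases strictly towards its limit 0 at infinite volume. The
  limit yields a weak inequality only, so it is taken at \<tau> + 1 and strictness comes from the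
  step back to \<tau>. This makes the sound speed real and positive.\<close>

lemma total_pressure_slope_neg:
  assumes "\<tau> > 0" shows "total_pressure_slope (\<tau>, s) < 0"
proof -
  have "((\<lambda>\<tau>. total_pressure_slope (\<tau>, s)) \<longlongrightarrow> 0) at_top"
    unfolding total_pressure_slope_def fst_conv snd_conv
    by (rule total_pressure_volume_lim_volume_infinity)
  moreover have "\<forall>\<^sub>F t in at_top. total_pressure_slope (\<tau> + 1, s) \<le> total_pressure_slope (t, s)"
    using eventually_gt_at_top[of "\<tau> + 1"]
    by eventually_elim (use assms total_pressure_slope_strict_mono[of "\<tau> + 1"] in \<open>simp add: less_imp_le\<close>)
  ultimately have "total_pressure_slope (\<tau> + 1, s) \<le> 0"
    by (rule tendsto_lowerbound) simp
  moreover have "total_pressure_slope (\<tau>, s) < total_pressure_slope (\<tau> + 1, s)"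
    using assms by (intro total_pressure_slope_strict_mono) auto
  ultimately show ?thesis by simp
qed

end

section \<open>The shock curve\<close>

text \<open>\<open>m\<close> is the mass flux through the wave. Since u - \<sigma> is
  \<open>m\<close> times the volume, and the sound speed is the volume times the root of minus the
  pressure slope, the Lax inequality at the left state reduces to \<open>flux_pos\<close> together
  with \<open>supersonic\<close>.\<close>

locale shock_profile = multi_pressure_laws e \<mu>
  for e \<mu> :: "'n::finite \<Rightarrow> real \<Rightarrow> real \<Rightarrow> real" +
  fixes \<epsilon> m \<tau>\<^sub>L :: real and s\<^sub>L :: "real ^ 'n"
  assumes eps_pos: "\<epsilon> > 0" and flux_pos: "m > 0" and volume_pos: "\<tau>\<^sub>L > 0"
    and supersonic: "total_pressure_slope (\<tau>\<^sub>L, s\<^sub>L) + m\<^sup>2 > 0"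
begin

text \<open>The height of the total pressure above the Rayleigh line, the line of slope -
  \<open>m\<close>^2 through the left state.\<close>

definition G :: "real \<times> (real ^ 'n) \<Rightarrow> real" where
  "G X = total_pressure X - total_pressure (\<tau>\<^sub>L, s\<^sub>L) + m\<^sup>2 * (fst X - \<tau>\<^sub>L)"

text \<open>The viscous heat released per unit change of volume is \<open>G X\<close>. It is shared
  among the components in proportion to their viscosities, and division by the temperature converts
  heat into entropy.\<close>

definition F :: "real \<times> (real ^ 'n) \<Rightarrow> real ^ 'n" where
  "F X = (\<chi> i. \<mu> i (fst X) (snd X $ i) * G X /
     (total_viscosity X * temperature (e i) (fst X) (snd X $ i)))"

definition h :: "real \<times> (real ^ 'n) \<Rightarrow> real" where
  "h X = G X / (\<epsilon> * m * total_viscosity X)"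

definition \<Phi> :: "real \<times> (real ^ 'n) \<Rightarrow> real \<times> (real ^ 'n)" where
  "\<Phi> X = h X *\<^sub>R (1, F X)"

abbreviation \<Omega> :: "(real \<times> (real ^ 'n)) set" where
  "\<Omega> \<equiv> {0<..} \<times> UNIV"

lemma open_\<Omega>: "open \<Omega>"
  by (rule open_half_plane)

lemma convex_\<Omega>: "convex \<Omega>"
  by (intro convex_Times) auto

lemma smooth_total_pressure: "smooth_on \<Omega> total_pressure"
  unfolding total_pressure_def
  by (intro smooth_on_sum open_\<Omega> smooth_on_component smooth_pressure)

lemma smooth_total_viscosity: "smooth_on \<Omega> total_viscosity"
  unfolding total_viscosity_def
  by (intro smooth_on_sum open_\<Omega> smooth_on_component viscosity_smooth)

lemma smooth_G: "smooth_on \<Omega> G"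
  unfolding G_def
  by (intro smooth_on_add smooth_on_diff smooth_on_mult smooth_total_pressure smooth_on_const open_\<Omega>
      smooth_on_bounded_linear[OF bounded_linear_fst])

lemma smooth_F: "smooth_on \<Omega> F"
  unfolding F_def
  by (intro smooth_on_vec smooth_on_divide smooth_on_mult smooth_G smooth_total_viscosity open_\<Omega>
      smooth_on_component viscosity_smooth smooth_temperature)
    (use total_viscosity_pos' temperature_pos in \<open>fastforce simp: less_imp_neq[symmetric]\<close>)

lemma smooth_h: "smooth_on \<Omega> h"
  unfolding h_def
  by (intro smooth_on_divide smooth_on_mult smooth_G smooth_total_viscosity smooth_on_const open_\<Omega>)
    (use total_viscosity_pos' eps_pos flux_pos in \<open>fastforce simp: less_imp_neq[symmetric]\<close>)

lemma smooth_\<Phi>: "smooth_on \<Omega> \<Phi>"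
  unfolding \<Phi>_def
  by (intro smooth_on_scaleR smooth_h smooth_on_Pair smooth_on_const smooth_F open_\<Omega>)

lemma G_left [simp]: "G (\<tau>\<^sub>L, s\<^sub>L) = 0"
  by (simp add: G_def)

lemma F_eq_0: "G X = 0 \<Longrightarrow> F X = 0"
  by (simp add: F_def vec_eq_iff)

lemma F_sign:
  assumes "fst X > 0"
  shows "G X \<le> 0 \<Longrightarrow> F X $ i \<le> 0" "G X \<ge> 0 \<Longrightarrow> F X $ i \<ge> 0"
  using viscosity_nonneg[OF assms, of i "snd X $ i"] temperature_pos[OF assms, of i "snd X $ i"]
    total_viscosity_pos'[OF assms]
  by (auto simp: F_def divide_le_0_iff zero_le_divide_iff mult_le_0_iff zero_le_mult_iff)

lemma G_mono: "\<tau> > 0 \<Longrightarrow> (\<And>i. s $ i \<le> s' $ i) \<Longrightarrow> G (\<tau>, s) \<le> G (\<tau>, s')"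
  using total_pressure_mono by (simp add: G_def)

lemma has_real_derivative_G:
  assumes "(x has_real_derivative x') (at t)" "(s has_vector_derivative s') (at t)" "x t > 0"
  shows "((\<lambda>t. G (x t, s t)) has_real_derivative
    (total_pressure_slope (x t, s t) + m\<^sup>2) * x'
      + (\<Sum>i\<in>UNIV. partial2 (pressure (e i)) (x t) (s t $ i) * s' $ i)) (at t)"
proof -
  note P = has_real_derivative_sum_partial[OF smooth_pressure assms]
  have "((\<lambda>t. (\<Sum>i\<in>UNIV. pressure (e i) (x t) (s t $ i)) - total_pressure (\<tau>\<^sub>L, s\<^sub>L)
      + m\<^sup>2 * (x t - \<tau>\<^sub>L)) has_real_derivative
    (\<Sum>i\<in>UNIV. partial1 (pressure (e i)) (x t) (s t $ i)) * x'
      + (\<Sum>i\<in>UNIV. partial2 (pressure (e i)) (x t) (s t $ i) * s' $ i) - 0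
      + m\<^sup>2 * (x' - 0)) (at t)"
    by (intro DERIV_add DERIV_diff DERIV_cmult P assms(1) DERIV_const)
  then show ?thesis
    by (simp add: G_def total_pressure_def[of "(_, _)"] total_pressure_slope_def algebra_simps)
qed

text \<open>Along the shock curve the total energy depends on $\tau$ only: the viscous heating
  $\sum_i T_i F_i = G$ cancels the pressure work.\<close>

lemma has_real_derivative_total_energy:
  assumes "(s has_vector_derivative F (\<tau>, s \<tau>)) (at \<tau>)" "\<tau> > 0"
  shows "((\<lambda>\<tau>. \<Sum>i\<in>UNIV. e i \<tau> (s \<tau> $ i)) has_real_derivative
    m\<^sup>2 * (\<tau> - \<tau>\<^sub>L) - total_pressure (\<tau>\<^sub>L, s\<^sub>L)) (at \<tau>)"
proof -
  let ?X = "(\<tau>, s \<tau>)"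
  have "(\<Sum>i\<in>UNIV. partial2 (e i) \<tau> (s \<tau> $ i) * F ?X $ i)
      = (\<Sum>i\<in>UNIV. \<mu> i \<tau> (s \<tau> $ i) * (G ?X / total_viscosity ?X))"
  proof (rule sum.cong[OF refl])
    fix i
    show "partial2 (e i) \<tau> (s \<tau> $ i) * F ?X $ i = \<mu> i \<tau> (s \<tau> $ i) * (G ?X / total_viscosity ?X)"
      using temperature_pos[OF assms(2), of i "s \<tau> $ i"] by (simp add: F_def temperature_def)
  qed
  also have "\<dots> = total_viscosity ?X * (G ?X / total_viscosity ?X)"
    unfolding total_viscosity_def fst_conv snd_conv by (rule sum_distrib_right[symmetric])
  also have "\<dots> = G ?X"
    using total_viscosity_pos'[of ?X] assms(2) by simp
  finally have "(\<Sum>i\<in>UNIV. partial2 (e i) \<tau> (s \<tau> $ i) * F ?X $ i) = G ?X" .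
  moreover have "(\<Sum>i\<in>UNIV. partial1 (e i) \<tau> (s \<tau> $ i)) = - total_pressure ?X"
    by (simp add: total_pressure_def pressure_def sum_negf)
  ultimately show ?thesis
    by (intro DERIV_cong[OF has_real_derivative_sum_partial[where q = e, OF energy_smooth DERIV_ident assms]])
      (simp add: G_def algebra_simps)
qed

end

context shock_profile
begin

text \<open>Clamping makes the field globally Lipschitz, and adjoining the volume as a component of
  unit speed makes it autonomous, as \<open>global_picard\<close> demands. The result is an integral
  curve of \<open>F\<close> itself as long as its graph stays in the box.\<close>

lemma clamped_curve:
  assumes "cbox lo hi \<subseteq> \<Omega>" "(\<tau>\<^sub>L, s\<^sub>L) \<in> cbox lo hi"
  obtains S where "S \<tau>\<^sub>L = s\<^sub>L"
    "\<And>\<tau>. (S has_vector_derivative F (clamp lo hi (\<tau>, S \<tau>))) (at \<tau>)"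
proof -
  have "lo \<bullet> i \<le> hi \<bullet> i" if "i \<in> Basis" for i
    using assms(2) that box_ne_empty(1)[of lo hi] by auto
  then have cl: "clamp lo hi X \<in> cbox lo hi" for X
    by (rule clamp_in_interval)
  obtain L where L: "L > 0" "\<And>X Y. X \<in> cbox lo hi \<Longrightarrow> Y \<in> cbox lo hi \<Longrightarrow> norm (F X - F Y) \<le> L * norm (X - Y)"
    using smooth_on_lipschitz[OF smooth_F assms(1) compact_cbox convex_box(1)] by metis
  have "norm ((1, F (clamp lo hi X)) - (1 :: real, F (clamp lo hi Y))) \<le> L * norm (X - Y)" for X Y
  proof -
    have "norm ((1, F (clamp lo hi X)) - (1 :: real, F (clamp lo hi Y)))
        = norm (F (clamp lo hi X) - F (clamp lo hi Y))" by (simp add: norm_Pair)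
    also have "\<dots> \<le> L * norm (clamp lo hi X - clamp lo hi Y)" by (rule L(2)[OF cl cl])
    also have "\<dots> \<le> L * norm (X - Y)"
      using dist_clamps_le_dist_args[of lo hi X Y] L(1) by (simp add: dist_norm)
    finally show ?thesis .
  qed
  with L(1) obtain X where X: "X 0 = (\<tau>\<^sub>L, s\<^sub>L)"
    "\<And>t. (X has_vector_derivative (1, F (clamp lo hi (X t)))) (at t)"
    using global_picard[of L "\<lambda>X. (1, F (clamp lo hi X))" "(\<tau>\<^sub>L, s\<^sub>L)"] by metis
  have fst': "((\<lambda>t. fst (X t)) has_vector_derivative 1) (at t)" for t
    using bounded_linear.has_vector_derivative[OF bounded_linear_fst X(2)] by simp
  have snd': "((\<lambda>t. snd (X t)) has_vector_derivative F (clamp lo hi (X t))) (at t)" for t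
    using bounded_linear.has_vector_derivative[OF bounded_linear_snd X(2)] by simp
  have "((\<lambda>t. fst (X t) - t) has_vector_derivative 0) (at t within UNIV)" for t
    using has_vector_derivative_diff[OF fst' has_vector_derivative_id] by simp
  then obtain c where "\<And>t. fst (X t) - t = c"
    using has_vector_derivative_zero_constant[of UNIV "\<lambda>t. fst (X t) - t"] by (metis UNIV_I convex_UNIV)
  then have fst: "fst (X t) = \<tau>\<^sub>L + t" for t
    using X(1) by (metis add.commute diff_add_cancel diff_zero fst_conv)
  show ?thesis
  proof (rule that[of "\<lambda>\<tau>. snd (X (\<tau> - \<tau>\<^sub>L))"])
    show "snd (X (\<tau>\<^sub>L - \<tau>\<^sub>L)) = s\<^sub>L" by (simp add: X(1))
    fix \<tau>
    have "((\<lambda>\<tau>. \<tau> - \<tau>\<^sub>L) has_vector_derivative 1) (at \<tau>)"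
      by (auto intro!: derivative_eq_intros)
    from vector_diff_chain_at[OF this snd'[of "\<tau> - \<tau>\<^sub>L"]]
    have "((\<lambda>\<tau>. snd (X (\<tau> - \<tau>\<^sub>L))) has_vector_derivative F (clamp lo hi (X (\<tau> - \<tau>\<^sub>L)))) (at \<tau>)"
      by (simp add: o_def)
    moreover have "X (\<tau> - \<tau>\<^sub>L) = (\<tau>, snd (X (\<tau> - \<tau>\<^sub>L)))"
      using fst[of "\<tau> - \<tau>\<^sub>L"] by (simp add: prod_eq_iff)
    ultimately show "((\<lambda>\<tau>. snd (X (\<tau> - \<tau>\<^sub>L))) has_vector_derivative
        F (clamp lo hi (\<tau>, snd (X (\<tau> - \<tau>\<^sub>L))))) (at \<tau>)" by simp
  qed
qed

text \<open>A barrier with the entropies frozen at their left values. Along the curve the entropies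
  are at least these values, so \<open>G_mono\<close> shows that \<open>G\<close> has to vanish
  before \<tau> gets below the barrier.\<close>

lemma G_left_nonneg:
  obtains \<tau>\<^sub>0 where "0 < \<tau>\<^sub>0" "\<tau>\<^sub>0 < \<tau>\<^sub>L" "G (\<tau>\<^sub>0, s\<^sub>L) \<ge> 0"
proof -
  have "\<forall>\<^sub>F \<tau> in at_right 0. total_pressure (\<tau>\<^sub>L, s\<^sub>L) + m\<^sup>2 * \<tau>\<^sub>L \<le> (\<Sum>i\<in>UNIV. pressure (e i) \<tau> (s\<^sub>L $ i))"
    using total_pressure_lim_volume_0 by (simp add: filterlim_at_top)
  moreover have "\<forall>\<^sub>F \<tau> in at_right 0. 0 < \<tau> \<and> \<tau> < \<tau>\<^sub>L"
    using volume_pos by (auto simp: eventually_at_right[OF volume_pos] intro!: exI[of _ \<tau>\<^sub>L])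
  ultimately have "\<forall>\<^sub>F \<tau> in at_right 0. 0 < \<tau> \<and> \<tau> < \<tau>\<^sub>L \<and> G (\<tau>, s\<^sub>L) \<ge> 0"
  proof eventually_elim
    case (elim \<tau>)
    have "m\<^sup>2 * \<tau> \<ge> 0" using elim by simp
    with elim have "0 \<le> G (\<tau>, s\<^sub>L)"
      unfolding G_def total_pressure_def[of "(\<tau>, s\<^sub>L)"] fst_conv snd_conv right_diff_distrib by linarith
    with elim show ?case by simp
  qed
  then show ?thesis
    using that eventually_happens'[OF trivial_limit_at_right_real] by blast
qed

lemma has_real_derivative_G_curve:
  assumes "(S has_vector_derivative F (\<tau>, S \<tau>)) (at \<tau>)" "\<tau> > 0"
  shows "((\<lambda>\<tau>. G (\<tau>, S \<tau>)) has_real_derivative (total_pressure_slope (\<tau>, S \<tau>) + m\<^sup>2)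
      + (\<Sum>i\<in>UNIV. partial2 (pressure (e i)) \<tau> (S \<tau> $ i) * F (\<tau>, S \<tau>) $ i)) (at \<tau>)"
  using has_real_derivative_G[OF DERIV_ident assms] by simp

text \<open>A first-exit argument on the clamped curve, run from \<open>\<tau>\<^sub>L\<close> to
  the left. Two events can end it: \<open>G\<close> reaches 0, or some entropy reaches a ceiling
  \<open>U\<close>. One of them occurs no later than the barrier \<open>\<tau>0\<close>, and the
  energy balance rules out the ceiling. Up to that moment the clamping is inactive.\<close>

lemma shock_curve:
  obtains S \<tau>\<^sub>R where "0 < \<tau>\<^sub>R" "\<tau>\<^sub>R < \<tau>\<^sub>L" "S \<tau>\<^sub>L = s\<^sub>L"
    "\<And>\<tau>. \<tau> \<in> {\<tau>\<^sub>R..\<tau>\<^sub>L} \<Longrightarrow> (S has_vector_derivative F (\<tau>, S \<tau>)) (at \<tau>)"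
    "\<And>\<tau>. \<tau> \<in> {\<tau>\<^sub>R<..<\<tau>\<^sub>L} \<Longrightarrow> G (\<tau>, S \<tau>) < 0" "G (\<tau>\<^sub>R, S \<tau>\<^sub>R) = 0"
proof -
  obtain \<tau>0 where \<tau>0: "0 < \<tau>0" "\<tau>0 < \<tau>\<^sub>L" "G (\<tau>0, s\<^sub>L) \<ge> 0"
    using G_left_nonneg .
  define P\<^sub>L where "P\<^sub>L = total_pressure (\<tau>\<^sub>L, s\<^sub>L)"
  \<comment> \<open>An upper bound for the total energy along the curve. Its exact value, obtained
    below from the constancy of \<open>Q\<close>, is the left energy plus
    \<open>P\<^sub>L * (\<tau>\<^sub>L - \<tau>)\<close> plus
    \<open>m\<^sup>2 * (\<tau> - \<tau>\<^sub>L)\<^sup>2 / 2\<close>, estimated generously for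
    volumes between 0 and \<open>\<tau>\<^sub>L\<close>.\<close>
  define E where "E = (\<Sum>i\<in>UNIV. e i \<tau>\<^sub>L (s\<^sub>L $ i)) + P\<^sub>L * \<tau>\<^sub>L + m\<^sup>2 * \<tau>\<^sub>L\<^sup>2"
  have "P\<^sub>L \<ge> 0"
    unfolding P\<^sub>L_def total_pressure_def
    by (intro sum_nonneg) (simp add: less_imp_le[OF pressure_pos[OF volume_pos]])
  \<comment> \<open>The ceilings are chosen so that one component at its ceiling alone exceeds
    \<open>E\<close> at \<open>\<tau>\<^sub>L\<close>, and then also at every smaller volume, since
    energies decrease in the volume.\<close>
  have "\<exists>u. s\<^sub>L $ i < u \<and> E < e i \<tau>\<^sub>L u" for i
  proof -
    have "\<forall>\<^sub>F u in at_top. E < e i \<tau>\<^sub>L u"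
      using energy_lim_entropy[OF volume_pos] filterlim_at_top_dense by blast
    then have "\<forall>\<^sub>F u in at_top. s\<^sub>L $ i < u \<and> E < e i \<tau>\<^sub>L u"
      using eventually_gt_at_top eventually_conj by blast
    then show ?thesis using eventually_happens'[OF trivial_limit_at_top_linorder] by blast
  qed
  then obtain U' where "\<And>i. s\<^sub>L $ i < U' i \<and> E < e i \<tau>\<^sub>L (U' i)" by metis
  then obtain U :: "real ^ 'n" where U: "\<And>i. s\<^sub>L $ i < U $ i" "\<And>i. E < e i \<tau>\<^sub>L (U $ i)"
    using that[of "\<chi> i. U' i"] by simp
  \<comment> \<open>The bound \<open>\<tau>0 / 2\<close> keeps the box at positive volumes. The
    slack of 1 below the left entropies places the curve in the box near
    \<open>\<tau>\<^sub>L\<close> before its monotonicity is known.\<close>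
  define lo hi where "lo = (\<tau>0 / 2, \<chi> i. s\<^sub>L $ i - 1)" and "hi = (\<tau>\<^sub>L + 1, U)"
  have mem: "(\<tau>, s) \<in> cbox lo hi \<longleftrightarrow> \<tau>0 / 2 \<le> \<tau> \<and> \<tau> \<le> \<tau>\<^sub>L + 1 \<and> (\<forall>i. s\<^sub>L $ i - 1 \<le> s $ i \<and> s $ i \<le> U $ i)"
    for \<tau> s by (simp add: lo_def hi_def mem_box_cart)
  have box: "cbox lo hi \<subseteq> \<Omega>"
    using mem \<tau>0 by auto
  have boxL: "(\<tau>\<^sub>L, s\<^sub>L) \<in> cbox lo hi"
    using \<tau>0 U(1) by (simp add: mem less_imp_le)
  obtain S where SL: "S \<tau>\<^sub>L = s\<^sub>L"
    and S': "\<And>\<tau>. (S has_vector_derivative F (clamp lo hi (\<tau>, S \<tau>))) (at \<tau>)"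
    using clamped_curve[OF box boxL] by metis
  have contS: "continuous_on A S" for A
    using has_vector_derivative_continuous[OF S'] by (simp add: continuous_at_imp_continuous_on)
  then have contSi: "continuous_on A (\<lambda>\<tau>. S \<tau> $ i)" for A i
    by (intro continuous_intros)
  \<comment> \<open>The clamped value is what drives \<open>S\<close>; it can be identified with
    \<open>G (\<tau>, S \<tau>)\<close> only once the graph is known to lie in the box.\<close>
  define g where "g \<tau> = G (clamp lo hi (\<tau>, S \<tau>))" for \<tau>
  have "continuous_on UNIV (\<lambda>X. G (clamp lo hi X))"
    using clamp_continuous_on[OF continuous_on_subset[OF smooth_on_imp_continuous_on[OF smooth_G] box]] .
  then have contg: "continuous_on A g" for A
    unfolding g_def by (rule continuous_on_compose2) (auto intro!: continuous_intros contS)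
  \<comment> \<open>If no event occurs between \<open>r\<close> and \<open>\<tau>\<^sub>L\<close>,
    then \<open>g\<close> is nonpositive there, the entropies decrease in \<tau>, and so the graph
    lies in the box. Continuity includes the end \<open>r\<close>.\<close>
  have inside: "g \<tau> \<le> 0" "\<forall>i. s\<^sub>L $ i \<le> S \<tau> $ i \<and> S \<tau> $ i \<le> U $ i" "(\<tau>, S \<tau>) \<in> cbox lo hi"
    if r: "\<tau>0 \<le> r" "r < \<tau>\<^sub>L" and ok: "\<And>\<tau>. r < \<tau> \<Longrightarrow> \<tau> < \<tau>\<^sub>L \<Longrightarrow> g \<tau> < 0 \<and> (\<forall>i. S \<tau> $ i < U $ i)"
      and \<tau>: "\<tau> \<in> {r..\<tau>\<^sub>L}" for r \<tau>
  proof -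
    have g: "g x \<le> 0" if "x \<in> {r..\<tau>\<^sub>L}" for x
      using continuous_ge_on_Ioo[OF continuous_on_minus[OF contg], of r \<tau>\<^sub>L 0 x] ok r(2) that
      by (simp add: less_imp_le)
    have u: "S \<tau> $ i \<le> U $ i" for i
      using continuous_ge_on_Ioo[OF continuous_on_minus[OF contSi], of r \<tau>\<^sub>L "- (U $ i)" i \<tau>] ok r(2) \<tau>
      by (simp add: less_imp_le)
    have l: "s\<^sub>L $ i \<le> S \<tau> $ i" for i
    proof -
      have "S \<tau>\<^sub>L $ i \<le> S \<tau> $ i"
      proof (rule DERIV_nonpos_imp_nonincreasing[where f = "\<lambda>x. S x $ i"])
        fix x assume x: "\<tau> \<le> x" "x \<le> \<tau>\<^sub>L"
        have "clamp lo hi (x, S x) \<in> cbox lo hi"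
          using boxL box_ne_empty(1)[of lo hi] by auto
        then have "fst (clamp lo hi (x, S x)) > 0"
          using box by auto
        then have "F (clamp lo hi (x, S x)) $ i \<le> 0"
          using F_sign(1) g[of x] x \<tau> by (simp add: g_def)
        then show "\<exists>y. ((\<lambda>x. S x $ i) has_real_derivative y) (at x) \<and> y \<le> 0"
          using has_real_derivative_vec_nth[OF S'] by blast
      qed (use \<tau> in auto)
      then show ?thesis by (simp add: SL)
    qed
    show "g \<tau> \<le> 0" using g \<tau> by simp
    show *: "\<forall>i. s\<^sub>L $ i \<le> S \<tau> $ i \<and> S \<tau> $ i \<le> U $ i" using u l by simp
    have "s\<^sub>L $ i - 1 \<le> S \<tau> $ i" for i using l[of i] by linarith
    with u show "(\<tau>, S \<tau>) \<in> cbox lo hi" using \<tau> r \<tau>0 by (auto simp: mem)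
  qed
  obtain \<delta> where \<delta>: "\<delta> > 0" "\<delta> < \<tau>\<^sub>L - \<tau>0"
    "\<And>\<tau>. \<tau>\<^sub>L - \<delta> < \<tau> \<Longrightarrow> \<tau> < \<tau>\<^sub>L \<Longrightarrow> g \<tau> < 0 \<and> (\<forall>i. S \<tau> $ i < U $ i)"
  proof -
    have "\<forall>i. \<forall>\<^sub>F \<tau> in at \<tau>\<^sub>L. S \<tau> $ i < U $ i \<and> s\<^sub>L $ i - 1 < S \<tau> $ i"
    proof
      fix i
      have "((\<lambda>\<tau>. S \<tau> $ i) \<longlongrightarrow> s\<^sub>L $ i) (at \<tau>\<^sub>L)"
        unfolding SL[symmetric] using contSi[of UNIV i] by (auto simp: continuous_on_eq_continuous_at isCont_def)
      then show "\<forall>\<^sub>F \<tau> in at \<tau>\<^sub>L. S \<tau> $ i < U $ i \<and> s\<^sub>L $ i - 1 < S \<tau> $ i"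
        by (intro eventually_conj order_tendstoD[of _ "s\<^sub>L $ i"]) (use U(1) in auto)
    qed
    then have "\<forall>\<^sub>F \<tau> in at \<tau>\<^sub>L. \<forall>i. S \<tau> $ i < U $ i \<and> s\<^sub>L $ i - 1 < S \<tau> $ i"
      by (simp add: eventually_all_finite)
    then obtain d1 where d1: "d1 > 0" "\<And>\<tau> i. \<tau> \<noteq> \<tau>\<^sub>L \<Longrightarrow> dist \<tau> \<tau>\<^sub>L < d1 \<Longrightarrow> S \<tau> $ i < U $ i \<and> s\<^sub>L $ i - 1 < S \<tau> $ i"
      unfolding eventually_at by blast
    \<comment> \<open>\<open>F\<close> vanishes at the left state, so only the partial derivative of
      \<open>G\<close> in the volume remains; being positive, it makes \<open>G\<close> negative
      just to the left.\<close>
    have "((\<lambda>\<tau>. G (\<tau>, S \<tau>)) has_real_derivative total_pressure_slope (\<tau>\<^sub>L, s\<^sub>L) + m\<^sup>2) (at \<tau>\<^sub>L)"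
      using has_real_derivative_G_curve[of S \<tau>\<^sub>L] S'[of \<tau>\<^sub>L] boxL volume_pos
      by (simp add: SL F_eq_0)
    from DERIV_pos_inc_left[OF this supersonic] obtain d2 where
      d2: "d2 > 0" "\<And>h. h > 0 \<Longrightarrow> h < d2 \<Longrightarrow> G (\<tau>\<^sub>L - h, S (\<tau>\<^sub>L - h)) < 0"
      by (auto simp: SL)
    define \<delta> where "\<delta> = min (min d1 d2) ((\<tau>\<^sub>L - \<tau>0) / 2)"
    have \<delta>_le: "\<delta> \<le> d1" "\<delta> \<le> d2" "\<delta> \<le> (\<tau>\<^sub>L - \<tau>0) / 2"
      unfolding \<delta>_def by linarith+
    show ?thesis
    proof (rule that[of \<delta>])
      show "\<delta> > 0" "\<delta> < \<tau>\<^sub>L - \<tau>0" using d1(1) d2(1) \<tau>0 by (auto simp: \<delta>_def min_def)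
      fix \<tau> assume \<tau>: "\<tau>\<^sub>L - \<delta> < \<tau>" "\<tau> < \<tau>\<^sub>L"
      then have "\<tau>\<^sub>L - \<tau> < (\<tau>\<^sub>L - \<tau>0) / 2" using \<delta>_le(3) by linarith
      then have d: "\<tau> \<noteq> \<tau>\<^sub>L" "dist \<tau> \<tau>\<^sub>L < d1" "\<tau>\<^sub>L - \<tau> < d2" "\<tau>0 < \<tau>"
        using \<tau> \<delta>_le(1,2) \<tau>0(2) by (auto simp: dist_real_def)
      have "(\<tau>, S \<tau>) \<in> cbox lo hi"
        using d1(2)[OF d(1,2)] d \<tau> \<tau>0 by (auto simp: mem less_imp_le)
      then have "g \<tau> < 0"
        using d2(2)[of "\<tau>\<^sub>L - \<tau>"] \<tau> d by (simp add: g_def)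
      then show "g \<tau> < 0 \<and> (\<forall>i. S \<tau> $ i < U $ i)"
        using d1(2)[OF d(1,2)] by simp
    qed
  qed
  \<comment> \<open>The volumes at which an event occurs. Staying at distance \<delta> from
    \<open>\<tau>\<^sub>L\<close> discards the trivial zero of \<open>g\<close> at the left state
    and keeps the set closed.\<close>
  define A where "A = {\<tau>0..\<tau>\<^sub>L - \<delta>} \<inter> ({\<tau>. 0 \<le> g \<tau>} \<union> (\<Union>i. {\<tau>. U $ i \<le> S \<tau> $ i}))"
  have "closed A"
    unfolding A_def
    by (intro closed_Int closed_Un closed_UN ballI closed_Collect_le contg contSi continuous_on_const) auto
  have notA: "g \<tau> < 0 \<and> (\<forall>i. S \<tau> $ i < U $ i)" if "\<tau> \<notin> A" "\<tau>0 \<le> \<tau>" "\<tau> < \<tau>\<^sub>L" for \<tau>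
    using that \<delta>(3)[of \<tau>] unfolding A_def by (cases "\<tau> \<le> \<tau>\<^sub>L - \<delta>") (auto simp: not_le)
  \<comment> \<open>Otherwise \<open>G\<close> would be negative on the curve at
    \<open>\<tau>0\<close>, where it is at least its nonnegative value for frozen entropies.\<close>
  have "A \<noteq> {}"
  proof
    assume "A = {}"
    then have ok: "g \<tau> < 0 \<and> (\<forall>i. S \<tau> $ i < U $ i)" if "\<tau>0 \<le> \<tau>" "\<tau> < \<tau>\<^sub>L" for \<tau>
      using notA that by simp
    have "(\<tau>0, S \<tau>0) \<in> cbox lo hi" "\<forall>i. s\<^sub>L $ i \<le> S \<tau>0 $ i"
      using inside[of \<tau>0 \<tau>0] ok \<tau>0 by auto
    then have "G (\<tau>0, S \<tau>0) < 0" "G (\<tau>0, s\<^sub>L) \<le> G (\<tau>0, S \<tau>0)"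
      using ok[of \<tau>0] \<tau>0 G_mono[of \<tau>0 s\<^sub>L "S \<tau>0"] by (simp_all add: g_def)
    with \<tau>0(3) show False by simp
  qed
  have bdd: "bdd_above A" unfolding A_def by (auto intro!: bdd_aboveI[of _ "\<tau>\<^sub>L - \<delta>"])
  \<comment> \<open>The largest event is the first one met when moving left from
    \<open>\<tau>\<^sub>L\<close>.\<close>
  define \<tau>\<^sub>R where "\<tau>\<^sub>R = Sup A"
  have RA: "\<tau>\<^sub>R \<in> A"
    unfolding \<tau>\<^sub>R_def by (rule closed_contains_Sup[OF \<open>A \<noteq> {}\<close> bdd \<open>closed A\<close>])
  then have R: "\<tau>0 \<le> \<tau>\<^sub>R" "\<tau>\<^sub>R < \<tau>\<^sub>L" using \<delta>(1) by (auto simp: A_def)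
  have ok: "g \<tau> < 0 \<and> (\<forall>i. S \<tau> $ i < U $ i)" if "\<tau>\<^sub>R < \<tau>" "\<tau> < \<tau>\<^sub>L" for \<tau>
  proof (rule notA)
    show "\<tau> \<notin> A" using that cSup_upper[OF _ bdd] by (force simp: \<tau>\<^sub>R_def)
  qed (use that R in auto)
  note inside' = inside[OF R ok]
  have der: "(S has_vector_derivative F (\<tau>, S \<tau>)) (at \<tau>)" if "\<tau> \<in> {\<tau>\<^sub>R..\<tau>\<^sub>L}" for \<tau>
    using S'[of \<tau>] inside'(3)[of \<tau>] that by simp
  define Q where "Q \<tau> = (\<Sum>i\<in>UNIV. e i \<tau> (S \<tau> $ i)) + P\<^sub>L * \<tau> - m\<^sup>2 * (\<tau> - \<tau>\<^sub>L)\<^sup>2 / 2" for \<tau>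
  have "(Q has_real_derivative 0) (at \<tau>)" if "\<tau> \<in> {\<tau>\<^sub>R..\<tau>\<^sub>L}" for \<tau>
  proof -
    have "((\<lambda>\<tau>. f \<tau> + P\<^sub>L * \<tau> - m\<^sup>2 * (\<tau> - \<tau>\<^sub>L)\<^sup>2 / 2) has_real_derivative 0) (at \<tau>)"
      if "(f has_real_derivative m\<^sup>2 * (\<tau> - \<tau>\<^sub>L) - P\<^sub>L) (at \<tau>)" for f
      using that by (auto intro!: derivative_eq_intros simp: field_simps)
    then show ?thesis
      unfolding Q_def using has_real_derivative_total_energy[OF der[OF that]] that R \<tau>0
      by (simp add: P\<^sub>L_def)
  qed
  then have "Q \<tau>\<^sub>R \<le> Q \<tau>\<^sub>L"
    using R by (intro DERIV_nonneg_imp_nondecreasing[of \<tau>\<^sub>R \<tau>\<^sub>L Q]) auto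
  moreover have "m\<^sup>2 * (\<tau>\<^sub>R - \<tau>\<^sub>L)\<^sup>2 / 2 \<le> m\<^sup>2 * \<tau>\<^sub>L\<^sup>2"
  proof -
    have "(\<tau>\<^sub>R - \<tau>\<^sub>L)\<^sup>2 \<le> \<tau>\<^sub>L\<^sup>2"
      using R \<tau>0 by (intro power2_le_iff_abs_le[THEN iffD2]) auto
    then have "m\<^sup>2 * (\<tau>\<^sub>R - \<tau>\<^sub>L)\<^sup>2 \<le> m\<^sup>2 * \<tau>\<^sub>L\<^sup>2" by (rule mult_left_mono) simp
    moreover have "0 \<le> m\<^sup>2 * (\<tau>\<^sub>R - \<tau>\<^sub>L)\<^sup>2" by simp
    ultimately show ?thesis by linarith
  qed
  moreover have "0 \<le> P\<^sub>L * \<tau>\<^sub>R" using \<open>P\<^sub>L \<ge> 0\<close> R \<tau>0 by simp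
  ultimately have E: "(\<Sum>i\<in>UNIV. e i \<tau>\<^sub>R (S \<tau>\<^sub>R $ i)) \<le> E"
    by (simp add: Q_def E_def SL)
  \<comment> \<open>Rules out the ceiling: a component at its ceiling would by itself carry more
    than the energy bound \<open>E\<close>.\<close>
  have "S \<tau>\<^sub>R $ i < U $ i" for i
  proof (rule ccontr)
    assume "\<not> S \<tau>\<^sub>R $ i < U $ i"
    then have "e i \<tau>\<^sub>L (U $ i) \<le> e i \<tau>\<^sub>L (S \<tau>\<^sub>R $ i)"
      using energy_strict_mono[OF volume_pos] by (metis less_imp_le linorder_cases order_refl)
    also have "\<dots> \<le> e i \<tau>\<^sub>R (S \<tau>\<^sub>R $ i)"
      using R \<tau>0 by (intro energy_antimono) auto
    also have "\<dots> \<le> (\<Sum>i\<in>UNIV. e i \<tau>\<^sub>R (S \<tau>\<^sub>R $ i))"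
      using energy_pos R \<tau>0 by (intro member_le_sum) (auto intro: less_imp_le)
    finally show False using E U(2)[of i] by simp
  qed
  with RA have "g \<tau>\<^sub>R \<ge> 0" by (auto simp: A_def not_le[symmetric])
  moreover have "g \<tau>\<^sub>R \<le> 0" using inside'(1)[of \<tau>\<^sub>R] R by simp
  ultimately have "G (\<tau>\<^sub>R, S \<tau>\<^sub>R) = 0"
    using inside'(3)[of \<tau>\<^sub>R] R by (simp add: g_def)
  moreover have "G (\<tau>, S \<tau>) < 0" if "\<tau> \<in> {\<tau>\<^sub>R<..<\<tau>\<^sub>L}" for \<tau>
    using ok[of \<tau>] inside'(3)[of \<tau>] that by (simp add: g_def)
  ultimately show ?thesis
    using that[of \<tau>\<^sub>R S] R \<tau>0 SL der by auto
qed

text \<open>If $G_\tau \ge 0$ held at the end point, then convexity of the total pressure would make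
  $G$ positive immediately to the right of it.\<close>

lemma shock_curve_subsonic:
  assumes "0 < \<tau>\<^sub>R" "\<tau>\<^sub>R < \<tau>\<^sub>L"
    and S: "\<And>\<tau>. \<tau> \<in> {\<tau>\<^sub>R..\<tau>\<^sub>L} \<Longrightarrow> (S has_vector_derivative F (\<tau>, S \<tau>)) (at \<tau>)"
    and neg: "\<And>\<tau>. \<tau> \<in> {\<tau>\<^sub>R<..<\<tau>\<^sub>L} \<Longrightarrow> G (\<tau>, S \<tau>) < 0" and "G (\<tau>\<^sub>R, S \<tau>\<^sub>R) = 0"
  shows "total_pressure_slope (\<tau>\<^sub>R, S \<tau>\<^sub>R) + m\<^sup>2 < 0"
proof (rule ccontr)
  assume *: "\<not> ?thesis"
  define D where "D \<tau> = total_pressure_slope (\<tau>, S \<tau>) + m\<^sup>2" for \<tau>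
  define b where "b X = (\<Sum>i\<in>UNIV. partial2 (pressure (e i)) (fst X) (snd X $ i) * \<mu> i (fst X) (snd X $ i)
      / (total_viscosity X * temperature (e i) (fst X) (snd X $ i)))" for X :: "real \<times> (real ^ 'n)"
  have F_b: "(\<Sum>i\<in>UNIV. partial2 (pressure (e i)) (fst X) (snd X $ i) * F X $ i) = b X * G X" for X
    by (simp add: b_def F_def sum_distrib_right mult.assoc)
  have "smooth_on \<Omega> b"
    unfolding b_def
    by (intro smooth_on_sum smooth_on_divide smooth_on_mult smooth_total_viscosity open_\<Omega>
      smooth_on_component viscosity_smooth smooth_temperature smooth_on_partial(2)[OF smooth_pressure])
      (use total_viscosity_pos' temperature_pos in \<open>fastforce simp: less_imp_neq[symmetric]\<close>)
  moreover have contS: "continuous_on {\<tau>\<^sub>R..\<tau>\<^sub>L} S"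
    using has_vector_derivative_continuous[OF S] by (simp add: continuous_at_imp_continuous_on)
  ultimately have "continuous_on {\<tau>\<^sub>R..\<tau>\<^sub>L} (\<lambda>\<tau>. b (\<tau>, S \<tau>))"
    using assms(1)
    by (intro continuous_on_compose2[OF smooth_on_imp_continuous_on, of \<Omega> b]) (auto intro!: continuous_intros)
  then have "bounded ((\<lambda>\<tau>. b (\<tau>, S \<tau>)) ` {\<tau>\<^sub>R..\<tau>\<^sub>L})"
    by (intro compact_imp_bounded compact_continuous_image) auto
  then obtain B where B: "\<And>\<tau>. \<tau> \<in> {\<tau>\<^sub>R..\<tau>\<^sub>L} \<Longrightarrow> b (\<tau>, S \<tau>) \<le> B"
    unfolding bounded_iff by (metis abs_le_iff imageI real_norm_def)
  \<comment> \<open>At the end point \<open>F\<close> vanishes, so the entropy terms drop out and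
    convexity decides the sign. Thus \<open>D\<close> becomes positive to the right even if it is
    zero at \<open>\<tau>\<^sub>R\<close>.\<close>
  have "(D has_real_derivative (\<Sum>i\<in>UNIV. partial1 (partial1 (pressure (e i))) \<tau>\<^sub>R (S \<tau>\<^sub>R $ i))) (at \<tau>\<^sub>R)"
    using has_real_derivative_sum_partial[where q = "\<lambda>i. partial1 (pressure (e i))", OF smooth_pressure_slope DERIV_ident S[of \<tau>\<^sub>R]]
      assms(1,2,5)
    unfolding D_def total_pressure_slope_def fst_conv snd_conv
    by (auto simp: F_eq_0 intro!: DERIV_add[where E = 0, simplified])
  from DERIV_pos_inc_right[OF this total_pressure_convex[OF assms(1)]]
  obtain d where d: "d > 0" "\<And>h. h > 0 \<Longrightarrow> h < d \<Longrightarrow> D \<tau>\<^sub>R < D (\<tau>\<^sub>R + h)" by blast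
  define h where "h = min d (\<tau>\<^sub>L - \<tau>\<^sub>R) / 2"
  have h: "0 < h" "h < d" "\<tau>\<^sub>R + h < \<tau>\<^sub>L"
    using d(1) assms(2) by (auto simp: h_def min_def field_simps)
  \<comment> \<open>Since \<open>G\<close> is nonpositive and \<open>B\<close> bounds
    \<open>b\<close> from above, this integrating factor leaves a nonnegative derivative, so
    \<open>?w\<close> cannot fall below its initial value 0.\<close>
  let ?w = "\<lambda>\<tau>. G (\<tau>, S \<tau>) * exp (- B * \<tau>)"
  have "?w \<tau>\<^sub>R \<le> ?w (\<tau>\<^sub>R + h)"
  proof (rule DERIV_nonneg_imp_nondecreasing[where f = ?w])
    fix \<tau> assume \<tau>: "\<tau>\<^sub>R \<le> \<tau>" "\<tau> \<le> \<tau>\<^sub>R + h"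
    have "D \<tau> \<ge> 0"
      using d(2)[of "\<tau> - \<tau>\<^sub>R"] \<tau> h * by (cases "\<tau> = \<tau>\<^sub>R") (auto simp: D_def)
    moreover have "G (\<tau>, S \<tau>) \<le> 0"
      using neg[of \<tau>] \<tau> h assms(5) by (cases "\<tau> = \<tau>\<^sub>R") auto
    then have "(b (\<tau>, S \<tau>) - B) * G (\<tau>, S \<tau>) \<ge> 0"
      using B[of \<tau>] \<tau> h by (intro mult_nonpos_nonpos) auto
    ultimately have "0 \<le> (D \<tau> + (b (\<tau>, S \<tau>) - B) * G (\<tau>, S \<tau>)) * exp (- B * \<tau>)"
      by simp
    moreover have "((\<lambda>\<tau>. G (\<tau>, S \<tau>)) has_real_derivative D \<tau> + b (\<tau>, S \<tau>) * G (\<tau>, S \<tau>)) (at \<tau>)"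
      using has_real_derivative_G_curve[OF S[of \<tau>]] F_b[of "(\<tau>, S \<tau>)"] \<tau> h assms(1) by (simp add: D_def)
    then have "(?w has_real_derivative (D \<tau> + (b (\<tau>, S \<tau>) - B) * G (\<tau>, S \<tau>)) * exp (- B * \<tau>)) (at \<tau>)"
      by (auto intro!: derivative_eq_intros simp: algebra_simps)
    ultimately show "\<exists>y. (?w has_real_derivative y) (at \<tau>) \<and> 0 \<le> y" by blast
  qed (use h in simp)
  then have "0 \<le> G (\<tau>\<^sub>R + h, S (\<tau>\<^sub>R + h))"
    using assms(5) by (simp add: zero_le_mult_iff)
  then show False
    using neg[of "\<tau>\<^sub>R + h"] h by simp
qed

end

section \<open>Shock profiles\<close>

lemma mono_tendsto_bounds:
  fixes f :: "real \<Rightarrow> real"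
  assumes "mono f"
  shows "(f \<longlongrightarrow> l) at_bot \<Longrightarrow> l \<le> f t" "(f \<longlongrightarrow> l) at_top \<Longrightarrow> f t \<le> l"
proof -
  have "\<forall>\<^sub>F x in at_bot. f x \<le> f t"
    by (rule eventually_mono[OF eventually_le_at_bot]) (rule monoD[OF assms])
  moreover have "\<forall>\<^sub>F x in at_top. f t \<le> f x"
    by (rule eventually_mono[OF eventually_ge_at_top]) (rule monoD[OF assms])
  ultimately show "(f \<longlongrightarrow> l) at_bot \<Longrightarrow> l \<le> f t" "(f \<longlongrightarrow> l) at_top \<Longrightarrow> f t \<le> l"
    using tendsto_upperbound[of f l at_bot "f t"] tendsto_lowerbound[of f l at_top "f t"] by auto
qed

lemma mono_of_nonneg_derivative:
  fixes f :: "real \<Rightarrow> real"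
  assumes "\<And>t. (f has_real_derivative f' t) (at t)" "\<And>t. 0 \<le> f' t"
  shows "mono f"
proof (rule monoI)
  fix x y :: real assume "x \<le> y"
  then show "f x \<le> f y"
    by (rule DERIV_nonneg_imp_nondecreasing) (use assms in blast)
qed

context shock_profile
begin

text \<open>A trajectory of the reduced system issuing from the left state. Its smoothness follows
  from the equation by \<open>smooth_on_autonomous_solution\<close>, and that \<open>R\<close> is a
  zero of \<open>G\<close> is derived inside \<open>profile_G_neg\<close>.\<close>

definition profile :: "(real \<Rightarrow> real \<times> (real ^ 'n)) \<Rightarrow> real \<times> (real ^ 'n) \<Rightarrow> bool" where
  "profile X R \<longleftrightarrow> range X \<subseteq> \<Omega> \<and> (\<forall>\<xi>. (X has_vector_derivative \<Phi> (X \<xi>)) (at \<xi>)) \<and>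
     \<not> X constant_on UNIV \<and> (X \<longlongrightarrow> (\<tau>\<^sub>L, s\<^sub>L)) at_bot \<and> (X \<longlongrightarrow> R) at_top \<and> R \<in> \<Omega>"

lemma isCont_smooth_on_\<Omega>: "smooth_on \<Omega> f \<Longrightarrow> X \<in> \<Omega> \<Longrightarrow> isCont f X"
  using smooth_on_imp_continuous_on[of \<Omega> f] continuous_on_eq_continuous_at[OF open_\<Omega>] by blast

lemma \<Phi>_components:
  assumes "(X has_vector_derivative \<Phi> (X \<xi>)) (at \<xi>)"
  shows "((\<lambda>\<xi>. fst (X \<xi>)) has_real_derivative h (X \<xi>)) (at \<xi>)"
    and "((\<lambda>\<xi>. snd (X \<xi>)) has_vector_derivative h (X \<xi>) *\<^sub>R F (X \<xi>)) (at \<xi>)"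
  using bounded_linear.has_vector_derivative[OF bounded_linear_fst assms]
    bounded_linear.has_vector_derivative[OF bounded_linear_snd assms]
  by (simp_all add: \<Phi>_def has_real_derivative_iff_has_vector_derivative)

lemma h_sign:
  assumes "X \<in> \<Omega>"
  shows "h X = 0 \<longleftrightarrow> G X = 0" "h X < 0 \<longleftrightarrow> G X < 0" "h X > 0 \<longleftrightarrow> G X > 0"
proof -
  have "\<epsilon> * m * total_viscosity X > 0"
    using assms total_viscosity_pos'[of X] eps_pos flux_pos by (auto simp: mem_Times_iff)
  then show "h X = 0 \<longleftrightarrow> G X = 0" "h X < 0 \<longleftrightarrow> G X < 0" "h X > 0 \<longleftrightarrow> G X > 0"
    by (auto simp: h_def divide_less_0_iff zero_less_divide_iff)
qed

text \<open>By convexity the derivative in the volume can only grow from its positive value at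
  \<open>\<tau>\<^sub>L\<close>. This is the obstruction to expansive profiles.\<close>

lemma G_pos_right:
  assumes "\<tau> > \<tau>\<^sub>L" shows "G (\<tau>, s\<^sub>L) > 0"
proof -
  have "G (\<tau>\<^sub>L, s\<^sub>L) < G (\<tau>, s\<^sub>L)"
  proof (rule DERIV_pos_imp_increasing[where f = "\<lambda>\<tau>. G (\<tau>, s\<^sub>L)", OF assms])
    fix x assume x: "\<tau>\<^sub>L \<le> x" "x \<le> \<tau>"
    have "((\<lambda>\<tau>. G (\<tau>, s\<^sub>L)) has_real_derivative total_pressure_slope (x, s\<^sub>L) + m\<^sup>2) (at x)"
      using has_real_derivative_G[OF DERIV_ident has_vector_derivative_const[of s\<^sub>L], of x] x volume_pos by simp
    moreover have "total_pressure_slope (\<tau>\<^sub>L, s\<^sub>L) \<le> total_pressure_slope (x, s\<^sub>L)"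
      using total_pressure_slope_strict_mono[OF volume_pos, of x s\<^sub>L] x
      by (cases "x = \<tau>\<^sub>L") (auto intro: less_imp_le)
    ultimately show "\<exists>y. ((\<lambda>\<tau>. G (\<tau>, s\<^sub>L)) has_real_derivative y) (at x) \<and> 0 < y"
      using supersonic by (intro exI[of _ "total_pressure_slope (x, s\<^sub>L) + m\<^sup>2"]) auto
  qed
  then show ?thesis by simp
qed

text \<open>Zeros of \<open>G\<close> are equilibria, which a nonconstant orbit never meets, so the
  sign is constant. If it were positive, volume and entropies would increase to \<open>R\<close>,
  and \<open>G_mono\<close> with \<open>G_pos_right\<close> would give \<open>G R\<close> > 0,
  although \<open>R\<close> is an equilibrium.\<close>

lemma profile_G_neg:
  assumes "profile Y R" shows "G (Y \<xi>) < 0"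
proof -
  have Y: "\<And>\<xi>. Y \<xi> \<in> \<Omega>" "\<And>\<xi>. (Y has_vector_derivative \<Phi> (Y \<xi>)) (at \<xi>)" "\<not> Y constant_on UNIV"
    "(Y \<longlongrightarrow> (\<tau>\<^sub>L, s\<^sub>L)) at_bot" "(Y \<longlongrightarrow> R) at_top" "R \<in> \<Omega>"
    using assms unfolding profile_def by blast+
  have G0: "G (Y \<xi>) \<noteq> 0" for \<xi>
  proof
    assume "G (Y \<xi>) = 0"
    then have "\<Phi> (Y \<xi>) = 0" by (simp add: \<Phi>_def h_def zero_prod_def)
    then have c: "((\<lambda>t. Y \<xi>) has_vector_derivative \<Phi> (Y \<xi>)) (at t)" for t by simp
    have "Y t = Y \<xi>" for t
      by (rule smooth_vector_field_solution_unique[OF smooth_\<Phi> convex_\<Omega> _ _ Y(2) c refl])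
        (use Y(1) in \<open>simp_all only: image_subset_iff ball_simps simp_thms\<close>)
    then show False using Y(3) unfolding constant_on_def by blast
  qed
  have contG: "isCont (\<lambda>\<xi>. G (Y \<xi>)) \<xi>" for \<xi>
    using isCont_o2[of \<xi> Y G, OF _ isCont_smooth_on_\<Omega>[OF smooth_G Y(1)]]
      has_vector_derivative_continuous[OF Y(2), of \<xi>] by simp
  \<comment> \<open>The volume converges and its derivative tends to \<open>h R\<close>, so
    \<open>h R\<close> must be 0.\<close>
  have GR: "G R = 0"
  proof -
    have "((\<lambda>\<xi>. h (Y \<xi>)) \<longlongrightarrow> h R) at_top"
      by (rule isCont_tendsto_compose[OF isCont_smooth_on_\<Omega>[OF smooth_h Y(6)] Y(5)])
    from tendsto_derivative_at_top[OF \<Phi>_components(1)[OF Y(2)] tendsto_fst[OF Y(5)] this]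
    show ?thesis using h_sign(1)[OF Y(6)] by simp
  qed
  show ?thesis
  proof (rule ccontr)
    assume "\<not> ?thesis"
    then have "G (Y \<xi>) > 0" using G0[of \<xi>] by simp
    have conn: "connected (range (\<lambda>\<xi>. G (Y \<xi>)))"
      using contG by (intro connected_continuous_image continuous_at_imp_continuous_on) auto
    have pos: "G (Y t) > 0" for t
    proof (rule ccontr)
      assume "\<not> G (Y t) > 0"
      then have "0 \<in> range (\<lambda>\<xi>. G (Y \<xi>))"
        using connectedD_interval[OF conn rangeI rangeI, of t 0 \<xi>] \<open>G (Y \<xi>) > 0\<close> by simp
      then show False using G0 by auto
    qed
    have hpos: "h (Y t) > 0" for t using pos h_sign(3)[OF Y(1)] by blast
    have mono: "mono (\<lambda>\<xi>. fst (Y \<xi>))"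
      by (rule mono_of_nonneg_derivative[OF \<Phi>_components(1)[OF Y(2)]]) (use hpos less_imp_le in blast)
    have "fst (Y 0) < fst (Y 1)"
      by (rule DERIV_pos_imp_increasing[of 0 1 "\<lambda>\<xi>. fst (Y \<xi>)"]) (use \<Phi>_components(1)[OF Y(2)] hpos in auto)
    moreover have "\<tau>\<^sub>L \<le> fst (Y 0)" "fst (Y 1) \<le> fst R"
      using mono_tendsto_bounds[OF mono] tendsto_fst[OF Y(4)] tendsto_fst[OF Y(5)] by auto
    ultimately have "\<tau>\<^sub>L < fst R" by simp
    have "s\<^sub>L $ i \<le> snd R $ i" for i
    proof -
      have "mono (\<lambda>\<xi>. snd (Y \<xi>) $ i)"
      proof (rule mono_of_nonneg_derivative[OF has_real_derivative_vec_nth[OF \<Phi>_components(2)[OF Y(2)]]])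
        show "0 \<le> (h (Y t) *\<^sub>R F (Y t)) $ i" for t
          using F_sign(2)[of "Y t" i] pos[of t] hpos[of t] Y(1)[of t] by (auto simp: mem_Times_iff)
      qed
      then have "s\<^sub>L $ i \<le> snd (Y 0) $ i" "snd (Y 0) $ i \<le> snd R $ i"
        using mono_tendsto_bounds[of "\<lambda>\<xi>. snd (Y \<xi>) $ i"] tendsto_vec_nth[OF tendsto_snd[OF Y(4)]]
          tendsto_vec_nth[OF tendsto_snd[OF Y(5)]] by auto
      then show ?thesis by simp
    qed
    then have "G (fst R, s\<^sub>L) \<le> G (fst R, snd R)"
      using Y(6) by (intro G_mono) (auto simp: mem_Times_iff)
    then show False
      using G_pos_right[OF \<open>\<tau>\<^sub>L < fst R\<close>] GR by simp
  qed
qed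

text \<open>The Gronwall factor $\exp(2L\tau)$ stays bounded as $\xi \to -\infty$, so an orbit issuing from
  the left-hand state cannot leave the shock curve.\<close>

lemma profile_meets_shock_curve:
  assumes "profile Y R" "0 < \<tau>\<^sub>R" "\<tau>\<^sub>R < \<tau>\<^sub>L" "S \<tau>\<^sub>L = s\<^sub>L"
    and S: "\<And>\<tau>. \<tau> \<in> {\<tau>\<^sub>R..\<tau>\<^sub>L} \<Longrightarrow> (S has_vector_derivative F (\<tau>, S \<tau>)) (at \<tau>)"
  obtains \<xi> where "\<tau>\<^sub>R < fst (Y \<xi>)" "fst (Y \<xi>) < \<tau>\<^sub>L" "snd (Y \<xi>) = S (fst (Y \<xi>))"
proof -
  have Y: "\<And>\<xi>. Y \<xi> \<in> \<Omega>" "\<And>\<xi>. (Y has_vector_derivative \<Phi> (Y \<xi>)) (at \<xi>)"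
    "(Y \<longlongrightarrow> (\<tau>\<^sub>L, s\<^sub>L)) at_bot"
    using assms(1) unfolding profile_def by blast+
  have hneg: "h (Y \<xi>) < 0" for \<xi> using profile_G_neg[OF assms(1)] h_sign(2)[OF Y(1)] by blast
  note fst' = \<Phi>_components(1)[OF Y(2)] and snd' = \<Phi>_components(2)[OF Y(2)]
  \<comment> \<open>The limit at minus infinity gives a weak bound; one unit of strict decrease
    before \<xi> makes it strict. The orbit thus stays at volumes below
    \<open>\<tau>\<^sub>L\<close>, where it can be compared with the curve.\<close>
  have lt: "fst (Y \<xi>) < \<tau>\<^sub>L" for \<xi>
  proof -
    have "fst (Y \<xi>) < fst (Y (\<xi> - 1))"
      by (rule DERIV_neg_imp_decreasing[of "\<xi> - 1" \<xi> "\<lambda>\<xi>. fst (Y \<xi>)"]) (use fst' hneg in auto)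
    moreover have "mono (\<lambda>\<xi>. - fst (Y \<xi>))"
      by (rule mono_of_nonneg_derivative[OF DERIV_minus[OF fst']]) (simp add: less_imp_le[OF hneg])
    then have "- \<tau>\<^sub>L \<le> - fst (Y (\<xi> - 1))"
      by (rule mono_tendsto_bounds(1)) (use tendsto_minus[OF tendsto_fst[OF Y(3)]] in simp)
    ultimately show ?thesis by simp
  qed
  obtain r where r: "r > 0" "cball (\<tau>\<^sub>L, s\<^sub>L) r \<subseteq> \<Omega>"
    using open_contains_cball[of \<Omega>] open_\<Omega> volume_pos by (metis (no_types) UNIV_I SigmaI greaterThan_iff)
  obtain L where L: "L > 0" "\<And>X X'. X \<in> cball (\<tau>\<^sub>L, s\<^sub>L) r \<Longrightarrow> X' \<in> cball (\<tau>\<^sub>L, s\<^sub>L) r \<Longrightarrow>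
      norm (F X - F X') \<le> L * norm (X - X')"
    using smooth_on_lipschitz[OF smooth_F r(2) compact_cball convex_cball] by metis
  have "isCont S \<tau>\<^sub>L"
    using has_vector_derivative_continuous[OF S, of \<tau>\<^sub>L] assms(3) by simp
  then have Slim: "((\<lambda>\<xi>. S (fst (Y \<xi>))) \<longlongrightarrow> s\<^sub>L) at_bot"
    using isCont_tendsto_compose[OF _ tendsto_fst[OF Y(3)], of S] assms(4) by simp
  have Clim: "((\<lambda>\<xi>. (fst (Y \<xi>), S (fst (Y \<xi>)))) \<longlongrightarrow> (\<tau>\<^sub>L, s\<^sub>L)) at_bot"
    using tendsto_Pair[OF tendsto_fst[OF Y(3)] Slim] by simp
  have "\<forall>\<^sub>F \<xi> in at_bot. dist (Y \<xi>) (\<tau>\<^sub>L, s\<^sub>L) < r \<and> dist (fst (Y \<xi>), S (fst (Y \<xi>))) (\<tau>\<^sub>L, s\<^sub>L) < r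
      \<and> \<tau>\<^sub>R < fst (Y \<xi>)"
    using tendstoD[OF Y(3) r(1)] tendstoD[OF Clim r(1)] order_tendstoD(1)[OF tendsto_fst[OF Y(3)], of \<tau>\<^sub>R] assms(3)
    by (simp add: eventually_conj)
  then obtain \<xi>1 where \<xi>1: "\<And>\<xi>. \<xi> \<le> \<xi>1 \<Longrightarrow> Y \<xi> \<in> cball (\<tau>\<^sub>L, s\<^sub>L) r \<and>
      (fst (Y \<xi>), S (fst (Y \<xi>))) \<in> cball (\<tau>\<^sub>L, s\<^sub>L) r \<and> \<tau>\<^sub>R < fst (Y \<xi>)"
    unfolding eventually_at_bot_linorder by (metis dist_commute less_imp_le mem_cball)
  \<comment> \<open>Orbit and curve are compared at equal volume, not at equal \<xi>, so both sides
    carry the same speed factor \<open>h\<close>.\<close>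
  define D where "D \<xi> = snd (Y \<xi>) - S (fst (Y \<xi>))" for \<xi>
  have D': "(D has_vector_derivative h (Y \<xi>) *\<^sub>R (F (Y \<xi>) - F (fst (Y \<xi>), S (fst (Y \<xi>))))) (at \<xi>)"
    if "\<xi> \<le> \<xi>1" for \<xi>
  proof -
    have "((\<lambda>\<xi>. S (fst (Y \<xi>))) has_vector_derivative h (Y \<xi>) *\<^sub>R F (fst (Y \<xi>), S (fst (Y \<xi>)))) (at \<xi>)"
      using vector_diff_chain_at[OF fst'[of \<xi>, unfolded has_real_derivative_iff_has_vector_derivative] S]
        \<xi>1[OF that] lt[of \<xi>] by (simp add: o_def)
    from has_vector_derivative_diff[OF snd' this] show ?thesis
      unfolding D_def by (simp add: scaleR_diff_right)
  qed
  \<comment> \<open>As \<open>h\<close> is negative, - \<open>L\<close> * \<open>h\<close> is a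
    nonnegative Gronwall rate; its antiderivative is a multiple of the volume and therefore
    converges at minus infinity.\<close>
  have K': "((\<lambda>\<xi>. - L * fst (Y \<xi>)) has_real_derivative - L * h (Y \<xi>)) (at \<xi>)" for \<xi>
    by (rule DERIV_cmult[OF fst'])
  have bound: "norm (h (Y \<xi>) *\<^sub>R (F (Y \<xi>) - F (fst (Y \<xi>), S (fst (Y \<xi>))))) \<le> - L * h (Y \<xi>) * norm (D \<xi>)"
    if "\<xi> \<le> \<xi>1" for \<xi>
  proof -
    have "norm (Y \<xi> - (fst (Y \<xi>), S (fst (Y \<xi>)))) = norm (D \<xi>)"
      by (cases "Y \<xi>") (simp add: D_def norm_Pair)
    with L(2)[of "Y \<xi>" "(fst (Y \<xi>), S (fst (Y \<xi>)))"] \<xi>1[OF that]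
    have "norm (F (Y \<xi>) - F (fst (Y \<xi>), S (fst (Y \<xi>)))) \<le> L * norm (D \<xi>)" by simp
    then have "- h (Y \<xi>) * norm (F (Y \<xi>) - F (fst (Y \<xi>), S (fst (Y \<xi>)))) \<le> - h (Y \<xi>) * (L * norm (D \<xi>))"
      using hneg[of \<xi>] by (intro mult_left_mono) auto
    then show ?thesis using hneg[of \<xi>] by (simp add: mult_ac)
  qed
  have gron: "(norm (D \<xi>1))\<^sup>2 * exp (- 2 * (- L * fst (Y \<xi>1))) \<le> (norm (D \<xi>))\<^sup>2 * exp (- 2 * (- L * fst (Y \<xi>)))"
    if "\<xi> \<le> \<xi>1" for \<xi>
    by (rule gronwall_norm_square(1)[OF that D' K' bound]) auto
  have "(D \<longlongrightarrow> s\<^sub>L - s\<^sub>L) at_bot"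
    unfolding D_def using tendsto_snd[OF Y(3)] Slim by (intro tendsto_diff) auto
  then have "((\<lambda>\<xi>. (norm (D \<xi>))\<^sup>2 * exp (- 2 * (- L * fst (Y \<xi>)))) \<longlongrightarrow> (norm (s\<^sub>L - s\<^sub>L))\<^sup>2 * exp (- 2 * (- L * fst (\<tau>\<^sub>L, s\<^sub>L)))) at_bot"
    by (intro tendsto_intros Y(3))
  \<comment> \<open>Letting \<xi> tend to minus infinity: orbit and curve share the left state, so
    the bound tends to 0.\<close>
  then have "(norm (D \<xi>1))\<^sup>2 * exp (- 2 * (- L * fst (Y \<xi>1))) \<le> (norm (s\<^sub>L - s\<^sub>L))\<^sup>2 * exp (- 2 * (- L * fst (\<tau>\<^sub>L, s\<^sub>L)))"
    by (rule tendsto_lowerbound) (use gron in \<open>auto intro: eventually_at_bot_linorderI[of \<xi>1]\<close>)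
  then have "D \<xi>1 = 0" by (simp add: mult_le_0_iff)
  then show ?thesis
    using that[of \<xi>1] \<xi>1[of \<xi>1] lt[of \<xi>1] by (simp add: D_def)
qed

text \<open>Restricted to the curve, the system is one scalar equation with equilibria exactly at
  the two ends. Its Lipschitz constant combines that of \<open>h\<close> on the convex hull of the
  curve with 1 + \<open>M\<close> for the graph of \<open>S\<close>, where \<open>M\<close> bounds
  its slope \<open>F\<close>.\<close>

lemma shock_curve_heteroclinic:
  assumes "0 < \<tau>\<^sub>R" "\<tau>\<^sub>R < \<tau>\<^sub>L" "S \<tau>\<^sub>L = s\<^sub>L"
    and S: "\<And>\<tau>. \<tau> \<in> {\<tau>\<^sub>R..\<tau>\<^sub>L} \<Longrightarrow> (S has_vector_derivative F (\<tau>, S \<tau>)) (at \<tau>)"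
    and neg: "\<And>\<tau>. \<tau> \<in> {\<tau>\<^sub>R<..<\<tau>\<^sub>L} \<Longrightarrow> G (\<tau>, S \<tau>) < 0" and "G (\<tau>\<^sub>R, S \<tau>\<^sub>R) = 0"
  obtains \<theta> where "\<And>\<xi>. (\<theta> has_real_derivative h (\<theta> \<xi>, S (\<theta> \<xi>))) (at \<xi>)"
    "\<And>\<xi>. \<tau>\<^sub>R < \<theta> \<xi>" "\<And>\<xi>. \<theta> \<xi> < \<tau>\<^sub>L" "(\<theta> \<longlongrightarrow> \<tau>\<^sub>L) at_bot" "(\<theta> \<longlongrightarrow> \<tau>\<^sub>R) at_top"
proof -
  let ?I = "{\<tau>\<^sub>R..\<tau>\<^sub>L}" and ?Y = "\<lambda>\<tau>. (\<tau>, S \<tau>)"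
  have contY: "continuous_on ?I ?Y"
    using has_vector_derivative_continuous[OF S]
    by (intro continuous_on_Pair continuous_on_id continuous_at_imp_continuous_on) auto
  have YO: "?Y \<tau> \<in> \<Omega>" if "\<tau> \<in> ?I" for \<tau> using that assms(1) by auto
  have K: "compact (convex hull (?Y ` ?I))"
    by (intro compact_convex_hull compact_continuous_image contY) auto
  have "convex hull (?Y ` ?I) \<subseteq> \<Omega>"
    using YO by (intro hull_minimal convex_\<Omega>) auto
  from smooth_on_lipschitz[OF smooth_h this K convex_convex_hull]
  obtain L where L: "L > 0" "\<And>X X'. X \<in> convex hull (?Y ` ?I) \<Longrightarrow> X' \<in> convex hull (?Y ` ?I) \<Longrightarrow>
      norm (h X - h X') \<le> L * norm (X - X')" by blast
  have "continuous_on ?I (\<lambda>\<tau>. F (?Y \<tau>))"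
    by (rule continuous_on_compose2[OF smooth_on_imp_continuous_on[OF smooth_F] contY]) (use YO in auto)
  then have "bounded ((\<lambda>\<tau>. F (?Y \<tau>)) ` ?I)"
    by (intro compact_imp_bounded compact_continuous_image) auto
  then obtain M where M: "\<And>\<tau>. \<tau> \<in> ?I \<Longrightarrow> norm (F (?Y \<tau>)) \<le> M"
    unfolding bounded_iff by blast
  have "M \<ge> 0" using M[of \<tau>\<^sub>R] assms(2) order_trans[OF norm_ge_zero] by auto
  have SL: "norm (S x - S y) \<le> M * norm (x - y)" if "x \<in> ?I" "y \<in> ?I" for x y
  proof (rule differentiable_bound[OF convex_real_interval(5) _ _ that])
    fix \<tau> assume \<tau>: "\<tau> \<in> ?I"
    show "(S has_derivative (\<lambda>t. t *\<^sub>R F (?Y \<tau>))) (at \<tau> within ?I)"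
      using S[OF \<tau>] by (auto simp: has_vector_derivative_def intro: has_derivative_at_withinI)
    show "onorm (\<lambda>t. t *\<^sub>R F (?Y \<tau>)) \<le> M"
      using mult_right_mono[OF M[OF \<tau>] abs_ge_zero] by (intro onorm_le) (simp add: mult.commute)
  qed
  have "\<bar>h (?Y x) - h (?Y y)\<bar> \<le> L * (1 + M) * \<bar>x - y\<bar>" if "x \<in> ?I" "y \<in> ?I" for x y
  proof -
    have "norm (?Y x - ?Y y) \<le> norm (x - y) + norm (S x - S y)"
      using norm_Pair_le[of "x - y" "S x - S y"] by simp
    also have "\<dots> \<le> (1 + M) * norm (x - y)"
      using SL[OF that] by (simp add: algebra_simps)
    finally have "L * norm (?Y x - ?Y y) \<le> L * ((1 + M) * norm (x - y))"
      using L(1) by simp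
    moreover have "norm (h (?Y x) - h (?Y y)) \<le> L * norm (?Y x - ?Y y)"
      using that by (intro L(2) hull_inc) auto
    ultimately show ?thesis by (simp add: mult.assoc)
  qed
  moreover have "h (?Y \<tau>\<^sub>R) = 0" "h (?Y \<tau>\<^sub>L) = 0"
    using assms(3,6) by (simp_all add: h_def)
  moreover have "h (?Y \<tau>) < 0" if "\<tau>\<^sub>R < \<tau>" "\<tau> < \<tau>\<^sub>L" for \<tau>
    using h_sign(2)[OF YO, of \<tau>] neg[of \<tau>] that by simp
  moreover have "L * (1 + M) > 0" using L(1) \<open>M \<ge> 0\<close> by simp
  ultimately show ?thesis
    using scalar_heteroclinic_orbit[OF assms(2), of "\<lambda>\<tau>. h (?Y \<tau>)" "L * (1 + M)"] that by metis
qed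

text \<open>Uniqueness is reduced to one common point. Any profile meets the curve at a volume
  strictly between \<open>\<tau>\<^sub>R\<close> and \<open>\<tau>\<^sub>L\<close>, and
  \<open>\<theta>\<close> takes every such volume; after a shift both solve the same smooth equation
  through that point.\<close>

theorem profile_exists_unique:
  obtains X R where "profile X R" "total_pressure_slope R + m\<^sup>2 < 0"
    "\<And>Y R'. profile Y R' \<Longrightarrow> \<exists>a. \<forall>\<xi>. Y \<xi> = X (\<xi> + a)"
proof -
  obtain S \<tau>\<^sub>R where c: "0 < \<tau>\<^sub>R" "\<tau>\<^sub>R < \<tau>\<^sub>L" "S \<tau>\<^sub>L = s\<^sub>L"
    "\<And>\<tau>. \<tau> \<in> {\<tau>\<^sub>R..\<tau>\<^sub>L} \<Longrightarrow> (S has_vector_derivative F (\<tau>, S \<tau>)) (at \<tau>)"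
    "\<And>\<tau>. \<tau> \<in> {\<tau>\<^sub>R<..<\<tau>\<^sub>L} \<Longrightarrow> G (\<tau>, S \<tau>) < 0" "G (\<tau>\<^sub>R, S \<tau>\<^sub>R) = 0"
    using shock_curve by metis
  obtain \<theta> where \<theta>: "\<And>\<xi>. (\<theta> has_real_derivative h (\<theta> \<xi>, S (\<theta> \<xi>))) (at \<xi>)"
    "\<And>\<xi>. \<tau>\<^sub>R < \<theta> \<xi>" "\<And>\<xi>. \<theta> \<xi> < \<tau>\<^sub>L" "(\<theta> \<longlongrightarrow> \<tau>\<^sub>L) at_bot" "(\<theta> \<longlongrightarrow> \<tau>\<^sub>R) at_top"
    using shock_curve_heteroclinic[OF c] by metis
  define X where "X \<xi> = (\<theta> \<xi>, S (\<theta> \<xi>))" for \<xi>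
  have X\<Omega>: "range X \<subseteq> \<Omega>"
    using \<theta>(2) c(1) less_trans by (fastforce simp: X_def)
  have X': "(X has_vector_derivative \<Phi> (X \<xi>)) (at \<xi>)" for \<xi>
  proof -
    have t: "(\<theta> has_vector_derivative h (X \<xi>)) (at \<xi>)"
      using \<theta>(1) by (simp add: X_def has_real_derivative_iff_has_vector_derivative)
    have "((\<lambda>\<xi>. S (\<theta> \<xi>)) has_vector_derivative h (X \<xi>) *\<^sub>R F (X \<xi>)) (at \<xi>)"
      using vector_diff_chain_at[OF t c(4)] \<theta>(2,3)[of \<xi>] by (simp add: o_def X_def)
    from has_vector_derivative_Pair[OF t this] show ?thesis
      by (simp add: X_def[abs_def] \<Phi>_def)
  qed
  have isC: "isCont S \<tau>" if "\<tau> \<in> {\<tau>\<^sub>R..\<tau>\<^sub>L}" for \<tau>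
    using has_vector_derivative_continuous[OF c(4)[OF that]] by simp
  have lims: "(X \<longlongrightarrow> (\<tau>\<^sub>L, s\<^sub>L)) at_bot" "(X \<longlongrightarrow> (\<tau>\<^sub>R, S \<tau>\<^sub>R)) at_top"
    using tendsto_Pair[OF \<theta>(4) isCont_tendsto_compose[OF isC \<theta>(4)]]
      tendsto_Pair[OF \<theta>(5) isCont_tendsto_compose[OF isC \<theta>(5)]] c(2,3)
    by (auto simp: X_def[abs_def])
  have "\<not> X constant_on UNIV"
  proof
    assume "X constant_on UNIV"
    then obtain c' where "X = (\<lambda>\<xi>. c')" by (auto simp: constant_on_def)
    then have "c' = (\<tau>\<^sub>L, s\<^sub>L)" "c' = (\<tau>\<^sub>R, S \<tau>\<^sub>R)"
      using lims tendsto_const_iff[of "at_bot :: real filter"] tendsto_const_iff[of "at_top :: real filter"] by auto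
    then show False using c(2) by simp
  qed
  then have "profile X (\<tau>\<^sub>R, S \<tau>\<^sub>R)"
    using X\<Omega> X' lims c(1) by (simp add: profile_def)
  moreover have "total_pressure_slope (\<tau>\<^sub>R, S \<tau>\<^sub>R) + m\<^sup>2 < 0"
    by (rule shock_curve_subsonic[OF c(1,2,4,5,6)])
  moreover have "\<exists>a. \<forall>\<xi>. Y \<xi> = X (\<xi> + a)" if Y: "profile Y R'" for Y R'
  proof -
    obtain \<xi>1 where \<xi>1: "\<tau>\<^sub>R < fst (Y \<xi>1)" "fst (Y \<xi>1) < \<tau>\<^sub>L" "snd (Y \<xi>1) = S (fst (Y \<xi>1))"
      using profile_meets_shock_curve[OF Y c(1-4)] by metis
    have "fst (Y \<xi>1) \<in> range \<theta>"
    proof -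
      obtain \<xi>2 where "\<theta> \<xi>2 < fst (Y \<xi>1)"
        using eventually_happens'[OF trivial_limit_at_top_linorder order_tendstoD(2)[OF \<theta>(5) \<xi>1(1)]] by blast
      moreover obtain \<xi>3 where "fst (Y \<xi>1) < \<theta> \<xi>3"
        using eventually_happens'[OF trivial_limit_at_bot_linorder order_tendstoD(1)[OF \<theta>(4) \<xi>1(2)]] by blast
      moreover have "connected (range \<theta>)"
        using DERIV_isCont[OF \<theta>(1)] by (intro connected_continuous_image continuous_at_imp_continuous_on) auto
      ultimately show ?thesis
        using connectedD_interval[of "range \<theta>" "\<theta> \<xi>2" "\<theta> \<xi>3"] by (meson less_imp_le rangeI)
    qed
    then obtain \<eta> where "\<theta> \<eta> = fst (Y \<xi>1)" by auto
    then have eq: "X (\<xi>1 + (\<eta> - \<xi>1)) = Y \<xi>1"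
      using \<xi>1(3) by (simp add: X_def prod_eq_iff)
    have shift: "((\<lambda>\<xi>. X (\<xi> + (\<eta> - \<xi>1))) has_vector_derivative \<Phi> (X (\<xi> + (\<eta> - \<xi>1)))) (at \<xi>)" for \<xi>
    proof -
      have "((\<lambda>\<xi>. \<xi> + (\<eta> - \<xi>1)) has_vector_derivative 1) (at \<xi>)"
        by (auto intro!: derivative_eq_intros)
      from vector_diff_chain_at[OF this X'] show ?thesis by (simp add: o_def)
    qed
    have "Y \<xi> = X (\<xi> + (\<eta> - \<xi>1))" for \<xi>
      by (rule smooth_vector_field_solution_unique[of \<Omega> \<Phi> Y "\<lambda>\<xi>. X (\<xi> + (\<eta> - \<xi>1))" \<xi>1,
            OF smooth_\<Phi> convex_\<Omega> _ _ _ shift eq[symmetric]])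
        (use Y X\<Omega> in \<open>auto simp: profile_def\<close>)
    then show ?thesis by blast
  qed
  ultimately show ?thesis using that by blast
qed

end

section \<open>Traveling waves\<close>

definition specific_state :: "'n::finite state \<Rightarrow> real \<times> (real ^ 'n)" where
  "specific_state U = (volume U, \<chi> i. entropy U i)"

text \<open>The inverse of \<^const>\<open>specific_state\<close> on states with $\rho (u - \sigma) = m$.\<close>

definition wave_state :: "real \<Rightarrow> real \<Rightarrow> real \<times> (real ^ 'n) \<Rightarrow> 'n::finite state" where
  "wave_state \<sigma> m X = (1 / fst X, \<sigma> / fst X + m, (1 / fst X) *\<^sub>R snd X)"

lemma specific_state_simps [simp]:
  "fst (specific_state U) = volume U" "snd (specific_state U) $ i = entropy U i"
  by (simp_all add: specific_state_def)

lemma wave_state_simps: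
  assumes "fst X > 0"
  shows "density (wave_state \<sigma> m X) = 1 / fst X" "volume (wave_state \<sigma> m X) = fst X"
    "velocity (wave_state \<sigma> m X) = \<sigma> + m * fst X" "entropy (wave_state \<sigma> m X) i = snd X $ i"
    "wave_state \<sigma> m X \<in> state_space" "specific_state (wave_state \<sigma> m X) = X"
  using assms
  by (simp_all add: wave_state_def density_def volume_def velocity_def entropy_def state_space_def
      specific_state_def prod_eq_iff vec_eq_iff field_simps)

lemma wave_state_specific_state:
  assumes "U \<in> state_space" "velocity U = \<sigma> + m * volume U"
  shows "wave_state \<sigma> m (specific_state U) = U"
proof -
  have "fst U > 0" using assms(1) by (simp add: state_space_def)
  moreover from this have "fst (snd U) = \<sigma> * fst U + m"
    using assms(2) by (simp add: velocity_def volume_def density_def field_simps)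
  ultimately show ?thesis
    by (simp add: wave_state_def specific_state_def volume_def density_def entropy_def
        prod_eq_iff vec_eq_iff)
qed

lemma open_state_space: "open state_space"
  unfolding state_space_def by (intro open_Collect_less continuous_intros)

lemma smooth_density: "smooth_on state_space density"
  unfolding density_def by (intro smooth_on_bounded_linear bounded_linear_fst)

lemma smooth_volume: "smooth_on state_space volume"
  unfolding volume_def
  by (intro smooth_on_divide smooth_on_const smooth_density open_state_space)
    (simp add: state_space_def density_def)

lemma smooth_velocity: "smooth_on state_space velocity"
  unfolding velocity_def
  by (intro smooth_on_divide smooth_density open_state_space smooth_on_bounded_linear
      bounded_linear_compose[OF bounded_linear_fst bounded_linear_snd])
    (simp add: state_space_def density_def)

lemma smooth_specific_state: "smooth_on state_space specific_state"
  unfolding specific_state_def entropy_def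
  by (intro smooth_on_Pair smooth_on_vec smooth_on_divide smooth_volume smooth_density open_state_space
      smooth_on_bounded_linear bounded_linear_compose[OF bounded_linear_vec_nth]
      bounded_linear_compose[OF bounded_linear_snd bounded_linear_snd])
    (simp add: state_space_def density_def)

lemma specific_state_mem: "U \<in> state_space \<Longrightarrow> specific_state U \<in> {0<..} \<times> UNIV"
  by (simp add: state_space_def specific_state_def volume_def density_def)

lemma smooth_wave_state: "smooth_on ({0<..} \<times> UNIV) (wave_state \<sigma> m)"
  unfolding wave_state_def
  by (intro smooth_on_Pair smooth_on_add smooth_on_scaleR smooth_on_divide smooth_on_const open_half_plane
      smooth_on_bounded_linear bounded_linear_fst bounded_linear_snd) auto

text \<open>In x the wave is a translate, so the values of \<open>deriv\<close> agree even where no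
  derivative exists; fluxes and viscous terms then need no regularity proof here. In t the chain
  rule is used, and it does ask for differentiability.\<close>

lemma partial_wave:
  shows "partial2 (\<lambda>t x. f (x - \<sigma> * t)) t x = deriv f (x - \<sigma> * t)"
    and "smooth_on UNIV f \<Longrightarrow> partial1 (\<lambda>t x. f (x - \<sigma> * t)) t x = - \<sigma> * deriv f (x - \<sigma> * t)"
proof -
  have "((\<lambda>r. f (r - \<sigma> * t)) has_field_derivative d) (at x) \<longleftrightarrow> (f has_field_derivative d) (at (x - \<sigma> * t))" for d
    using DERIV_shift[of f d x "- \<sigma> * t"] by (simp add: add.commute)
  then show "partial2 (\<lambda>t x. f (x - \<sigma> * t)) t x = deriv f (x - \<sigma> * t)"
    unfolding partial2_def deriv_def by simp
  assume "smooth_on UNIV f"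
  moreover have "((\<lambda>t. x - \<sigma> * t) has_real_derivative - \<sigma>) (at t)"
    by (auto intro!: derivative_eq_intros)
  ultimately have "((\<lambda>t. f (x - \<sigma> * t)) has_real_derivative deriv f (x - \<sigma> * t) * - \<sigma>) (at t)"
    by (intro DERIV_chain2 smooth_on_real_derivative(1))
  then show "partial1 (\<lambda>t x. f (x - \<sigma> * t)) t x = - \<sigma> * deriv f (x - \<sigma> * t)"
    unfolding partial1_def by (subst mult.commute) (rule DERIV_imp_deriv)
qed

section \<open>Reduction of the system to ordinary differential equations\<close>

context multi_pressure_laws
begin

lemma smooth_along:
  fixes q :: "'n \<Rightarrow> real \<Rightarrow> real \<Rightarrow> real"
  assumes "smooth_on UNIV V" "\<And>\<xi>. V \<xi> \<in> state_space"
  shows "smooth_on UNIV (\<lambda>\<xi>::real. density (V \<xi>))" "smooth_on UNIV (\<lambda>\<xi>. velocity (V \<xi>))"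
    "smooth_on UNIV (\<lambda>\<xi>. specific_state (V \<xi>))"
    "(\<And>i. smooth_on ({0<..} \<times> UNIV) (\<lambda>(a, b). q i a b)) \<Longrightarrow>
      smooth_on UNIV (\<lambda>\<xi>. q i (volume (V \<xi>)) (entropy (V \<xi>) i))"
proof -
  note comp = smooth_on_compose[OF _ assms(1) open_UNIV open_state_space]
  show "smooth_on UNIV (\<lambda>\<xi>::real. density (V \<xi>))" "smooth_on UNIV (\<lambda>\<xi>. velocity (V \<xi>))"
    using comp[OF smooth_density] comp[OF smooth_velocity] assms(2) by auto
  show S: "smooth_on UNIV (\<lambda>\<xi>. specific_state (V \<xi>))"
    using comp[OF smooth_specific_state] assms(2) by auto
  assume "\<And>i. smooth_on ({0<..} \<times> UNIV) (\<lambda>(a, b). q i a b)"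
  from smooth_on_compose[OF smooth_on_component[OF this, of i i] S open_UNIV open_half_plane]
  show "smooth_on UNIV (\<lambda>\<xi>. q i (volume (V \<xi>)) (entropy (V \<xi>) i))"
    using specific_state_mem[OF assms(2)] by (simp add: image_subset_iff)
qed

lemma navier_stokes_wave:
  assumes V: "smooth_on UNIV V" "\<And>\<xi>. V \<xi> \<in> state_space"
  shows "navier_stokes_solution e \<mu> \<epsilon> (\<lambda>t x. V (x - \<sigma> * t)) \<longleftrightarrow>
    (\<forall>\<xi>. - \<sigma> * deriv (\<lambda>\<xi>. density (V \<xi>)) \<xi> + deriv (\<lambda>\<xi>. density (V \<xi>) * velocity (V \<xi>)) \<xi> = 0 \<and>
      - \<sigma> * deriv (\<lambda>\<xi>. density (V \<xi>) * velocity (V \<xi>)) \<xi>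
        + deriv (\<lambda>\<xi>. density (V \<xi>) * (velocity (V \<xi>))\<^sup>2
            + (\<Sum>i\<in>UNIV. pressure (e i) (volume (V \<xi>)) (entropy (V \<xi>) i))) \<xi>
      = \<epsilon> * deriv (\<lambda>\<xi>. (\<Sum>i\<in>UNIV. \<mu> i (volume (V \<xi>)) (entropy (V \<xi>) i))
          * deriv (\<lambda>\<xi>. velocity (V \<xi>)) \<xi>) \<xi> \<and>
      (\<forall>i. - \<sigma> * deriv (\<lambda>\<xi>. density (V \<xi>) * e i (volume (V \<xi>)) (entropy (V \<xi>) i)) \<xi>
        + deriv (\<lambda>\<xi>. density (V \<xi>) * velocity (V \<xi>) * e i (volume (V \<xi>)) (entropy (V \<xi>) i)) \<xi>
        + pressure (e i) (volume (V \<xi>)) (entropy (V \<xi>) i) * deriv (\<lambda>\<xi>. velocity (V \<xi>)) \<xi>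
        = \<epsilon> * \<mu> i (volume (V \<xi>)) (entropy (V \<xi>) i) * (deriv (\<lambda>\<xi>. velocity (V \<xi>)) \<xi>)\<^sup>2))"
    (is "_ \<longleftrightarrow> (\<forall>\<xi>. ?Q \<xi>)")
proof -
  have "bounded_linear (\<lambda>z :: real \<times> real. snd z - \<sigma> * fst z)"
    by (intro bounded_linear_sub bounded_linear_snd bounded_linear_const_mult bounded_linear_fst)
  from smooth_on_compose[OF V(1) smooth_on_bounded_linear[OF this] open_UNIV open_UNIV]
  have W: "smooth_on UNIV (\<lambda>(t, x). V (x - \<sigma> * t))"
    by (simp add: case_prod_unfold)
  note smooth = smooth_along[OF V]
  note p2 = partial_wave(1)[of _ \<sigma>] and p1 = partial_wave(2)[of _ \<sigma>]
  have "navier_stokes_solution e \<mu> \<epsilon> (\<lambda>t x. V (x - \<sigma> * t)) \<longleftrightarrow> (\<forall>t x. ?Q (x - \<sigma> * t))"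
    unfolding navier_stokes_solution_def Let_def
      p1[OF smooth(1)] p1[OF smooth_on_mult[OF open_UNIV smooth(1,2)]]
      p1[OF smooth_on_mult[OF open_UNIV smooth(1) smooth(4)[where q = e, OF energy_smooth]]]
      p2[of "\<lambda>\<xi>. velocity (V \<xi>)"] p2[of "\<lambda>\<xi>. density (V \<xi>) * velocity (V \<xi>)"]
      p2[of "\<lambda>\<xi>. density (V \<xi>) * (velocity (V \<xi>))\<^sup>2
            + (\<Sum>i\<in>UNIV. pressure (e i) (volume (V \<xi>)) (entropy (V \<xi>) i))"]
      p2[of "\<lambda>\<xi>. density (V \<xi>) * velocity (V \<xi>) * e i (volume (V \<xi>)) (entropy (V \<xi>) i)" for i]
      p2[of "\<lambda>\<xi>. (\<Sum>i\<in>UNIV. \<mu> i (volume (V \<xi>)) (entropy (V \<xi>) i)) * deriv (\<lambda>\<xi>. velocity (V \<xi>)) \<xi>"]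
    using W V(2) by blast
  also have "\<dots> \<longleftrightarrow> (\<forall>\<xi>. ?Q \<xi>)"
  proof
    assume *: "\<forall>t x. ?Q (x - \<sigma> * t)"
    show "\<forall>\<xi>. ?Q \<xi>"
    proof
      show "?Q \<xi>" for \<xi> using *[THEN spec, of 0, THEN spec, of \<xi>] unfolding mult_zero_right diff_zero .
    qed
  next
    assume *: "\<forall>\<xi>. ?Q \<xi>"
    show "\<forall>t x. ?Q (x - \<sigma> * t)"
      by (intro allI *[THEN spec])
  qed
  finally show ?thesis .
qed

text \<open>With u - \<sigma> equal to \<open>m\<close> times the volume, the factor
  \<open>volume U\<close> cancels in the Lax quotient and leaves \<open>m\<close> over the square
  root.\<close>

lemma sound_speed_eq:
  assumes "U \<in> state_space"
  shows "sound_speed e U = volume U * sqrt (- total_pressure_slope (specific_state U))"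
proof -
  have "volume U > 0" using assms by (simp add: state_space_def volume_def density_def)
  have "(\<Sum>i\<in>UNIV. - (volume U)\<^sup>2 * partial1 (pressure (e i)) (volume U) (entropy U i))
      = (volume U)\<^sup>2 * - total_pressure_slope (specific_state U)"
    by (simp add: total_pressure_slope_def sum_distrib_left sum_negf)
  with \<open>volume U > 0\<close> show ?thesis
    unfolding sound_speed_def by (simp only: real_sqrt_mult) simp
qed

end

section \<open>From profiles to traveling waves\<close>

context shock_profile
begin

text \<open>For states built by \<open>wave_state\<close> the momentum density is \<sigma> \<rho> +
  \<open>m\<close>, so mass is conserved identically. The momentum flux is a multiple of the density
  plus \<open>G\<close> plus a constant, and \<open>h\<close> is chosen so that \<open>G\<close> is
  the viscous stress. In the energy equations the terms in \<sigma> cancel and the definition of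
  \<open>F\<close> accounts for the heating.\<close>

lemma profile_traveling_wave:
  assumes "profile X R"
  shows "traveling_wave e \<mu> \<epsilon> \<sigma> (wave_state \<sigma> m (\<tau>\<^sub>L, s\<^sub>L)) (wave_state \<sigma> m R) (\<lambda>\<xi>. wave_state \<sigma> m (X \<xi>))"
proof -
  have X: "range X \<subseteq> \<Omega>" "\<And>\<xi>. (X has_vector_derivative \<Phi> (X \<xi>)) (at \<xi>)" "\<not> X constant_on UNIV"
    "(X \<longlongrightarrow> (\<tau>\<^sub>L, s\<^sub>L)) at_bot" "(X \<longlongrightarrow> R) at_top" "R \<in> \<Omega>"
    using assms unfolding profile_def by blast+
  have pos: "fst (X \<xi>) > 0" for \<xi> using X(1) by (metis mem_Times_iff greaterThan_iff rangeI subsetD)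
  define V where "V \<xi> = wave_state \<sigma> m (X \<xi>)" for \<xi>
  have smV: "smooth_on UNIV V"
    unfolding V_def
    using smooth_on_compose[OF smooth_wave_state smooth_on_autonomous_solution[OF open_\<Omega> smooth_\<Phi> X(1,2)]
        open_UNIV open_\<Omega> X(1)] .
  note Vsimps = wave_state_simps[OF pos, where \<sigma> = \<sigma> and m = m, folded V_def]
  define \<tau> where "\<tau> \<xi> = fst (X \<xi>)" for \<xi>
  have \<tau>pos: "\<tau> \<xi> > 0" for \<xi> using pos by (simp add: \<tau>_def)
  then have \<tau>0: "\<tau> \<xi> \<noteq> 0" for \<xi> by (metis less_irrefl)
  define k where "k \<xi> = h (X \<xi>)" for \<xi>
  have d\<tau>: "(\<tau> has_real_derivative k \<xi>) (at \<xi>)" for \<xi>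
    using \<Phi>_components(1)[OF X(2)] by (simp add: \<tau>_def[abs_def] k_def)
  note ds = \<Phi>_components(2)[OF X(2)]
  have k: "\<epsilon> * (total_viscosity (X \<xi>) * (m * k \<xi>)) = G (X \<xi>)" for \<xi>
    using total_viscosity_pos'[OF pos[of \<xi>]] eps_pos flux_pos by (simp add: k_def h_def)
  have d_inv: "((\<lambda>\<xi>. 1 / \<tau> \<xi>) has_real_derivative - k \<xi> / (\<tau> \<xi>)\<^sup>2) (at \<xi>)" for \<xi>
    using d\<tau> \<tau>0 by (auto intro!: derivative_eq_intros simp: power2_eq_square)
  have rho: "density (V \<xi>) = 1 / \<tau> \<xi>" and u: "velocity (V \<xi>) = \<sigma> + m * \<tau> \<xi>" for \<xi>
    by (simp_all add: Vsimps \<tau>_def)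
  have rhou: "density (V \<xi>) * velocity (V \<xi>) = \<sigma> * (1 / \<tau> \<xi>) + m" for \<xi>
    using \<tau>0[of \<xi>] by (simp add: rho u field_simps)
  have rhouu: "density (V \<xi>) * (velocity (V \<xi>))\<^sup>2
      + (\<Sum>i\<in>UNIV. pressure (e i) (volume (V \<xi>)) (entropy (V \<xi>) i))
      = \<sigma>\<^sup>2 * (1 / \<tau> \<xi>) + G (X \<xi>) + (2 * \<sigma> * m + m\<^sup>2 * \<tau>\<^sub>L + total_pressure (\<tau>\<^sub>L, s\<^sub>L))" for \<xi>
  proof -
    have "(\<Sum>i\<in>UNIV. pressure (e i) (volume (V \<xi>)) (entropy (V \<xi>) i)) = total_pressure (X \<xi>)"
      by (simp add: Vsimps total_pressure_def)
    moreover have "1 / \<tau> \<xi> * (\<sigma> + m * \<tau> \<xi>)\<^sup>2 = \<sigma>\<^sup>2 * (1 / \<tau> \<xi>) + 2 * \<sigma> * m + m\<^sup>2 * \<tau> \<xi>"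
      using \<tau>0[of \<xi>] by (simp add: field_simps power2_eq_square)
    ultimately show ?thesis
      by (simp add: rho u G_def \<tau>_def[symmetric] algebra_simps)
  qed
  have dG: "\<exists>g. ((\<lambda>\<xi>. G (X \<xi>)) has_real_derivative g) (at \<xi>)" for \<xi>
    using has_real_derivative_G[OF d\<tau>[of \<xi>, unfolded \<tau>_def[abs_def]] ds pos] by auto
  have d1: "deriv (\<lambda>\<xi>. density (V \<xi>)) \<xi> = - k \<xi> / (\<tau> \<xi>)\<^sup>2" for \<xi>
    unfolding rho by (rule DERIV_imp_deriv[OF d_inv])
  have d2: "deriv (\<lambda>\<xi>. density (V \<xi>) * velocity (V \<xi>)) \<xi> = - \<sigma> * k \<xi> / (\<tau> \<xi>)\<^sup>2" for \<xi>
    unfolding rhou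
    using DERIV_imp_deriv[OF DERIV_add[OF DERIV_cmult[OF d_inv] DERIV_const]] by simp
  have d3: "deriv (\<lambda>\<xi>. density (V \<xi>) * (velocity (V \<xi>))\<^sup>2
      + (\<Sum>i\<in>UNIV. pressure (e i) (volume (V \<xi>)) (entropy (V \<xi>) i))) \<xi>
      = - \<sigma>\<^sup>2 * k \<xi> / (\<tau> \<xi>)\<^sup>2 + deriv (\<lambda>\<xi>. G (X \<xi>)) \<xi>" for \<xi>
  proof -
    obtain g where g: "((\<lambda>\<xi>. G (X \<xi>)) has_real_derivative g) (at \<xi>)" using dG by blast
    show ?thesis
      unfolding rhouu DERIV_imp_deriv[OF g]
      using DERIV_imp_deriv[OF DERIV_add[OF DERIV_add[OF DERIV_cmult[OF d_inv] g] DERIV_const]] by simp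
  qed
  have d4: "deriv (\<lambda>\<xi>. velocity (V \<xi>)) \<xi> = m * k \<xi>" for \<xi>
    unfolding u by (rule DERIV_imp_deriv) (use d\<tau> in \<open>auto intro!: derivative_eq_intros\<close>)
  have visc: "(\<Sum>i\<in>UNIV. \<mu> i (volume (V \<xi>)) (entropy (V \<xi>) i)) = total_viscosity (X \<xi>)" for \<xi>
    by (simp add: Vsimps total_viscosity_def)
  \<comment> \<open>The product under the derivative equals \<open>G (X \<xi>) / \<epsilon>\<close>
    for all \<xi>, so its derivative is inherited from \<open>G\<close>.\<close>
  have d5: "\<epsilon> * deriv (\<lambda>\<xi>. total_viscosity (X \<xi>) * (m * k \<xi>)) \<xi> = deriv (\<lambda>\<xi>. G (X \<xi>)) \<xi>" for \<xi>
  proof -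
    obtain g where g: "((\<lambda>\<xi>. G (X \<xi>)) has_real_derivative g) (at \<xi>)" using dG by blast
    have "total_viscosity (X \<xi>) * (m * k \<xi>) = G (X \<xi>) / \<epsilon>" for \<xi>
      using k[of \<xi>] eps_pos by (simp add: field_simps)
    then have "((\<lambda>\<xi>. total_viscosity (X \<xi>) * (m * k \<xi>)) has_real_derivative g / \<epsilon>) (at \<xi>)"
      using DERIV_cdivide[OF g] by simp
    from DERIV_imp_deriv[OF this] DERIV_imp_deriv[OF g] show ?thesis using eps_pos by simp
  qed
  have energy: "- \<sigma> * deriv (\<lambda>\<xi>. density (V \<xi>) * e i (volume (V \<xi>)) (entropy (V \<xi>) i)) \<xi>
        + deriv (\<lambda>\<xi>. density (V \<xi>) * velocity (V \<xi>) * e i (volume (V \<xi>)) (entropy (V \<xi>) i)) \<xi>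
        + pressure (e i) (volume (V \<xi>)) (entropy (V \<xi>) i) * deriv (\<lambda>\<xi>. velocity (V \<xi>)) \<xi>
        = \<epsilon> * \<mu> i (volume (V \<xi>)) (entropy (V \<xi>) i) * (deriv (\<lambda>\<xi>. velocity (V \<xi>)) \<xi>)\<^sup>2" for i \<xi>
  proof -
    define E where "E \<xi> = e i (\<tau> \<xi>) (snd (X \<xi>) $ i)" for \<xi>
    let ?p = "pressure (e i) (\<tau> \<xi>) (snd (X \<xi>) $ i)" and ?T = "temperature (e i) (\<tau> \<xi>) (snd (X \<xi>) $ i)"
      and ?F = "F (X \<xi>) $ i" and ?m = "\<mu> i (\<tau> \<xi>) (snd (X \<xi>) $ i)"
    have dE: "(E has_real_derivative k \<xi> * (?T * ?F - ?p)) (at \<xi>)"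
      using has_real_derivative_partial[OF energy_smooth[of i] d\<tau>[of \<xi>] has_real_derivative_vec_nth[OF ds[of \<xi>]] \<tau>pos[of \<xi>]]
      unfolding E_def by (simp add: temperature_def pressure_def k_def algebra_simps)
    have dq: "((\<lambda>\<xi>. 1 / \<tau> \<xi> * E \<xi>) has_real_derivative
        (- k \<xi> / (\<tau> \<xi>)\<^sup>2) * E \<xi> + (k \<xi> * (?T * ?F - ?p)) * (1 / \<tau> \<xi>)) (at \<xi>)" (is "(_ has_real_derivative ?q) _")
      by (rule DERIV_mult[OF d_inv dE])
    have dm: "((\<lambda>\<xi>. \<sigma> * (1 / \<tau> \<xi> * E \<xi>) + m * E \<xi>) has_real_derivative
        \<sigma> * ?q + m * (k \<xi> * (?T * ?F - ?p))) (at \<xi>)"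
      by (intro DERIV_add DERIV_cmult dq dE)
    have E: "e i (volume (V \<xi>)) (entropy (V \<xi>) i) = E \<xi>" for \<xi>
      by (simp add: E_def Vsimps \<tau>_def)
    have "deriv (\<lambda>\<xi>. density (V \<xi>) * e i (volume (V \<xi>)) (entropy (V \<xi>) i)) \<xi> = ?q"
      unfolding E rho by (rule DERIV_imp_deriv[OF dq])
    moreover have "deriv (\<lambda>\<xi>. density (V \<xi>) * velocity (V \<xi>) * e i (volume (V \<xi>)) (entropy (V \<xi>) i)) \<xi>
        = \<sigma> * ?q + m * (k \<xi> * (?T * ?F - ?p))"
    proof -
      have "(\<sigma> * (1 / \<tau> \<xi>) + m) * E \<xi> = \<sigma> * (1 / \<tau> \<xi> * E \<xi>) + m * E \<xi>" for \<xi>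
        by (simp add: distrib_right)
      then show ?thesis unfolding E rhou using DERIV_imp_deriv[OF dm] by presburger
    qed
    moreover have "m * (k \<xi> * (?T * ?F)) = \<epsilon> * ?m * (m * k \<xi>)\<^sup>2"
    proof -
      have "?T * ?F = ?m * (G (X \<xi>) / total_viscosity (X \<xi>))"
        using temperature_pos[OF \<tau>pos[of \<xi>], of i "snd (X \<xi>) $ i"] by (simp add: F_def \<tau>_def)
      also have "G (X \<xi>) / total_viscosity (X \<xi>) = \<epsilon> * (m * k \<xi>)"
        using total_viscosity_pos'[OF pos[of \<xi>]] k[of \<xi>] by (simp add: field_simps)
      finally show ?thesis by (simp add: power2_eq_square mult_ac)
    qed
    moreover have "- \<sigma> * q + (\<sigma> * q + m * (k \<xi> * (?T * ?F - ?p))) + ?p * (m * k \<xi>) = m * (k \<xi> * (?T * ?F))" for q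
      by (simp add: algebra_simps)
    moreover have "pressure (e i) (volume (V \<xi>)) (entropy (V \<xi>) i) = ?p"
      "\<mu> i (volume (V \<xi>)) (entropy (V \<xi>) i) = ?m"
      by (simp_all add: Vsimps \<tau>_def)
    ultimately show ?thesis by (simp only: d4)
  qed
  have "navier_stokes_solution e \<mu> \<epsilon> (\<lambda>t x. V (x - \<sigma> * t))"
    unfolding navier_stokes_wave[OF smV Vsimps(5)]
    using energy unfolding visc d4 d5 d1 d2 d3 by (simp add: power2_eq_square)
  moreover have "\<not> V constant_on UNIV"
  proof
    assume "V constant_on UNIV"
    then obtain c where "\<And>\<xi>. V \<xi> = c" by (auto simp: constant_on_def)
    then have "X \<xi> = specific_state c" for \<xi> using Vsimps(6) by metis
    then show False using X(3) unfolding constant_on_def by blast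
  qed
  moreover have "(V \<longlongrightarrow> wave_state \<sigma> m (\<tau>\<^sub>L, s\<^sub>L)) at_bot" "(V \<longlongrightarrow> wave_state \<sigma> m R) at_top"
    unfolding V_def
    using isCont_tendsto_compose[OF isCont_smooth_on_\<Omega>[OF smooth_wave_state] X(4)]
      isCont_tendsto_compose[OF isCont_smooth_on_\<Omega>[OF smooth_wave_state X(6)] X(5)] volume_pos by auto
  ultimately show ?thesis
    unfolding traveling_wave_def V_def by blast
qed

end

section \<open>From traveling waves to profiles\<close>

lemma zero_derivative_limit:
  fixes f :: "real \<Rightarrow> real"
  assumes "\<And>t. (f has_real_derivative 0) (at t)" "(f \<longlongrightarrow> l) at_bot"
  shows "f t = l"
proof -
  have "f = (\<lambda>_. f t)" using DERIV_isconst_all[of f _ t] assms(1) by auto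
  then have "((\<lambda>_::real. f t) \<longlongrightarrow> l) at_bot" using assms(2) by metis
  then show ?thesis using tendsto_const_iff[of "at_bot :: real filter"] by auto
qed

lemma isCont_smooth_on_state_space:
  "smooth_on state_space f \<Longrightarrow> U \<in> state_space \<Longrightarrow> isCont f U"
  using smooth_on_imp_continuous_on[of state_space f] continuous_on_eq_continuous_at[OF open_state_space] by blast

context shock_profile
begin

text \<open>Mass and momentum are integrated once, with constants determined at minus infinity. For
  the mass this is direct; for the momentum the viscous stress contains \<tau>', whose limit is not
  given and has to be deduced. The energy equations then yield the entropies algebraically.\<close>

lemma traveling_wave_profile:
  assumes tw: "traveling_wave e \<mu> \<epsilon> \<sigma> U\<^sub>L U\<^sub>R V" and "U\<^sub>L \<in> state_space" "U\<^sub>R \<in> state_space"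
    and L: "specific_state U\<^sub>L = (\<tau>\<^sub>L, s\<^sub>L)" "velocity U\<^sub>L = \<sigma> + m * \<tau>\<^sub>L"
  shows "profile (\<lambda>\<xi>. specific_state (V \<xi>)) (specific_state U\<^sub>R)"
    and "wave_state \<sigma> m (specific_state (V \<xi>)) = V \<xi>"
proof -
  have NS: "navier_stokes_solution e \<mu> \<epsilon> (\<lambda>t x. V (x - \<sigma> * t))" and nc: "\<not> V constant_on UNIV"
    and lims: "(V \<longlongrightarrow> U\<^sub>L) at_bot" "(V \<longlongrightarrow> U\<^sub>R) at_top"
    using tw by (auto simp: traveling_wave_def)
  have sp: "V \<xi> \<in> state_space" for \<xi>
    using NS[unfolded navier_stokes_solution_def, THEN conjunct2, THEN conjunct1, THEN spec, of 0, THEN spec, of \<xi>]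
    by simp
  have "smooth_on UNIV (\<lambda>(t, x). V (x - \<sigma> * t))"
    using NS unfolding navier_stokes_solution_def by blast
  \<comment> \<open>Restriction to t = 0 recovers the smoothness of the profile from that of the
    solution in (t, x).\<close>
  from smooth_on_compose[OF this smooth_on_bounded_linear[OF bounded_linear_Pair[OF bounded_linear_zero bounded_linear_ident]]
      open_UNIV open_UNIV]
  have smV: "smooth_on UNIV V" by simp
  note sm = smooth_along[OF smV sp]
  define \<rho> where "\<rho> \<xi> = density (V \<xi>)" for \<xi>
  define u where "u \<xi> = velocity (V \<xi>)" for \<xi>
  define X where "X \<xi> = specific_state (V \<xi>)" for \<xi>
  have X\<Omega>: "X \<xi> \<in> \<Omega>" for \<xi> using specific_state_mem[OF sp] by (simp add: X_def)
  have pos: "fst (X \<xi>) > 0" for \<xi> using X\<Omega>[of \<xi>] by (simp add: mem_Times_iff)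
  have vol: "volume (V \<xi>) = fst (X \<xi>)" and ent: "entropy (V \<xi>) i = snd (X \<xi>) $ i" for \<xi> i
    by (simp_all add: X_def)
  have \<rho>_vol: "\<rho> \<xi> * fst (X \<xi>) = 1" for \<xi>
    using pos[of \<xi>] by (simp add: \<rho>_def vol[symmetric] volume_def)
  have smX: "smooth_on UNIV X" unfolding X_def by (rule sm(3))
  have d\<rho>: "(\<rho> has_real_derivative deriv \<rho> \<xi>) (at \<xi>)" and du: "(u has_real_derivative deriv u \<xi>) (at \<xi>)" for \<xi>
    unfolding \<rho>_def u_def by (intro smooth_on_real_derivative(1) sm(1,2))+
  have Xlim: "(X \<longlongrightarrow> (\<tau>\<^sub>L, s\<^sub>L)) at_bot" "(X \<longlongrightarrow> specific_state U\<^sub>R) at_top"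
    unfolding X_def
    using isCont_tendsto_compose[OF isCont_smooth_on_state_space[OF smooth_specific_state assms(2)] lims(1)]
      isCont_tendsto_compose[OF isCont_smooth_on_state_space[OF smooth_specific_state assms(3)] lims(2)] L(1) by simp_all
  have \<rho>lim: "(\<rho> \<longlongrightarrow> density U\<^sub>L) at_bot"
    unfolding \<rho>_def by (rule isCont_tendsto_compose[OF isCont_smooth_on_state_space[OF smooth_density assms(2)] lims(1)])
  have ulim: "(u \<longlongrightarrow> velocity U\<^sub>L) at_bot"
    unfolding u_def by (rule isCont_tendsto_compose[OF isCont_smooth_on_state_space[OF smooth_velocity assms(2)] lims(1)])
  note eqs = NS[unfolded navier_stokes_wave[OF smV sp], rule_format, folded \<rho>_def u_def, unfolded vol ent]
  have flux: "\<rho> \<xi> * (u \<xi> - \<sigma>) = m" for \<xi>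
  proof (rule zero_derivative_limit[where f = "\<lambda>\<xi>. \<rho> \<xi> * (u \<xi> - \<sigma>)"])
    fix \<xi>
    have "deriv (\<lambda>\<xi>. \<rho> \<xi> * u \<xi>) \<xi> = deriv \<rho> \<xi> * u \<xi> + deriv u \<xi> * \<rho> \<xi>"
      by (rule DERIV_imp_deriv[OF DERIV_mult[OF d\<rho> du]])
    moreover have "- \<sigma> * deriv \<rho> \<xi> + deriv (\<lambda>\<xi>. \<rho> \<xi> * u \<xi>) \<xi> = 0"
      using eqs[of \<xi>] by blast
    ultimately have "deriv \<rho> \<xi> * (u \<xi> - \<sigma>) + (deriv u \<xi> - 0) * \<rho> \<xi> = 0"
      by (simp add: algebra_simps)
    moreover have "((\<lambda>\<xi>. \<rho> \<xi> * (u \<xi> - \<sigma>)) has_real_derivative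
        deriv \<rho> \<xi> * (u \<xi> - \<sigma>) + (deriv u \<xi> - 0) * \<rho> \<xi>) (at \<xi>)"
      by (intro DERIV_mult DERIV_diff d\<rho> du DERIV_const)
    ultimately show "((\<lambda>\<xi>. \<rho> \<xi> * (u \<xi> - \<sigma>)) has_real_derivative 0) (at \<xi>)"
      by (simp only:)
  next
    have "density U\<^sub>L * (velocity U\<^sub>L - \<sigma>) = m"
    proof -
      have "\<tau>\<^sub>L = volume U\<^sub>L" using arg_cong[OF L(1), of fst] by simp
      then show ?thesis using L(2) volume_pos by (simp add: volume_def)
    qed
    then show "((\<lambda>\<xi>. \<rho> \<xi> * (u \<xi> - \<sigma>)) \<longlongrightarrow> m) at_bot"
      using tendsto_mult[OF \<rho>lim tendsto_diff[OF ulim tendsto_const[of \<sigma>]]] by simp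
  qed
  have u: "u \<xi> = \<sigma> + m * fst (X \<xi>)" for \<xi>
  proof -
    have "m * fst (X \<xi>) = (\<rho> \<xi> * fst (X \<xi>)) * (u \<xi> - \<sigma>)"
      unfolding flux[of \<xi>, symmetric] by (simp add: mult_ac)
    then show ?thesis by (simp add: \<rho>_vol)
  qed
  then show "wave_state \<sigma> m (specific_state (V \<xi>)) = V \<xi>"
    using wave_state_specific_state[OF sp, of \<xi> \<sigma> m] by (simp add: u_def vol)
  define X' where "X' \<xi> = vector_derivative X (at \<xi>)" for \<xi>
  have X': "(X has_vector_derivative X' \<xi>) (at \<xi>)" for \<xi>
    unfolding X'_def using smooth_on_differentiable[OF smX] by (simp add: vector_derivative_works[symmetric])
  define \<tau>' where "\<tau>' \<xi> = fst (X' \<xi>)" for \<xi>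
  have d\<tau>: "((\<lambda>\<xi>. fst (X \<xi>)) has_real_derivative \<tau>' \<xi>) (at \<xi>)" for \<xi>
    using bounded_linear.has_vector_derivative[OF bounded_linear_fst X']
    by (simp add: \<tau>'_def has_real_derivative_iff_has_vector_derivative)
  have ds: "((\<lambda>\<xi>. snd (X \<xi>)) has_vector_derivative snd (X' \<xi>)) (at \<xi>)" for \<xi>
    by (rule bounded_linear.has_vector_derivative[OF bounded_linear_snd X'])
  have deriv_u: "deriv u \<xi> = m * \<tau>' \<xi>" for \<xi>
    unfolding u[abs_def] using DERIV_imp_deriv[OF DERIV_add[OF DERIV_const DERIV_cmult[OF d\<tau>]]] by simp
  define W where "W \<xi> = total_viscosity (X \<xi>) * (m * \<tau>' \<xi>)" for \<xi>
  have G_eq: "G (X \<xi>) = \<epsilon> * W \<xi>" for \<xi>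
  proof -
    have dG: "((\<lambda>\<xi>. G (X \<xi>)) has_real_derivative deriv (\<lambda>\<xi>. G (X \<xi>)) \<xi>) (at \<xi>)" for \<xi>
    proof -
      have "\<exists>g. ((\<lambda>\<xi>. G (X \<xi>)) has_real_derivative g) (at \<xi>)"
        using has_real_derivative_G[OF d\<tau> ds pos, of \<xi>] by auto
      then show ?thesis using DERIV_imp_deriv by blast
    qed
    have "smooth_on UNIV W"
    proof -
      have "smooth_on UNIV (\<lambda>\<xi>. total_viscosity (X \<xi>))"
        by (rule smooth_on_compose[OF smooth_total_viscosity smX open_UNIV open_\<Omega>])
          (simp only: image_subset_iff X\<Omega> ball_simps simp_thms)
      moreover have "smooth_on UNIV (deriv u)"
        unfolding u_def by (rule smooth_on_real_derivative(2)[OF sm(2)])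
      ultimately show ?thesis
        unfolding W_def deriv_u[symmetric] by (intro smooth_on_mult open_UNIV)
    qed
    from smooth_on_real_derivative(1)[OF this]
    have dW: "(W has_real_derivative deriv W \<xi>) (at \<xi>)" for \<xi> .
    have mom: "deriv (\<lambda>\<xi>. G (X \<xi>)) \<xi> = \<epsilon> * deriv W \<xi>" for \<xi>
    proof -
      have "\<rho> \<xi> * (u \<xi>)\<^sup>2 + (\<Sum>i\<in>UNIV. pressure (e i) (fst (X \<xi>)) (snd (X \<xi>) $ i))
          = \<sigma> * (\<rho> \<xi> * u \<xi>) + (G (X \<xi>) + (m * \<sigma> + m\<^sup>2 * \<tau>\<^sub>L + total_pressure (\<tau>\<^sub>L, s\<^sub>L)))" for \<xi>
      proof -
        have "\<rho> \<xi> * (u \<xi>)\<^sup>2 = \<sigma> * (\<rho> \<xi> * u \<xi>) + (\<rho> \<xi> * (u \<xi> - \<sigma>)) * u \<xi>"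
          by (simp add: power2_eq_square algebra_simps)
        also have "\<dots> = \<sigma> * (\<rho> \<xi> * u \<xi>) + m * (\<sigma> + m * fst (X \<xi>))"
          unfolding flux by (simp only: u)
        finally show ?thesis
          unfolding G_def total_pressure_def[of "X \<xi>"] by (simp add: power2_eq_square algebra_simps)
      qed
      then have "deriv (\<lambda>\<xi>. \<rho> \<xi> * (u \<xi>)\<^sup>2 + (\<Sum>i\<in>UNIV. pressure (e i) (fst (X \<xi>)) (snd (X \<xi>) $ i))) \<xi>
          = \<sigma> * deriv (\<lambda>\<xi>. \<rho> \<xi> * u \<xi>) \<xi> + (deriv (\<lambda>\<xi>. G (X \<xi>)) \<xi> + 0)"
        using DERIV_imp_deriv[OF DERIV_add[OF DERIV_cmult[OF DERIV_mult[OF d\<rho>[of \<xi>] du[of \<xi>]], of \<sigma>]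
            DERIV_add[OF dG[of \<xi>] DERIV_const[of "m * \<sigma> + m\<^sup>2 * \<tau>\<^sub>L + total_pressure (\<tau>\<^sub>L, s\<^sub>L)"]]]]
          DERIV_imp_deriv[OF DERIV_mult[OF d\<rho>[of \<xi>] du[of \<xi>]]] by presburger
      moreover have "(\<lambda>\<xi>. (\<Sum>i\<in>UNIV. \<mu> i (fst (X \<xi>)) (snd (X \<xi>) $ i)) * deriv u \<xi>) = W"
        by (simp add: fun_eq_iff W_def total_viscosity_def deriv_u)
      ultimately show ?thesis
        using eqs[of \<xi>] by simp
    qed
    \<comment> \<open>The integration constant of the momentum equation.\<close>
    define k where "k \<xi> = G (X \<xi>) - \<epsilon> * W \<xi>" for \<xi>
    have "(k has_real_derivative 0) (at \<xi>)" for \<xi>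
      unfolding k_def using DERIV_diff[OF dG[of \<xi>] DERIV_cmult[OF dW[of \<xi>], of \<epsilon>]] mom[of \<xi>] by simp
    then have const: "k \<xi> = k 0" for \<xi>
      using DERIV_isconst_all[of k \<xi> 0] by blast
    have Glim: "((\<lambda>\<xi>. G (X \<xi>)) \<longlongrightarrow> 0) at_bot"
      using isCont_tendsto_compose[OF isCont_smooth_on_\<Omega>[OF smooth_G] Xlim(1)] volume_pos by simp
    have Mlim: "((\<lambda>\<xi>. total_viscosity (X \<xi>)) \<longlongrightarrow> total_viscosity (\<tau>\<^sub>L, s\<^sub>L)) at_bot"
      using isCont_tendsto_compose[OF isCont_smooth_on_\<Omega>[OF smooth_total_viscosity] Xlim(1)] volume_pos by simp
    have visL: "total_viscosity (\<tau>\<^sub>L, s\<^sub>L) > 0"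
      using total_viscosity_pos'[of "(\<tau>\<^sub>L, s\<^sub>L)"] volume_pos by simp
    have \<tau>'_eq: "\<tau>' \<xi> = (G (X \<xi>) - k 0) / (\<epsilon> * m * total_viscosity (X \<xi>))" for \<xi>
      using const[of \<xi>] total_viscosity_pos'[OF pos[of \<xi>]] eps_pos flux_pos
      by (simp add: k_def W_def field_simps)
    \<comment> \<open>Once \<open>k\<close> is constant, \<open>\<tau>'\<close> is a function of the
      state and hence converges. Since the volume converges too, this limit is 0, which forces the
      constant to vanish.\<close>
    have "(\<tau>' \<longlongrightarrow> (0 - k 0) / (\<epsilon> * m * total_viscosity (\<tau>\<^sub>L, s\<^sub>L))) at_bot"
      unfolding \<tau>'_eq[abs_def] using visL eps_pos flux_pos
      by (intro tendsto_divide tendsto_diff tendsto_mult tendsto_const Glim Mlim) auto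
    from tendsto_derivative_at_bot[OF d\<tau> _ this] tendsto_fst[OF Xlim(1)]
    have "k 0 = 0" using visL eps_pos flux_pos by auto
    then show ?thesis using const[of \<xi>] by (simp add: k_def)
  qed
  have \<tau>'_h: "\<tau>' \<xi> = h (X \<xi>)" for \<xi>
    using G_eq[of \<xi>] total_viscosity_pos'[OF pos[of \<xi>]] eps_pos flux_pos
    by (simp add: h_def W_def)
  have s': "snd (X' \<xi>) $ i = h (X \<xi>) * F (X \<xi>) $ i" for \<xi> i
  proof -
    define E where "E \<xi> = e i (fst (X \<xi>)) (snd (X \<xi>) $ i)" for \<xi>
    let ?p = "pressure (e i) (fst (X \<xi>)) (snd (X \<xi>) $ i)" and ?T = "temperature (e i) (fst (X \<xi>)) (snd (X \<xi>) $ i)"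
      and ?m = "\<mu> i (fst (X \<xi>)) (snd (X \<xi>) $ i)" and ?s = "snd (X' \<xi>) $ i"
    have dE: "(E has_real_derivative ?T * ?s - ?p * \<tau>' \<xi>) (at \<xi>)"
      using has_real_derivative_partial[OF energy_smooth[of i] d\<tau>[of \<xi>] has_real_derivative_vec_nth[OF ds[of \<xi>]] pos[of \<xi>]]
      unfolding E_def by (simp add: temperature_def pressure_def algebra_simps)
    note dr = DERIV_mult[OF d\<rho> dE]
    \<comment> \<open>With constant mass flux the energy flux differs from \<sigma> times the energy
      density by \<open>m * E \<xi>\<close>, so the \<sigma> terms cancel and only the derivative of
      the specific energy survives.\<close>
    have "\<rho> \<xi> * u \<xi> * E \<xi> = \<sigma> * (\<rho> \<xi> * E \<xi>) + m * E \<xi>" for \<xi>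
      unfolding flux[of \<xi>, symmetric] by (simp add: algebra_simps)
    then have "deriv (\<lambda>\<xi>. \<rho> \<xi> * u \<xi> * E \<xi>) \<xi> = \<sigma> * deriv (\<lambda>\<xi>. \<rho> \<xi> * E \<xi>) \<xi> + m * (?T * ?s - ?p * \<tau>' \<xi>)"
      using DERIV_imp_deriv[OF DERIV_add[OF DERIV_cmult[OF dr, of \<sigma>] DERIV_cmult[OF dE, of m]]]
        DERIV_imp_deriv[OF dr] by presburger
    moreover have "- \<sigma> * deriv (\<lambda>\<xi>. \<rho> \<xi> * E \<xi>) \<xi> + deriv (\<lambda>\<xi>. \<rho> \<xi> * u \<xi> * E \<xi>) \<xi> + ?p * deriv u \<xi>
        = \<epsilon> * ?m * (deriv u \<xi>)\<^sup>2"
      unfolding E_def using eqs[of \<xi>] by blast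
    ultimately have "m * (?T * ?s) = \<epsilon> * ?m * (m * \<tau>' \<xi>)\<^sup>2"
      unfolding deriv_u by (simp add: algebra_simps)
    also have "\<dots> = m * (?m * \<tau>' \<xi> * (\<epsilon> * (m * \<tau>' \<xi>)))"
      by (simp add: power2_eq_square)
    also have "\<epsilon> * (m * \<tau>' \<xi>) = G (X \<xi>) / total_viscosity (X \<xi>)"
      using G_eq[of \<xi>] total_viscosity_pos'[OF pos[of \<xi>]] by (simp add: W_def)
    finally have "?T * ?s = ?m * \<tau>' \<xi> * (G (X \<xi>) / total_viscosity (X \<xi>))"
      using flux_pos by (metis less_irrefl mult_cancel_left)
    then have "?s = ?m * \<tau>' \<xi> * (G (X \<xi>) / total_viscosity (X \<xi>)) / ?T"
      using temperature_pos[OF pos[of \<xi>], of i "snd (X \<xi>) $ i"]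
      by (metis less_irrefl nonzero_mult_div_cancel_left)
    then show ?thesis
      by (simp add: F_def \<tau>'_h[symmetric] mult_ac)
  qed
  have "X' \<xi> = \<Phi> (X \<xi>)" for \<xi>
    using \<tau>'_h[of \<xi>] s'[of \<xi>] by (simp add: \<Phi>_def prod_eq_iff vec_eq_iff \<tau>'_def)
  then have der: "(X has_vector_derivative \<Phi> (X \<xi>)) (at \<xi>)" for \<xi>
    using X' by metis
  have "\<not> X constant_on UNIV"
  proof
    assume "X constant_on UNIV"
    then obtain c where c: "\<And>\<xi>. X \<xi> = c" by (auto simp: constant_on_def)
    have "V \<xi> = wave_state \<sigma> m c" for \<xi>
      using wave_state_specific_state[OF sp, of \<xi> \<sigma> m] u[of \<xi>] c[of \<xi>] by (simp add: u_def vol X_def[symmetric])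
    then show False using nc unfolding constant_on_def by blast
  qed
  then show "profile (\<lambda>\<xi>. specific_state (V \<xi>)) (specific_state U\<^sub>R)"
    using X\<Omega> der Xlim specific_state_mem[OF assms(3)] unfolding profile_def X_def by blast
qed

end

theorem theorem4p2:
  fixes e \<mu> :: "'n::finite \<Rightarrow> real \<Rightarrow> real \<Rightarrow> real"
    and \<epsilon> \<sigma> :: real
    and U\<^sub>L :: "'n state"
  assumes "multi_pressure_laws e \<mu>"
    and "\<epsilon> > 0"
    and "U\<^sub>L \<in> state_space"
    and "(velocity U\<^sub>L - \<sigma>) / sound_speed e U\<^sub>L > 1"
  shows "\<exists>V.
    (\<exists>U\<^sub>R\<in>state_space.
       traveling_wave e \<mu> \<epsilon> \<sigma> U\<^sub>L U\<^sub>R V \<and>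
       0 < (velocity U\<^sub>R - \<sigma>) / sound_speed e U\<^sub>R \<and>
       (velocity U\<^sub>R - \<sigma>) / sound_speed e U\<^sub>R < 1) \<and>
    (\<forall>V'.
       (\<exists>U\<^sub>R'\<in>state_space.
          traveling_wave e \<mu> \<epsilon> \<sigma> U\<^sub>L U\<^sub>R' V' \<and>
          0 < (velocity U\<^sub>R' - \<sigma>) / sound_speed e U\<^sub>R' \<and>
          (velocity U\<^sub>R' - \<sigma>) / sound_speed e U\<^sub>R' < 1) \<longrightarrow>
       (\<exists>a. \<forall>\<xi>. V' \<xi> = V (\<xi> + a)))"
proof -
  interpret multi_pressure_laws e \<mu> by fact
  define m where "m = density U\<^sub>L * (velocity U\<^sub>L - \<sigma>)"
  define \<tau>\<^sub>L where "\<tau>\<^sub>L = volume U\<^sub>L"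
  define s\<^sub>L where "s\<^sub>L = snd (specific_state U\<^sub>L)"
  have L: "specific_state U\<^sub>L = (\<tau>\<^sub>L, s\<^sub>L)" by (simp add: \<tau>\<^sub>L_def s\<^sub>L_def prod_eq_iff)
  have "density U\<^sub>L > 0" using assms(3) by (simp add: state_space_def density_def)
  then have \<tau>\<^sub>L: "\<tau>\<^sub>L > 0" and uL: "velocity U\<^sub>L = \<sigma> + m * \<tau>\<^sub>L"
    by (simp_all add: \<tau>\<^sub>L_def m_def volume_def)
  \<comment> \<open>The left sound speed divided by the left volume, so that the Lax inequality
    reads \<open>c < m\<close>; \<open>d\<close> plays the same part at the right state.\<close>
  define c where "c = sqrt (- total_pressure_slope (\<tau>\<^sub>L, s\<^sub>L))"
  have c: "c > 0" "c\<^sup>2 = - total_pressure_slope (\<tau>\<^sub>L, s\<^sub>L)"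
    using total_pressure_slope_neg[OF \<tau>\<^sub>L, of s\<^sub>L] by (simp_all add: c_def)
  have "sound_speed e U\<^sub>L = \<tau>\<^sub>L * c"
    by (simp add: sound_speed_eq[OF assms(3)] L c_def \<tau>\<^sub>L_def)
  then have "c < m"
    using assms(4) \<tau>\<^sub>L c(1) by (simp add: uL)
  then have "c\<^sup>2 < m\<^sup>2" "m > 0"
    using c(1) by (auto intro!: power_strict_mono)
  then interpret shock_profile e \<mu> \<epsilon> m \<tau>\<^sub>L s\<^sub>L
    using assms(2) \<tau>\<^sub>L c(2) by unfold_locales auto
  obtain X R where X: "profile X R" "total_pressure_slope R + m\<^sup>2 < 0"
    "\<And>Y R'. profile Y R' \<Longrightarrow> \<exists>a. \<forall>\<xi>. Y \<xi> = X (\<xi> + a)"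
    using profile_exists_unique by metis
  have R: "fst R > 0" using X(1) by (simp add: profile_def mem_Times_iff)
  note R_simps = wave_state_simps[OF R, of \<sigma> m]
  have wL: "wave_state \<sigma> m (\<tau>\<^sub>L, s\<^sub>L) = U\<^sub>L"
    using wave_state_specific_state[OF assms(3), of \<sigma> m] uL L by (simp add: \<tau>\<^sub>L_def)
  define d where "d = sqrt (- total_pressure_slope R)"
  have d: "m < d" unfolding d_def using X(2) by (intro real_less_rsqrt) simp
  have "(velocity (wave_state \<sigma> m R) - \<sigma>) / sound_speed e (wave_state \<sigma> m R) = m / d"
    using R by (simp add: sound_speed_eq R_simps d_def)
  moreover have "0 < m / d" "m / d < 1" using d \<open>m > 0\<close> by simp_all
  moreover note profile_traveling_wave[OF X(1), of \<sigma>, unfolded wL] R_simps(5)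
  moreover have "\<exists>a. \<forall>\<xi>. V' \<xi> = wave_state \<sigma> m (X (\<xi> + a))"
    if "U\<^sub>R' \<in> state_space" "traveling_wave e \<mu> \<epsilon> \<sigma> U\<^sub>L U\<^sub>R' V'" for V' U\<^sub>R'
  proof -
    note tw = traveling_wave_profile[OF that(2) assms(3) that(1) L uL]
    from X(3)[OF tw(1)] obtain a where "\<And>\<xi>. specific_state (V' \<xi>) = X (\<xi> + a)" by blast
    with tw(2) show ?thesis by metis
  qed
  ultimately show ?thesis
    by (intro exI[of _ "\<lambda>\<xi>. wave_state \<sigma> m (X \<xi>)"] conjI bexI[of _ "wave_state \<sigma> m R"] allI impI)
      (simp_all, blast)
qed

end
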